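(* Let $(U,\Sigma,\mu)$ be a $\sigma$-finite measure space with a full ordered core $\mathcal A$. Then $(L^1_\mu,L^\infty_\mu\!\!\downarrow)$ is an exact Calder\'on couple.
   Context: Functions equal $\mu$-a.e. are identified. An ordered core of $(U,\Sigma,\mu)$ is a subset $\mathcal A\subseteq\Sigma$, totally ordered by inclusion, containing $\emptyset$, whose members all have finite $\mu$-measure. It is $\sigma$-bounded if $\bigcup\mathcal A=\bigcup\mathcal A_0$ for some countable $\mathcal A_0\subseteq\mathcal A$, and full if it is $\sigma$-bounded and $\bigcup\mathcal A=U$. $\sigma(\mathcal A)$ is the $\sigma$-ring generated by $\mathcal A$ (a $\sigma$-algebra on $U$ when $\mathcal A$ is full). Write $u\le_{\mathcal A}v$ if for all $A\in\mathcal A$, $v\in A$ implies $u\in A$. $L^\downarrow(\mathcal A)$ is the set of core decreasing functions: $\sigma(\mathcal A)$-measurable $f:U\to[0,\infty]$ with $f(u)\ge f(v)$ whenever $u\le_{\mathcal A}v$. $L^\infty_\mu\!\!\downarrow$ is the Banach space of $\Sigma$-measurable $f:U\to[-\infty,\infty]$ for which $\|f\|_{L^\infty_\mu\!\downarrow}=\sup\{\int_U|f|g\,d\mu:g\in L^1_\mu\cap L^\downarrow(\mathcal A),\ \|g\|_{L^1_\mu}\le1\}$ is finite. For a compatible couple $(X_0,X_1)$ of Banach spaces, $K(f,t;X_0,X_1)=\inf\{\|f_0\|_{X_0}+t\|f_1\|_{X_1}:f_0+f_1=f\}$ for $f\in X_0+X_1$, $t>0$. An admissible contraction from $(X_0,X_1)$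 to itself is a linear map on $X_0+X_1$ whose restriction to each $X_j$ is a bounded map $X_j\to X_j$ of norm at most $1$, $j=0,1$. The couple is an exact Calder\'on couple if whenever $f,g\in X_0+X_1$ satisfy $K(f,t;X_0,X_1)\le K(g,t;X_0,X_1)$ for all $t>0$, there is an admissible contraction from $(X_0,X_1)$ to itself that maps $g$ to $f$. *)

theory Defs
  imports "HOL-Analysis.Analysis"
begin

section \<open>Ordered cores\<close>

definition ordered_core :: "'a measure \<Rightarrow> 'a set set \<Rightarrow> bool" where
  "ordered_core M \<A> \<longleftrightarrow>
     \<A> \<subseteq> sets M \<and> chain\<^sub>\<subseteq> \<A> \<and> {} \<in> \<A> \<and> (\<forall>A\<in>\<A>. emeasure M A < \<infinity>)"

definition sigma_bounded_core :: "'a measure \<Rightarrow> 'a set set \<Rightarrow> bool" where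
  "sigma_bounded_core M \<A> \<longleftrightarrow>
     ordered_core M \<A> \<and> (\<exists>\<A>\<^sub>0\<subseteq>\<A>. countable \<A>\<^sub>0 \<and> \<Union>\<A> = \<Union>\<A>\<^sub>0)"

definition full_core :: "'a measure \<Rightarrow> 'a set set \<Rightarrow> bool" where
  "full_core M \<A> \<longleftrightarrow> sigma_bounded_core M \<A> \<and> \<Union>\<A> = space M"

inductive_set sigma_ring_sets :: "'a set set \<Rightarrow> 'a set set" for \<A> where
  Basic: "A \<in> \<A> \<Longrightarrow> A \<in> sigma_ring_sets \<A>"
| Empty: "{} \<in> sigma_ring_sets \<A>"
| Diff: "A \<in> sigma_ring_sets \<A> \<Longrightarrow> B \<in> sigma_ring_sets \<A> \<Longrightarrow> A - B \<in> sigma_ring_sets \<A>"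
| Union: "(\<And>i::nat. A i \<in> sigma_ring_sets \<A>) \<Longrightarrow> (\<Union>i. A i) \<in> sigma_ring_sets \<A>"

definition core_le :: "'a set set \<Rightarrow> 'a \<Rightarrow> 'a \<Rightarrow> bool" where
  "core_le \<A> u v \<longleftrightarrow> (\<forall>A\<in>\<A>. v \<in> A \<longrightarrow> u \<in> A)"

text \<open>
  A function into \<open>[0,\<infinity>]\<close> is measurable with respect to a \<open>\<sigma>\<close>-ring if all its strict superlevel
  sets belong to it. For a full core the \<open>\<sigma>\<close>-ring is a \<open>\<sigma>\<close>-algebra on the whole space, and this
  is ordinary measurability; see \<open>core_measurable_iff\<close> below.
\<close>

definition core_measurable :: "'a measure \<Rightarrow> 'a set set \<Rightarrow> ('a \<Rightarrow> ennreal) \<Rightarrow> bool" where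
  "core_measurable M \<A> f \<longleftrightarrow> (\<forall>c. {u \<in> space M. c < f u} \<in> sigma_ring_sets \<A>)"

definition core_decreasing :: "'a measure \<Rightarrow> 'a set set \<Rightarrow> ('a \<Rightarrow> ennreal) set" where
  "core_decreasing M \<A> = {f. core_measurable M \<A> f \<and>
     (\<forall>u\<in>space M. \<forall>v\<in>space M. core_le \<A> u v \<longrightarrow> f v \<le> f u)}"

lemma sigma_ring_sets_full:
  assumes "full_core M \<A>"
  shows "sigma_ring_sets \<A> = sigma_sets (space M) \<A>"
proof -
  obtain \<A>0 where a0: "\<A>0 \<subseteq> \<A>" "countable \<A>0" "\<Union>\<A>0 = space M"
    using assms by (auto simp: full_core_def sigma_bounded_core_def)
  have sub: "\<A> \<subseteq> Pow (space M)"
    using assms by (auto simp: full_core_def)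
  have e: "{} \<in> \<A>"
    using assms by (auto simp: full_core_def sigma_bounded_core_def ordered_core_def)
  have "(\<Union>i. from_nat_into (insert {} \<A>0) i) \<in> sigma_ring_sets \<A>"
  proof (rule sigma_ring_sets.Union)
    fix i show "from_nat_into (insert {} \<A>0) i \<in> sigma_ring_sets \<A>"
      using from_nat_into[of "insert {} \<A>0" i] a0 e by (auto intro: sigma_ring_sets.Basic)
  qed
  moreover have "range (from_nat_into (insert {} \<A>0)) = insert {} \<A>0"
    using a0(2) by (intro range_from_nat_into) auto
  ultimately have U: "space M \<in> sigma_ring_sets \<A>" using a0(3) by auto
  interpret S: sigma_algebra "space M" "sigma_sets (space M) \<A>"
    using sub by (rule sigma_algebra_sigma_sets)
  have "A \<in> sigma_sets (space M) \<A>" if "A \<in> sigma_ring_sets \<A>" for A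
    using that by induction auto
  moreover have "A \<in> sigma_ring_sets \<A>" if "A \<in> sigma_sets (space M) \<A>" for A
    using that by induction (auto intro: sigma_ring_sets.intros U)
  ultimately show ?thesis by blast
qed

lemma core_measurable_iff:
  assumes "full_core M \<A>"
  shows "core_measurable M \<A> f \<longleftrightarrow> f \<in> borel_measurable (sigma (space M) \<A>)"
proof -
  let ?S = "sigma (space M) \<A>"
  have sets: "sets ?S = sigma_ring_sets \<A>"
    unfolding sigma_ring_sets_full[OF assms]
    using assms by (intro sets_measure_of) (auto simp: full_core_def)
  have space: "space ?S = space M" by (simp add: space_measure_of_conv)
  show ?thesis
  proof
    assume "core_measurable M \<A> f"
    then show "f \<in> borel_measurable ?S"
      by (intro borel_measurableI_greater) (auto simp: core_measurable_def sets space)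
  next
    assume [measurable]: "f \<in> borel_measurable ?S"
    have "{u \<in> space ?S. c < f u} \<in> sets ?S" for c
      using borel_measurable_less[of "\<lambda>_. c" ?S f] by simp
    then show "core_measurable M \<A> f" by (simp add: core_measurable_def sets space)
  qed
qed


section \<open>Spaces of measurable functions\<close>

text \<open>
  A normed space of extended real valued functions is a set of representatives paired with a norm.
  Elements are identified when they agree almost everywhere, so every equation between
  functions below is an equation almost everywhere. Members of the two spaces considered
  here are finite almost everywhere (for \<open>Linf_down\<close>, see \<open>Linf_down_AE_finite\<close>), hence the values
  of \<^typ>\<open>ereal\<close> arithmetic at \<open>\<infinity> - \<infinity>\<close> are irrelevant.
\<close>

type_synonym 'a fspace = "('a \<Rightarrow> ereal) set \<times> (('a \<Rightarrow> ereal) \<Rightarrow> ennreal)"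

definition L1_norm :: "'a measure \<Rightarrow> ('a \<Rightarrow> ereal) \<Rightarrow> ennreal" where
  "L1_norm M f = (\<integral>\<^sup>+u. e2ennreal \<bar>f u\<bar> \<partial>M)"

definition L1 :: "'a measure \<Rightarrow> 'a fspace" where
  "L1 M = ({f \<in> borel_measurable M. L1_norm M f < \<infinity>}, L1_norm M)"

definition Linf_down_norm :: "'a measure \<Rightarrow> 'a set set \<Rightarrow> ('a \<Rightarrow> ereal) \<Rightarrow> ennreal" where
  "Linf_down_norm M \<A> f =
     (SUP g \<in> {g \<in> core_decreasing M \<A>. (\<integral>\<^sup>+u. g u \<partial>M) \<le> 1}. \<integral>\<^sup>+u. e2ennreal \<bar>f u\<bar> * g u \<partial>M)"

definition Linf_down :: "'a measure \<Rightarrow> 'a set set \<Rightarrow> 'a fspace" where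
  "Linf_down M \<A> =
     ({f \<in> borel_measurable M. Linf_down_norm M \<A> f < \<infinity>}, Linf_down_norm M \<A>)"

lemma Linf_down_AE_finite:
  assumes full: "full_core M \<A>" and f: "f \<in> fst (Linf_down M \<A>)"
  shows "AE u in M. \<bar>f u\<bar> \<noteq> \<infinity>"
proof -
  have fm [measurable]: "f \<in> borel_measurable M" and fin: "Linf_down_norm M \<A> f < \<infinity>"
    using f by (auto simp: Linf_down_def)
  obtain \<A>0 where a0: "\<A>0 \<subseteq> \<A>" "countable \<A>0" "\<Union>\<A>0 = space M"
    using full by (auto simp: full_core_def sigma_bounded_core_def)
  have core: "\<A> \<subseteq> sets M" "\<And>A. A \<in> \<A> \<Longrightarrow> emeasure M A < \<infinity>"
    using full by (auto simp: full_core_def sigma_bounded_core_def ordered_core_def)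
  have "AE u in M. u \<in> A \<longrightarrow> \<bar>f u\<bar> \<noteq> \<infinity>" if A: "A \<in> \<A>" for A
  proof (cases "emeasure M A = 0")
    case True
    then have "A \<in> null_sets M" using A core by (intro null_setsI) auto
    from AE_not_in[OF this] show ?thesis by eventually_elim auto
  next
    case False
    define m where "m = emeasure M A"
    have m: "m \<noteq> 0" "m \<noteq> \<infinity>" using False core(2)[OF A] by (auto simp: m_def)
    have [measurable]: "A \<in> sets M" using A core by auto
    have AU: "A \<in> sets (sigma (space M) \<A>)"
      using A full by (subst sets_measure_of) (auto simp: full_core_def)
    define g :: "'a \<Rightarrow> ennreal" where "g = (\<lambda>u. inverse m * indicator A u)"
    have "core_measurable M \<A> g"
      unfolding core_measurable_iff[OF full] g_def using AU by measurable
    moreover have "g v \<le> g u" if "core_le \<A> u v" for u v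
      using that A by (auto simp: g_def core_le_def indicator_def)
    ultimately have "g \<in> core_decreasing M \<A>" by (auto simp: core_decreasing_def)
    moreover have "(\<integral>\<^sup>+u. g u \<partial>M) = 1"
    proof -
      have "(\<integral>\<^sup>+u. g u \<partial>M) = inverse m * m"
        unfolding g_def m_def by (subst nn_integral_cmult_indicator) auto
      also have "\<dots> = m / m" by (simp only: divide_ennreal_def mult.commute)
      also have "\<dots> = 1" using m by (intro ennreal_divide_self) (auto simp: less_top)
      finally show ?thesis .
    qed
    ultimately have "(\<integral>\<^sup>+u. e2ennreal \<bar>f u\<bar> * g u \<partial>M) \<le> Linf_down_norm M \<A> f"
      unfolding Linf_down_norm_def by (intro SUP_upper) auto
    then have "(\<integral>\<^sup>+u. e2ennreal \<bar>f u\<bar> * g u \<partial>M) \<noteq> \<infinity>" using fin by (auto simp: top_unique)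
    then have "AE u in M. e2ennreal \<bar>f u\<bar> * g u \<noteq> \<infinity>"
      by (intro nn_integral_PInf_AE) (auto simp: g_def)
    then show ?thesis
    proof eventually_elim
      case (elim u)
      then show ?case using m
        by (auto simp: g_def ennreal_top_mult e2ennreal_infty)
    qed
  qed
  then have "AE u in M. \<forall>A\<in>\<A>0. u \<in> A \<longrightarrow> \<bar>f u\<bar> \<noteq> \<infinity>"
    using a0 by (subst AE_ball_countable) auto
  then show ?thesis
    using AE_space
  proof eventually_elim
    case (elim u)
    have "u \<in> \<Union>\<A>0" using elim(2) a0(3) by simp
    then obtain A where "A \<in> \<A>0" "u \<in> A" by (rule UnionE)
    with elim(1) show ?case by auto
  qed
qed


section \<open>Couples of function spaces\<close>

definition sum_space :: "'a measure \<Rightarrow> 'a fspace \<Rightarrow> 'a fspace \<Rightarrow> ('a \<Rightarrow> ereal) set" where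
  "sum_space M X\<^sub>0 X\<^sub>1 = {f \<in> borel_measurable M.
     \<exists>f\<^sub>0\<in>fst X\<^sub>0. \<exists>f\<^sub>1\<in>fst X\<^sub>1. AE u in M. f\<^sub>0 u + f\<^sub>1 u = f u}"

definition K_functional ::
    "'a measure \<Rightarrow> 'a fspace \<Rightarrow> 'a fspace \<Rightarrow> ('a \<Rightarrow> ereal) \<Rightarrow> real \<Rightarrow> ennreal" where
  "K_functional M X\<^sub>0 X\<^sub>1 f t = Inf {snd X\<^sub>0 f\<^sub>0 + ennreal t * snd X\<^sub>1 f\<^sub>1 | f\<^sub>0 f\<^sub>1.
     f\<^sub>0 \<in> fst X\<^sub>0 \<and> f\<^sub>1 \<in> fst X\<^sub>1 \<and> (AE u in M. f\<^sub>0 u + f\<^sub>1 u = f u)}"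

text \<open>
  The second clause says that \<open>T\<close> is well defined on classes modulo equality almost everywhere.
\<close>

definition linear_on_sum_space ::
    "'a measure \<Rightarrow> 'a fspace \<Rightarrow> 'a fspace \<Rightarrow> (('a \<Rightarrow> ereal) \<Rightarrow> ('a \<Rightarrow> ereal)) \<Rightarrow> bool" where
  "linear_on_sum_space M X\<^sub>0 X\<^sub>1 T \<longleftrightarrow>
     T ` sum_space M X\<^sub>0 X\<^sub>1 \<subseteq> sum_space M X\<^sub>0 X\<^sub>1 \<and>
     (\<forall>f\<in>sum_space M X\<^sub>0 X\<^sub>1. \<forall>g\<in>sum_space M X\<^sub>0 X\<^sub>1.
        (AE u in M. f u = g u) \<longrightarrow> (AE u in M. T f u = T g u)) \<and>
     (\<forall>f\<in>sum_space M X\<^sub>0 X\<^sub>1. \<forall>g\<in>sum_space M X\<^sub>0 X\<^sub>1. \<forall>a b :: real.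
        AE u in M. T (\<lambda>v. ereal a * f v + ereal b * g v) u = ereal a * T f u + ereal b * T g u)"

definition contraction_on :: "'a fspace \<Rightarrow> (('a \<Rightarrow> ereal) \<Rightarrow> ('a \<Rightarrow> ereal)) \<Rightarrow> bool" where
  "contraction_on X T \<longleftrightarrow> (\<forall>f\<in>fst X. T f \<in> fst X \<and> snd X (T f) \<le> snd X f)"

definition admissible_contraction ::
    "'a measure \<Rightarrow> 'a fspace \<Rightarrow> 'a fspace \<Rightarrow> (('a \<Rightarrow> ereal) \<Rightarrow> ('a \<Rightarrow> ereal)) \<Rightarrow> bool" where
  "admissible_contraction M X\<^sub>0 X\<^sub>1 T \<longleftrightarrow>
     linear_on_sum_space M X\<^sub>0 X\<^sub>1 T \<and> contraction_on X\<^sub>0 T \<and> contraction_on X\<^sub>1 T"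

definition exact_calderon_couple :: "'a measure \<Rightarrow> 'a fspace \<Rightarrow> 'a fspace \<Rightarrow> bool" where
  "exact_calderon_couple M X\<^sub>0 X\<^sub>1 \<longleftrightarrow>
     (\<forall>f\<in>sum_space M X\<^sub>0 X\<^sub>1. \<forall>g\<in>sum_space M X\<^sub>0 X\<^sub>1.
        (\<forall>t>0. K_functional M X\<^sub>0 X\<^sub>1 f t \<le> K_functional M X\<^sub>0 X\<^sub>1 g t) \<longrightarrow>
        (\<exists>T. admissible_contraction M X\<^sub>0 X\<^sub>1 T \<and> (AE u in M. T g u = f u)))"

end

theory Submission
  imports Defs
begin

text \<open>
  For a measurable function \<open>h\<close> and \<open>A \<in> \<A>\<close> write \<open>H(A) = \<integral>\<^sub>A \<bar>h\<bar> d\<mu>\<close>, and in the same way \<open>F\<close> and \<open>G\<close>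
  for \<open>f\<close> and \<open>g\<close>. Both the norm of \<open>L\<^sup>\<infinity>\<down>\<close> and the K-functional see \<open>h\<close> only through the points
  \<open>(\<mu>(A), H(A))\<close> of the plane. The norm is the least slope \<open>C\<close> such that all points lie below the
  line \<open>x \<mapsto> C x\<close> (\<open>core_integral_le_norm\<close>, \<open>Linf_down_norm_leI\<close>). The K-functional at \<open>\<mu>(A)\<close> is at
  least \<open>H(A)\<close> (\<open>core_integral_le_K\<close>), and \<open>K(h, t) \<le> p + c t\<close> whenever \<open>p, c \<ge> 0\<close> and the line
  \<open>x \<mapsto> p + c x\<close> lies above all the points (\<open>K_le_line\<close>). Hence \<open>K(f, \<cdot>) \<le> K(g, \<cdot>)\<close> forces every
  such line above the points of \<open>g\<close> to be above the points of \<open>f\<close> (\<open>K_le_imp_majorants\<close>): \<open>F\<close> is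
  bounded by the least concave majorant of \<open>G\<close>.

  This allows the mass \<open>\<bar>g\<bar>\<mu>\<close> to be moved onto \<open>\<bar>f\<bar>\<mu>\<close> in two steps that are harmless for both
  norms. Mass is first averaged along the edges of the concave majorant of \<open>G\<close>, which replaces \<open>H\<close>
  by a linear interpolation between vertices and so keeps it below the line \<open>C x\<close>; then it is only
  moved upwards in the core order, or deleted, which increases no \<open>H(A)\<close>. For a finite part of the
  core this is an explicit finite sum (\<open>finite_transport\<close>), with a factor \<open>r < 1\<close> of slack that pays
  for replacing the whole core by finitely many of its members.

  Passing to the limit by Tychonoff's theorem (\<open>exact_transport\<close>) yields for each \<open>h \<ge> 0\<close> a finitely
  additive set function \<open>\<Lambda> h\<close>. It need not be a measure, since a limit of transports may
  concentrate mass. But the largest measure below a finitely additive set function depends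
  additively on it (\<open>emeasure_sigma_part_add\<close>), respects all upper bounds, and loses nothing for
  \<open>h = \<bar>g\<bar>\<close>, where \<open>\<Lambda> h\<close> already is the measure \<open>\<bar>f\<bar>\<mu>\<close> on the members of the core. The
  Radon-Nikodym density of this measure is a positive operator \<open>P\<close> with \<open>P \<bar>g\<bar> = \<bar>f\<bar>\<close>, and
  \<open>k \<mapsto> sgn f \<cdot> P (sgn g \<cdot> k)\<close> is the contraction sought.

  The upper bound for the K-functional rests on the same principle: a function whose points lie
  below \<open>p + c x\<close> splits into a part of integral at most \<open>p\<close> and a part of norm at most \<open>c\<close>; for
  finitely many core sets the splitting is explicit, and the general case is a limit
  (\<open>finite_majorized_split\<close>, \<open>majorized_split\<close>).
\<close>

section \<open>Finitely additive set functions and their limits\<close>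

lemma compact_UNIV_fun: "compact (UNIV :: ('i \<Rightarrow> ennreal) set)"
proof -
  have "compact_space (product_topology (\<lambda>i::'i. euclidean :: ennreal topology) UNIV)"
    by (subst compact_space_product_topology)
       (simp add: compact_UNIV compact_space_def[of euclidean, simplified topspace_euclidean])
  then show ?thesis
    by (simp only: euclidean_product_topology compact_space_def compactin_euclidean_iff topspace_euclidean)
qed

text \<open>
  The values lie in the compact space \<open>[0, \<infinity>]\<close>, so by Tychonoff's theorem the net has a cluster
  point in the product, and a finer filter converges to it in all coordinates at once. Refining the
  filter replaces the choice of an ultrafilter.
\<close>

lemma convergent_subfilter:
  fixes X :: "'n \<Rightarrow> 'i \<Rightarrow> ennreal"
  assumes "F \<noteq> bot"
  obtains F' L where "F' \<le> F" "F' \<noteq> bot" "\<forall>i. ((\<lambda>n. X n i) \<longlongrightarrow> L i) F'"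
proof -
  have "filtermap X F \<noteq> bot" using assms by (simp add: filtermap_bot_iff)
  then obtain L where L: "inf (nhds L) (filtermap X F) \<noteq> bot"
    using compact_UNIV_fun[where 'i='i] unfolding compact_filter by (metis UNIV_I always_eventually)
  define F' where "F' = inf (filtercomap X (nhds L)) F"
  have "F' \<noteq> bot"
  proof
    assume "F' = bot"
    then have "eventually (\<lambda>_. False) (inf (filtercomap X (nhds L)) F)" by (simp add: F'_def)
    then obtain P Q where PQ: "eventually P (filtercomap X (nhds L))" "eventually Q F"
      "\<And>n. P n \<and> Q n \<Longrightarrow> False"
      unfolding eventually_inf by blast
    then obtain P' where P': "eventually P' (nhds L)" "\<And>n. P' (X n) \<Longrightarrow> P n"
      by (auto simp: eventually_filtercomap)
    have "eventually (\<lambda>n. \<not> P' (X n)) F"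
      using PQ(2) by eventually_elim (use P'(2) PQ(3) in blast)
    then have "eventually (\<lambda>x. \<not> P' x) (filtermap X F)" by (simp add: eventually_filtermap)
    with P'(1) have "eventually (\<lambda>_. False) (inf (nhds L) (filtermap X F))"
      unfolding eventually_inf by (intro exI[of _ P'] exI[of _ "\<lambda>x. \<not> P' x"]) auto
    then show False using L by (simp add: trivial_limit_def)
  qed
  moreover have "((\<lambda>n. X n i) \<longlongrightarrow> L i) F'" for i
  proof -
    have "filterlim X (nhds L) (filtercomap X (nhds L))" by (rule filterlim_filtercomap)
    then have "(X \<longlongrightarrow> L) F'" by (rule filterlim_mono) (auto simp: F'_def)
    then show ?thesis
      by (rule continuous_on_tendsto_compose[OF continuous_on_product_coordinates]) auto
  qed
  moreover have "F' \<le> F" by (simp add: F'_def)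
  ultimately show ?thesis using that by blast
qed

definition content :: "'a measure \<Rightarrow> ('a set \<Rightarrow> ennreal) \<Rightarrow> bool" where
  "content M \<nu> \<longleftrightarrow> \<nu> {} = 0 \<and>
     (\<forall>D\<in>sets M. \<forall>E\<in>sets M. D \<inter> E = {} \<longrightarrow> \<nu> (D \<union> E) = \<nu> D + \<nu> E)"

text \<open>
  The infimum of \<open>\<Sum>i. \<nu> (A i)\<close> over countable measurable covers is the Yosida-Hewitt countably additive
  part of a finitely additive \<open>\<nu>\<close>. In this form Caratheodory's construction proves that it is a measure.
\<close>

definition sigma_part :: "'a measure \<Rightarrow> ('a set \<Rightarrow> ennreal) \<Rightarrow> 'a measure" where
  "sigma_part M \<nu> = measure_of (space M) (sets M) (outer_measure (sets M) \<nu>)"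

lemma sets_sigma_part [simp, measurable_cong]: "sets (sigma_part M \<nu>) = sets M"
  by (simp add: sigma_part_def)

lemma space_sigma_part [simp]: "space (sigma_part M \<nu>) = space M"
  by (simp add: sigma_part_def)

lemma content_properties:
  assumes "content M \<nu>"
  shows "positive (sets M) \<nu>" "additive (sets M) \<nu>" "increasing (sets M) \<nu>"
proof -
  show p: "positive (sets M) \<nu>" and a: "additive (sets M) \<nu>"
    using assms by (auto simp: content_def positive_def additive_def)
  then show "increasing (sets M) \<nu>" by (intro sets.additive_increasing)
qed

lemma emeasure_sigma_part:
  assumes "content M \<nu>" "E \<in> sets M"
  shows "emeasure (sigma_part M \<nu>) E = outer_measure (sets M) \<nu> E"
proof -
  note c = content_properties[OF assms(1)]
  have "measure_space (space M) (lambda_system (space M) (Pow (space M)) (outer_measure (sets M) \<nu>))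
     (outer_measure (sets M) \<nu>)"
    by (rule sigma_algebra.caratheodory_lemma[OF sigma_algebra_Pow
        sets.outer_measure_space_outer_measure[OF c(1) c(3)]])
  then have "measure_space (space M) (sets M) (outer_measure (sets M) \<nu>)"
    by (rule measure_down) (use sets.algebra_subset_lambda_system[OF c(1) c(3) c(2)] in
        \<open>auto simp: sets.sigma_algebra_axioms\<close>)
  then show ?thesis
    using assms(2) unfolding sigma_part_def measure_space_def
    by (intro emeasure_measure_of_sigma) auto
qed

lemma emeasure_sigma_part_le:
  assumes "content M \<nu>" "E \<in> sets M"
  shows "emeasure (sigma_part M \<nu>) E \<le> \<nu> E"
proof -
  note c = content_properties[OF assms(1)]
  have "outer_measure (sets M) \<nu> E \<le> (\<Sum>i. \<nu> (if i = (0::nat) then E else {}))"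
    by (rule sets.outer_measure_le[OF c(1) c(3)]) (use assms in \<open>auto split: if_splits\<close>)
  also have "\<dots> = \<nu> E"
    using assms(1) by (subst suminf_finite[of "{0}"]) (auto simp: content_def)
  finally show ?thesis by (simp add: emeasure_sigma_part[OF assms])
qed

text \<open>
  Where \<open>\<nu>\<close> is countably additive already, nothing is lost. Only the subsets of \<open>E\<close> matter, which
  is essential later: the limits of transports are known to be measures on subsets of core sets only.
\<close>

lemma emeasure_sigma_part_eq:
  assumes c: "content M \<nu>" and E: "E \<in> sets M" and N: "sets N = sets M"
    and eq: "\<And>D. D \<in> sets M \<Longrightarrow> D \<subseteq> E \<Longrightarrow> \<nu> D = emeasure N D"
  shows "emeasure (sigma_part M \<nu>) E = emeasure N E"
proof (rule antisym)
  show "emeasure (sigma_part M \<nu>) E \<le> emeasure N E"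
    using emeasure_sigma_part_le[OF c E] eq[OF E] by simp
  have "emeasure N E \<le> (\<Sum>i. \<nu> (A i))"
    if A: "range A \<subseteq> sets M" "E \<subseteq> (\<Union>i. A i)" for A :: "nat \<Rightarrow> 'a set"
  proof -
    have "emeasure N E = emeasure N (\<Union>i. A i \<inter> E)" using A(2) by (simp add: Int_absorb1 inf.absorb2)
    also have "\<dots> \<le> (\<Sum>i. emeasure N (A i \<inter> E))"
      using A(1) E N by (intro emeasure_subadditive_countably) auto
    also have "\<dots> = (\<Sum>i. \<nu> (A i \<inter> E))" using A(1) E by (subst eq) auto
    also have "\<dots> \<le> (\<Sum>i. \<nu> (A i))"
      using A(1) E content_properties(3)[OF c] by (intro suminf_le) (auto intro!: increasingD)
    finally show ?thesis .
  qed
  then show "emeasure N E \<le> emeasure (sigma_part M \<nu>) E"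
    unfolding emeasure_sigma_part[OF c E] outer_measure_def by (intro INF_greatest) auto
qed

lemma content_add:
  assumes "content M \<nu>\<^sub>1" "content M \<nu>\<^sub>2"
  shows "content M (\<lambda>E. \<nu>\<^sub>1 E + \<nu>\<^sub>2 E)"
  using assms by (auto simp: content_def algebra_simps)

lemma content_sum_le:
  assumes c: "content M \<nu>" and A: "\<And>i. A i \<in> sets M" "disjoint_family A" and D: "D \<in> sets M"
  shows "(\<Sum>i. \<nu> (D \<inter> A i)) \<le> \<nu> D"
proof (rule suminf_le_const[OF summableI])
  fix n
  note p = content_properties[OF c]
  have "(\<Sum>i<n. \<nu> (D \<inter> A i)) = \<nu> (\<Union>i\<in>{..<n}. D \<inter> A i)"
    using A D by (intro sets.additive_sum[OF p(1,2)])
      (auto simp: disjoint_family_on_def)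
  also have "\<dots> \<le> \<nu> D" using A D by (intro increasingD[OF p(3)]) auto
  finally show "(\<Sum>i<n. \<nu> (D \<inter> A i)) \<le> \<nu> D" .
qed

text \<open>
  Refining a partition decreases \<open>\<Sum>i. \<nu> (A i)\<close>, so that nearly optimal partitions for \<open>\<nu>\<^sub>1\<close> and
  \<open>\<nu>\<^sub>2\<close> can be replaced by their common refinement.
\<close>

lemma emeasure_sigma_part_add:
  assumes c: "content M \<nu>\<^sub>1" "content M \<nu>\<^sub>2" and E: "E \<in> sets M"
  shows "emeasure (sigma_part M (\<lambda>E. \<nu>\<^sub>1 E + \<nu>\<^sub>2 E)) E
    = emeasure (sigma_part M \<nu>\<^sub>1) E + emeasure (sigma_part M \<nu>\<^sub>2) E"
proof (rule antisym)
  let ?O = "\<lambda>\<nu>. outer_measure (sets M) \<nu> E"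
  let ?\<nu> = "\<lambda>E. \<nu>\<^sub>1 E + \<nu>\<^sub>2 E"
  note cc = content_add[OF c]
  note em = emeasure_sigma_part[OF c(1) E] emeasure_sigma_part[OF c(2) E] emeasure_sigma_part[OF cc E]
  note p = content_properties[OF cc]
  have *: "?O ?\<nu> \<le> (\<Sum>i. \<nu>\<^sub>1 (A i)) + (\<Sum>i. \<nu>\<^sub>2 (B i))"
    if A: "range A \<subseteq> sets M" "disjoint_family A" "E \<subseteq> (\<Union>i. A i)"
      and B: "range B \<subseteq> sets M" "disjoint_family B" "E \<subseteq> (\<Union>i. B i)" for A B :: "nat \<Rightarrow> 'a set"
  proof -
    have AB: "A i \<in> sets M" "B i \<in> sets M" for i using A B by auto
    \<comment> \<open>the common refinement of the two partitions\<close>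
    define C where "C = (\<lambda>(i, j). A i \<inter> B j)"
    have "E \<subseteq> (\<Union>n. C (prod_decode n))"
    proof
      fix u assume "u \<in> E"
      then obtain i j where "u \<in> A i" "u \<in> B j" using A(3) B(3) by blast
      then have "u \<in> C (prod_decode (prod_encode (i, j)))" by (simp add: C_def)
      then show "u \<in> (\<Union>n. C (prod_decode n))" by blast
    qed
    then have "?O ?\<nu> \<le> (\<Sum>n. ?\<nu> (C (prod_decode n)))"
      using AB by (intro sets.outer_measure_le[OF p(1,3)]) (auto simp: C_def split: prod.splits)
    also have "\<dots> = (\<Sum>n. \<nu>\<^sub>1 (C (prod_decode n))) + (\<Sum>n. \<nu>\<^sub>2 (C (prod_decode n)))"
      by (rule suminf_add[symmetric]) auto
    also have "(\<Sum>n. \<nu>\<^sub>1 (C (prod_decode n))) = (\<Sum>i. \<Sum>j. \<nu>\<^sub>1 (A i \<inter> B j))"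
      by (rule suminf_ennreal_2dimen[where f="\<lambda>p. \<nu>\<^sub>1 (C p)"]) (simp add: C_def)
    also have "\<dots> \<le> (\<Sum>i. \<nu>\<^sub>1 (A i))"
      using AB B by (intro suminf_le content_sum_le[OF c(1)]) auto
    also have "(\<Sum>n. \<nu>\<^sub>2 (C (prod_decode n))) = (\<Sum>i. \<Sum>j. \<nu>\<^sub>2 (A i \<inter> B j))"
      by (rule suminf_ennreal_2dimen[where f="\<lambda>p. \<nu>\<^sub>2 (C p)"]) (simp add: C_def)
    also have "\<dots> = (\<Sum>j. \<Sum>i. \<nu>\<^sub>2 (B j \<inter> A i))"
      using nn_integral_suminf[of "\<lambda>j i. \<nu>\<^sub>2 (A i \<inter> B j)" "count_space UNIV"]
      by (simp add: nn_integral_count_space_nat Int_commute)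
    also have "\<dots> \<le> (\<Sum>j. \<nu>\<^sub>2 (B j))"
      using AB A by (intro suminf_le content_sum_le[OF c(2)]) auto
    finally show ?thesis by (simp add: add_mono)
  qed
  show "emeasure (sigma_part M ?\<nu>) E \<le> emeasure (sigma_part M \<nu>\<^sub>1) E + emeasure (sigma_part M \<nu>\<^sub>2) E"
    unfolding em
  proof (rule ennreal_le_epsilon)
    fix e :: real assume e: "0 < e" and fin: "?O \<nu>\<^sub>1 + ?O \<nu>\<^sub>2 < top"
    have "?O \<nu>\<^sub>1 < ?O \<nu>\<^sub>1 + e / 2" "?O \<nu>\<^sub>2 < ?O \<nu>\<^sub>2 + e / 2" using e fin 
      by (auto simp: less_top intro!: ennreal_add_left_cancel_less[THEN iffD2, of _ 0, simplified])
    then obtain A B where A: "range A \<subseteq> sets M" "disjoint_family A" "E \<subseteq> (\<Union>i. A i)"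
        and B: "range B \<subseteq> sets M" "disjoint_family B" "E \<subseteq> (\<Union>i. B i)"
        and lt: "(\<Sum>i. \<nu>\<^sub>1 (A i)) < ?O \<nu>\<^sub>1 + e / 2" "(\<Sum>i. \<nu>\<^sub>2 (B i)) < ?O \<nu>\<^sub>2 + e / 2"
      by (metis sets.outer_measure_close)
    have "?O ?\<nu> \<le> (?O \<nu>\<^sub>1 + e / 2) + (?O \<nu>\<^sub>2 + e / 2)"
      using *[OF A B] lt by (meson add_mono less_imp_le order_trans)
    also have "\<dots> = ?O \<nu>\<^sub>1 + ?O \<nu>\<^sub>2 + (ennreal (e / 2) + ennreal (e / 2))" by (simp add: ac_simps)
    also have "ennreal (e / 2) + ennreal (e / 2) = e" using e by (subst ennreal_plus[symmetric]) auto
    finally show "?O ?\<nu> \<le> ?O \<nu>\<^sub>1 + ?O \<nu>\<^sub>2 + e" .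
  qed
  show "emeasure (sigma_part M \<nu>\<^sub>1) E + emeasure (sigma_part M \<nu>\<^sub>2) E \<le> emeasure (sigma_part M ?\<nu>) E"
    unfolding em outer_measure_def[of _ "?\<nu>"]
  proof (intro INF_greatest, clarify)
    fix A :: "nat \<Rightarrow> 'a set" assume A: "range A \<subseteq> sets M" "disjoint_family A" "E \<subseteq> (\<Union>i. A i)"
    have "?O \<nu>\<^sub>1 + ?O \<nu>\<^sub>2 \<le> (\<Sum>i. \<nu>\<^sub>1 (A i)) + (\<Sum>i. \<nu>\<^sub>2 (A i))"
      using A content_properties[OF c(1)] content_properties[OF c(2)]
      by (intro add_mono sets.outer_measure_le) auto
    also have "\<dots> = (\<Sum>i. ?\<nu> (A i))" by (rule suminf_add) auto
    finally show "?O \<nu>\<^sub>1 + ?O \<nu>\<^sub>2 \<le> (\<Sum>i. ?\<nu> (A i))" .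
  qed
qed

lemma content_emeasure: "sets N = sets M \<Longrightarrow> content M (emeasure N)"
  by (auto simp: content_def plus_emeasure)

lemma content_cmult: "content M \<nu> \<Longrightarrow> content M (\<lambda>E. c * \<nu> E)"
  by (auto simp: content_def algebra_simps)

lemma content_Int:
  assumes "content M \<nu>" "D \<in> sets M"
  shows "content M (\<lambda>E. \<nu> (E \<inter> D))"
  unfolding content_def
proof (intro conjI ballI impI)
  show "\<nu> ({} \<inter> D) = 0" using assms(1) by (simp add: content_def)
  fix E E' assume E: "E \<in> sets M" "E' \<in> sets M" "E \<inter> E' = {}"
  have "\<nu> ((E \<inter> D) \<union> (E' \<inter> D)) = \<nu> (E \<inter> D) + \<nu> (E' \<inter> D)"
    using assms(1)[unfolded content_def, THEN conjunct2, rule_format, of "E \<inter> D" "E' \<inter> D"] assms(2) E by blast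
  then show "\<nu> ((E \<union> E') \<inter> D) = \<nu> (E \<inter> D) + \<nu> (E' \<inter> D)" by (simp only: Int_Un_distrib2)
qed

lemma content_Diff:
  assumes "content M \<nu>" "D \<in> sets M"
  shows "content M (\<lambda>E. \<nu> (E - D))"
  unfolding content_def
proof (intro conjI ballI impI)
  show "\<nu> ({} - D) = 0" using assms(1) by (simp add: content_def)
  fix E E' assume E: "E \<in> sets M" "E' \<in> sets M" "E \<inter> E' = {}"
  have "\<nu> ((E - D) \<union> (E' - D)) = \<nu> (E - D) + \<nu> (E' - D)"
    using assms(1)[unfolded content_def, THEN conjunct2, rule_format, of "E - D" "E' - D"] assms(2) E by blast
  then show "\<nu> ((E \<union> E') - D) = \<nu> (E - D) + \<nu> (E' - D)" by (simp only: Un_Diff)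
qed

lemma content_sum:
  "(\<And>i. i \<in> I \<Longrightarrow> content M (\<nu> i)) \<Longrightarrow> content M (\<lambda>E. \<Sum>i\<in>I. \<nu> i E)"
  by (auto simp: content_def sum.distrib)

lemma content_limit:
  assumes "F \<noteq> bot" "eventually (\<lambda>n. content M (X n)) F" "\<And>E. E \<in> sets M \<Longrightarrow> ((\<lambda>n. X n E) \<longlongrightarrow> \<nu> E) F"
  shows "content M \<nu>"
  unfolding content_def
proof (intro conjI ballI impI)
  have "eventually (\<lambda>n. X n {} = 0) F"
    using assms(2) by eventually_elim (simp add: content_def)
  then have "((\<lambda>n. 0) \<longlongrightarrow> \<nu> {}) F" using assms(3)[of "{}"] by (auto intro: Lim_transform_eventually)
  then show "\<nu> {} = 0" using assms(1) by (simp add: tendsto_const_iff)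
next
  fix D E assume DE: "D \<in> sets M" "E \<in> sets M" "D \<inter> E = {}"
  have "eventually (\<lambda>n. X n (D \<union> E) = X n D + X n E) F"
    using assms(2) by eventually_elim (use DE in \<open>simp add: content_def\<close>)
  then have "((\<lambda>n. X n D + X n E) \<longlongrightarrow> \<nu> (D \<union> E)) F"
    using assms(3)[of "D \<union> E"] DE by (auto intro: Lim_transform_eventually)
  moreover have "((\<lambda>n. X n D + X n E) \<longlongrightarrow> \<nu> D + \<nu> E) F"
    by (intro tendsto_add assms DE)
  ultimately show "\<nu> (D \<union> E) = \<nu> D + \<nu> E" using assms(1) tendsto_unique by blast
qed

lemma sigma_part_cong:
  assumes "\<And>E. E \<in> sets M \<Longrightarrow> \<nu> E = \<nu>' E"
  shows "sigma_part M \<nu> = sigma_part M \<nu>'"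
proof -
  have "outer_measure (sets M) \<nu> = outer_measure (sets M) \<nu>'"
    unfolding outer_measure_def[abs_def]
    by (intro ext INF_cong refl arg_cong[where f=suminf]) (use assms in auto)
  then show ?thesis by (simp add: sigma_part_def)
qed

text \<open>
  For \<open>r > 0\<close> one inequality suffices, applied to \<open>r\<close> and to \<open>1 / r\<close>.
\<close>

lemma emeasure_sigma_part_cmult:
  assumes c: "content M \<nu>" and E: "E \<in> sets M"
  shows "emeasure (sigma_part M (\<lambda>E. ennreal r * \<nu> E)) E = ennreal r * emeasure (sigma_part M \<nu>) E"
proof -
  have le: "emeasure (sigma_part M (\<lambda>E. ennreal r * \<nu> E)) E \<le> ennreal r * emeasure (sigma_part M \<nu>) E"
    if r: "0 < r" and c: "content M \<nu>" for r \<nu>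
  proof -
    have rr: "ennreal (1 / r) * ennreal r = 1" using r by (simp flip: ennreal_mult)
    note p = content_properties[OF content_cmult[OF c, of "ennreal r"]]
    have "ennreal (1 / r) * outer_measure (sets M) (\<lambda>E. ennreal r * \<nu> E) E \<le> outer_measure (sets M) \<nu> E"
      unfolding outer_measure_def[of _ \<nu>]
    proof (intro INF_greatest, clarify)
      fix A :: "nat \<Rightarrow> 'a set" assume A: "range A \<subseteq> sets M" "disjoint_family A" "E \<subseteq> (\<Union>i. A i)"
      have "outer_measure (sets M) (\<lambda>E. ennreal r * \<nu> E) E \<le> (\<Sum>i. ennreal r * \<nu> (A i))"
        using A by (intro sets.outer_measure_le[OF p(1,3)]) auto
      then have "ennreal (1 / r) * outer_measure (sets M) (\<lambda>E. ennreal r * \<nu> E) E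
          \<le> ennreal (1 / r) * (ennreal r * (\<Sum>i. \<nu> (A i)))"
        by (intro mult_left_mono) auto
      then show "ennreal (1 / r) * outer_measure (sets M) (\<lambda>E. ennreal r * \<nu> E) E \<le> (\<Sum>i. \<nu> (A i))"
        by (simp add: mult.assoc[symmetric] rr)
    qed
    then have "ennreal r * (ennreal (1 / r) * outer_measure (sets M) (\<lambda>E. ennreal r * \<nu> E) E)
        \<le> ennreal r * outer_measure (sets M) \<nu> E"
      by (rule mult_left_mono) simp
    moreover have "ennreal r * (ennreal (1 / r) * x) = x" for x
      using rr by (metis mult.assoc mult.commute mult_1)
    ultimately show ?thesis
      by (simp only: emeasure_sigma_part[OF c E] emeasure_sigma_part[OF content_cmult[OF c] E])
  qed
  show ?thesis
  proof (cases "0 < r")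
    case True
    have "emeasure (sigma_part M \<nu>) E = emeasure (sigma_part M (\<lambda>E. ennreal (1 / r) * (ennreal r * \<nu> E))) E"
    proof -
      have "ennreal (1 / r) * ennreal r = 1" using True by (simp flip: ennreal_mult)
      then show ?thesis by (simp add: mult.assoc[symmetric])
    qed
    also have "\<dots> \<le> ennreal (1 / r) * emeasure (sigma_part M (\<lambda>E. ennreal r * \<nu> E)) E"
      using True by (intro le content_cmult c) auto
    finally have "ennreal r * emeasure (sigma_part M \<nu>) E
        \<le> ennreal r * (ennreal (1 / r) * emeasure (sigma_part M (\<lambda>E. ennreal r * \<nu> E)) E)"
      by (rule mult_left_mono) simp
    also have "\<dots> = emeasure (sigma_part M (\<lambda>E. ennreal r * \<nu> E)) E"
      using True by (simp add: mult.assoc[symmetric] flip: ennreal_mult)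
    finally show ?thesis using le[OF True c] by (rule antisym[rotated])
  next
    case False
    then have "emeasure (sigma_part M (\<lambda>E. ennreal r * \<nu> E)) E \<le> 0"
      using emeasure_sigma_part_le[OF content_cmult[OF c, of "ennreal r"] E] by (simp add: ennreal_neg)
    then show ?thesis using False by (simp add: ennreal_neg)
  qed
qed

section \<open>The core and the norm of the second space\<close>

locale full_core_space = sigma_finite_measure M for M :: "'a measure" +
  fixes \<A> :: "'a set set"
  assumes full_core: "full_core M \<A>"
begin

lemma core_sets [measurable]: "A \<in> \<A> \<Longrightarrow> A \<in> sets M"
  and core_empty: "{} \<in> \<A>"
  and core_emeasure_finite: "A \<in> \<A> \<Longrightarrow> emeasure M A < top"
  and core_comparable: "A \<in> \<A> \<Longrightarrow> B \<in> \<A> \<Longrightarrow> A \<subseteq> B \<or> B \<subseteq> A"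
  using full_core
  by (auto simp: full_core_def sigma_bounded_core_def ordered_core_def chain_subset_def)

lemma core_subset_Pow: "\<A> \<subseteq> Pow (space M)"
  using core_sets sets.sets_into_space by blast

lemma countable_core_cover:
  obtains \<A>\<^sub>0 where "\<A>\<^sub>0 \<subseteq> \<A>" "countable \<A>\<^sub>0" "\<Union>\<A>\<^sub>0 = space M"
  using full_core by (auto simp: full_core_def sigma_bounded_core_def)

lemma core_Un: "A \<in> \<A> \<Longrightarrow> B \<in> \<A> \<Longrightarrow> A \<union> B \<in> \<A>"
  and core_Int: "A \<in> \<A> \<Longrightarrow> B \<in> \<A> \<Longrightarrow> A \<inter> B \<in> \<A>"
  using core_comparable[of A B] by (auto simp: Un_absorb1 Un_absorb2 Int_absorb1 Int_absorb2)

lemma AE_core: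
  assumes "\<And>A. A \<in> \<A> \<Longrightarrow> AE u in M. u \<in> A \<longrightarrow> P u"
  shows "AE u in M. P u"
proof -
  obtain \<A>\<^sub>0 where a: "\<A>\<^sub>0 \<subseteq> \<A>" "countable \<A>\<^sub>0" "\<Union>\<A>\<^sub>0 = space M"
    by (rule countable_core_cover)
  then have "AE u in M. \<forall>A\<in>\<A>\<^sub>0. u \<in> A \<longrightarrow> P u"
    using assms by (subst AE_ball_countable) auto
  then show ?thesis using AE_space by eventually_elim (use a(3) in blast)
qed

lemma core_emeasure_eq: "A \<in> \<A> \<Longrightarrow> emeasure M A = ennreal (measure M A)"
  using core_emeasure_finite[of A] by (simp add: emeasure_eq_ennreal_measure less_top)

text \<open>
  A member of the generated \<open>\<sigma>\<close>-ring depends on countably many generators only: it cannot separate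
  points that these do not separate.
\<close>

lemma countably_saturated:
  assumes "D \<in> sigma_ring_sets \<A>"
  shows "\<exists>\<C>\<subseteq>\<A>. countable \<C> \<and> (\<forall>u v. (\<forall>A\<in>\<C>. u \<in> A \<longleftrightarrow> v \<in> A) \<longrightarrow> (u \<in> D \<longleftrightarrow> v \<in> D))"
  using assms
proof induction
  case (Basic A)
  then show ?case by (intro exI[of _ "{A}"]) auto
next
  case Empty
  then show ?case by (intro exI[of _ "{}"]) auto
next
  case (Diff A B)
  then obtain \<C> \<D> where
    "\<C> \<subseteq> \<A>" "countable \<C>" "\<And>u v. (\<forall>A\<in>\<C>. u \<in> A \<longleftrightarrow> v \<in> A) \<Longrightarrow> (u \<in> A \<longleftrightarrow> v \<in> A)"
    "\<D> \<subseteq> \<A>" "countable \<D>" "\<And>u v. (\<forall>A\<in>\<D>. u \<in> A \<longleftrightarrow> v \<in> A) \<Longrightarrow> (u \<in> B \<longleftrightarrow> v \<in> B)"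
    by metis
  note CD = this
  have "(u \<in> A - B) = (v \<in> A - B)" if "\<forall>A\<in>\<C> \<union> \<D>. u \<in> A \<longleftrightarrow> v \<in> A" for u v
    using that CD(3)[of u v] CD(6)[of u v] by simp
  then show ?case
    using CD(1,2,4,5) by (intro exI[of _ "\<C> \<union> \<D>"] conjI) auto
next
  case (Union A)
  then obtain \<C> where C: "\<And>i::nat. \<C> i \<subseteq> \<A>" "\<And>i. countable (\<C> i)"
    "\<And>i u v. (\<forall>A\<in>\<C> i. u \<in> A \<longleftrightarrow> v \<in> A) \<Longrightarrow> (u \<in> A i \<longleftrightarrow> v \<in> A i)"
    by metis
  have "(u \<in> (\<Union>i. A i)) = (v \<in> (\<Union>i. A i))" if "\<forall>A\<in>(\<Union>i. \<C> i). u \<in> A \<longleftrightarrow> v \<in> A" for u v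
    using that C(3)[of _ u v] by auto
  then show ?case
    using C(1,2) by (intro exI[of _ "\<Union>i. \<C> i"] conjI UN_least) auto
qed

lemma emeasure_UN_core_le:
  assumes B: "\<And>i::nat. B i \<in> \<A>" and N: "sets N = sets M"
    and le: "\<And>A. A \<in> \<A> \<Longrightarrow> emeasure N A \<le> C * emeasure M A"
  shows "emeasure N (\<Union>i. B i) \<le> C * emeasure M (\<Union>i. B i)"
proof -
  define U where "U n = (\<Union>i\<le>n. B i)" for n
  have U: "U n \<in> \<A>" for n
    by (induction n) (auto simp: U_def atMost_Suc B intro: core_Un)
  have "incseq U" by (force simp: U_def incseq_def)
  then have "(SUP n. emeasure N (U n)) = emeasure N (\<Union>n. U n)"
    using U N by (intro SUP_emeasure_incseq) auto
  moreover have "(\<Union>n. U n) = (\<Union>i. B i)" by (auto simp: U_def)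
  moreover have "emeasure N (U n) \<le> C * emeasure M (\<Union>i. B i)" for n
  proof -
    have "emeasure N (U n) \<le> C * emeasure M (U n)" by (rule le[OF U])
    also have "\<dots> \<le> C * emeasure M (\<Union>i. B i)"
      using B by (intro mult_left_mono emeasure_mono) (auto simp: U_def)
    finally show ?thesis .
  qed
  ultimately show ?thesis by (metis SUP_least)
qed

lemma emeasure_INT_core_le:
  assumes B: "\<And>i::nat. B i \<in> \<A>" and N: "sets N = sets M" and C: "C < top"
    and le: "\<And>A. A \<in> \<A> \<Longrightarrow> emeasure N A \<le> C * emeasure M A"
  shows "emeasure N (\<Inter>i. B i) \<le> C * emeasure M (\<Inter>i. B i)"
proof -
  define I where "I n = (\<Inter>i\<le>n. B i)" for n
  have I: "I n \<in> \<A>" for n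
    by (induction n) (auto simp: I_def atMost_Suc B intro: core_Int)
  have dec: "decseq I" by (force simp: I_def decseq_def)
  have eq: "(\<Inter>n. I n) = (\<Inter>i. B i)" by (auto simp: I_def)
  have fin: "emeasure N (I n) \<noteq> \<infinity>" for n
    using le[OF I, of n] core_emeasure_finite[OF I, of n] C
    by (metis ennreal_mult_less_top infinity_ennreal_def linorder_not_less)
  have "(\<lambda>n. emeasure N (I n)) \<longlonglongrightarrow> emeasure N (\<Inter>n. I n)"
    using I N fin dec by (intro Lim_emeasure_decseq) auto
  moreover have "(\<lambda>n. C * emeasure M (I n)) \<longlonglongrightarrow> C * emeasure M (\<Inter>n. I n)"
    using I core_emeasure_finite[OF I] dec C
    by (intro ennreal_tendsto_cmult Lim_emeasure_decseq) (auto simp: less_top)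
  ultimately show ?thesis
    unfolding eq by (rule LIMSEQ_le) (use le[OF I] in auto)
qed

text \<open>
  A lower set of the core order is comparable with every member of the core. If it is also measurable,
  choose countably many members of the core that saturate it. Those below the set and those above it
  leave a gap that these members do not separate, so the set contains all of the gap or nothing
  of it.
\<close>

lemma down_set_cases:
  assumes D: "D \<in> sigma_ring_sets \<A>" "D \<subseteq> space M"
    and down: "\<And>u v. u \<in> space M \<Longrightarrow> v \<in> D \<Longrightarrow> core_le \<A> u v \<Longrightarrow> u \<in> D"
  obtains B :: "nat \<Rightarrow> 'a set" where "range B \<subseteq> \<A>" "D = (\<Union>i. B i) \<or> D = (\<Inter>i. B i)"
proof -
  obtain \<C>\<^sub>1 where C1: "\<C>\<^sub>1 \<subseteq> \<A>" "countable \<C>\<^sub>1"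
    "\<And>u v. (\<forall>A\<in>\<C>\<^sub>1. u \<in> A \<longleftrightarrow> v \<in> A) \<Longrightarrow> (u \<in> D \<longleftrightarrow> v \<in> D)"
    using countably_saturated[OF D(1)] by metis
  obtain \<A>\<^sub>0 where a0: "\<A>\<^sub>0 \<subseteq> \<A>" "countable \<A>\<^sub>0" "\<Union>\<A>\<^sub>0 = space M"
    by (rule countable_core_cover)
  define \<C> where "\<C> = insert {} (\<C>\<^sub>1 \<union> \<A>\<^sub>0)"
  have C: "\<C> \<subseteq> \<A>" "countable \<C>" "\<Union>\<C> = space M"
    using C1(1,2) a0 core_empty core_subset_Pow by (auto simp: \<C>_def)
  have comp: "A \<subseteq> D \<or> D \<subseteq> A" if A: "A \<in> \<A>" for A
  proof (rule ccontr)
    assume "\<not> ?thesis"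
    then obtain v u where v: "v \<in> A" "v \<notin> D" and u: "u \<in> D" "u \<notin> A" by blast
    have "v \<in> space M" using v A core_sets sets.sets_into_space by blast
    then have "\<not> core_le \<A> v u" using down u v by blast
    then obtain B where "B \<in> \<A>" "u \<in> B" "v \<notin> B" by (auto simp: core_le_def)
    then show False using core_comparable[OF A, of B] u v by blast
  qed
  define L where "L = {A \<in> \<C>. A \<subseteq> D}"
  define R where "R = {A \<in> \<C>. D \<subseteq> A}"
  have "L \<subseteq> \<C>" "R \<subseteq> \<C>" by (auto simp: L_def R_def)
  then have LR: "countable L" "countable R" using C(2) by (auto intro: countable_subset)
  have L: "L \<noteq> {}" by (auto simp: L_def \<C>_def)
  show ?thesis
  proof (cases "D = \<Union>L")
    case True
    have "range (from_nat_into L) = L" using LR L by (intro range_from_nat_into)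
    moreover have "L \<subseteq> \<A>" using C(1) by (auto simp: L_def)
    ultimately show ?thesis using True that[of "from_nat_into L"] by metis
  next
    case False
    then obtain u where u: "u \<in> D" "u \<notin> \<Union>L" by (auto simp: L_def)
    then obtain A where "A \<in> \<C>" "u \<in> A" using D(2) C(3) by blast
    then have "A \<in> R" using u comp[of A] C(1) by (auto simp: L_def R_def)
    then have R: "R \<noteq> {}" by auto
    have "v \<in> D" if v: "v \<in> \<Inter>R" for v
    proof (cases "v \<in> \<Union>L")
      case True
      then show ?thesis by (auto simp: L_def)
    next
      case nL: False
      have "u \<in> A \<longleftrightarrow> v \<in> A" if A: "A \<in> \<C>\<^sub>1" for A
      proof -
        have AC: "A \<in> \<C>" using A by (simp add: \<C>_def)
        then consider "A \<in> L" | "A \<in> R" using comp[of A] C(1) by (auto simp: L_def R_def)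
        then show ?thesis using u nL v by cases (auto simp: R_def)
      qed
      then show ?thesis using C1(3)[of u v] u by blast
    qed
    then have "D = \<Inter>R" by (auto simp: R_def)
    moreover have "range (from_nat_into R) = R" using LR R by (intro range_from_nat_into)
    moreover have "R \<subseteq> \<A>" using C(1) by (auto simp: R_def)
    ultimately show ?thesis using that[of "from_nat_into R"] by metis
  qed
qed

lemma emeasure_down_set_le:
  assumes "D \<in> sigma_ring_sets \<A>" "D \<subseteq> space M"
    and "\<And>u v. u \<in> space M \<Longrightarrow> v \<in> D \<Longrightarrow> core_le \<A> u v \<Longrightarrow> u \<in> D"
    and N: "sets N = sets M" and C: "C < top"
    and le: "\<And>A. A \<in> \<A> \<Longrightarrow> emeasure N A \<le> C * emeasure M A"
  shows "emeasure N D \<le> C * emeasure M D"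
  by (rule down_set_cases[OF assms(1-3)])
    (use emeasure_UN_core_le[OF _ N le] emeasure_INT_core_le[OF _ N C le] in blast)+

text \<open>
  When \<open>g\<close> is core decreasing, its superlevel sets are lower sets, so that integrals against \<open>g\<close> are
  reduced to integrals over lower sets.
\<close>

lemma layer_cake:
  assumes [measurable]: "g \<in> borel_measurable M" "h \<in> borel_measurable M"
  shows "(\<integral>\<^sup>+u. h u * g u \<partial>M) =
    (\<integral>\<^sup>+c. (\<integral>\<^sup>+u. h u * indicator {u \<in> space M. ennreal c < g u} u \<partial>M) * indicator {0..} c \<partial>lborel)"
proof -
  interpret pair_sigma_finite M "lborel :: real measure" ..
  have int: "(\<integral>\<^sup>+c. indicator {c. 0 \<le> c \<and> ennreal c < y} c \<partial>lborel) = y" for y :: ennreal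
  proof (cases y)
    case (real r)
    then have "{c. 0 \<le> c \<and> ennreal c < y} = {0..<r}" by (auto simp: ennreal_less_iff)
    then show ?thesis using real by simp
  next
    case top
    have "{c. 0 \<le> c \<and> ennreal c < y} = {0..}" using top by (auto simp: less_top)
    moreover have "emeasure lborel {0::real..} = \<infinity>"
    proof -
      have "ennreal (real n) \<le> emeasure lborel {0::real..}" for n
        using emeasure_mono[of "{0..real n}" "{0::real..}" lborel] by simp
      then show ?thesis
        using real_arch_simple by (cases "emeasure lborel {0::real..}") (auto, metis ennreal_le_iff2 not_le gt_ex order_trans real_arch_simple)
    qed
    ultimately show ?thesis using top by simp
  qed
  have "(\<integral>\<^sup>+u. h u * g u \<partial>M) =
    (\<integral>\<^sup>+u. h u * (\<integral>\<^sup>+c. indicator {c. 0 \<le> c \<and> ennreal c < g u} c \<partial>lborel) \<partial>M)"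
    by (simp only: int)
  also have "\<dots> = (\<integral>\<^sup>+u. (\<integral>\<^sup>+c. h u * indicator {c. 0 \<le> c \<and> ennreal c < g u} c \<partial>lborel) \<partial>M)"
    by (intro nn_integral_cong nn_integral_cmult[symmetric]) measurable
  also have "\<dots> = (\<integral>\<^sup>+c. (\<integral>\<^sup>+u. h u * indicator {c. 0 \<le> c \<and> ennreal c < g u} c \<partial>M) \<partial>lborel)"
    by (rule Fubini'[symmetric]) measurable
  also have "\<dots> = (\<integral>\<^sup>+c. (\<integral>\<^sup>+u. h u * indicator {u \<in> space M. ennreal c < g u} u * indicator {0..} c \<partial>M) \<partial>lborel)"
    by (intro nn_integral_cong) (auto simp: indicator_def)
  also have "\<dots> = (\<integral>\<^sup>+c. (\<integral>\<^sup>+u. h u * indicator {u \<in> space M. ennreal c < g u} u \<partial>M) * indicator {0..} c \<partial>lborel)"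
    by (intro nn_integral_cong nn_integral_multc) measurable
  finally show ?thesis .
qed

lemma core_decreasing_measurable:
  assumes "g \<in> core_decreasing M \<A>"
  shows "g \<in> borel_measurable M"
proof -
  have "g \<in> borel_measurable (sigma (space M) \<A>)"
    using assms core_measurable_iff[OF full_core] by (simp add: core_decreasing_def)
  moreover have "sets (sigma (space M) \<A>) \<subseteq> sets M"
    using core_sets core_subset_Pow by (subst sets_measure_of) (auto intro!: sets.sigma_sets_subset)
  ultimately show ?thesis
    by (auto simp: measurable_def space_measure_of_conv)
qed

text \<open>
  Converse to \<open>core_integral_le_norm\<close>: the bound extends from the core to all measurable lower sets by
  continuity of measures, and then to \<open>g\<close> by integration over its superlevel sets.
\<close>

lemma nn_integral_core_decreasing_le:
  assumes g: "g \<in> core_decreasing M \<A>" and h [measurable]: "h \<in> borel_measurable M" and C: "C < top"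
    and le: "\<And>A. A \<in> \<A> \<Longrightarrow> (\<integral>\<^sup>+u\<in>A. h u \<partial>M) \<le> C * emeasure M A"
  shows "(\<integral>\<^sup>+u. h u * g u \<partial>M) \<le> C * (\<integral>\<^sup>+u. g u \<partial>M)"
proof -
  note [measurable] = core_decreasing_measurable[OF g]
  have *: "(\<integral>\<^sup>+u. h u * indicator {u \<in> space M. ennreal c < g u} u \<partial>M)
      \<le> C * (\<integral>\<^sup>+u. 1 * indicator {u \<in> space M. ennreal c < g u} u \<partial>M)" for c
  proof -
    let ?D = "{u \<in> space M. ennreal c < g u}"
    have "emeasure (density M h) ?D \<le> C * emeasure M ?D"
    proof (rule emeasure_down_set_le[OF _ _ _ _ C])
      show "?D \<in> sigma_ring_sets \<A>"
        using g by (simp add: core_decreasing_def core_measurable_def)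
      show "u \<in> ?D" if "u \<in> space M" "v \<in> ?D" "core_le \<A> u v" for u v
        using that g by (force simp: core_decreasing_def intro: less_le_trans)
      show "emeasure (density M h) A \<le> C * emeasure M A" if "A \<in> \<A>" for A
        using that le by (simp add: emeasure_density)
    qed auto
    then show ?thesis by (simp add: emeasure_density)
  qed
  have "(\<integral>\<^sup>+u. h u * g u \<partial>M) \<le>
    (\<integral>\<^sup>+c. C * (\<integral>\<^sup>+u. 1 * indicator {u \<in> space M. ennreal c < g u} u \<partial>M) * indicator {0..} c \<partial>lborel)"
    unfolding layer_cake[OF core_decreasing_measurable[OF g] h]
    by (intro nn_integral_mono mult_right_mono *) auto
  also have "\<dots> = C * (\<integral>\<^sup>+u. 1 * g u \<partial>M)"
    by (subst layer_cake) (auto simp: mult.assoc intro!: nn_integral_cmult)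
  finally show ?thesis by simp
qed

text \<open>
  Test the norm with the core decreasing function \<open>1\<^sub>A / \<mu>(A)\<close>.
\<close>

lemma core_integral_le_norm:
  assumes f [measurable]: "f \<in> borel_measurable M" and A: "A \<in> \<A>"
  shows "(\<integral>\<^sup>+u\<in>A. e2ennreal \<bar>f u\<bar> \<partial>M) \<le> Linf_down_norm M \<A> f * emeasure M A"
proof (cases "emeasure M A = 0")
  case True
  then have "A \<in> null_sets M" using A core_sets by auto
  then show ?thesis using True by (simp add: nn_integral_null_set)
next
  case False
  define m where "m = emeasure M A"
  have m: "m \<noteq> 0" "m \<noteq> top" using False core_emeasure_finite[OF A] by (auto simp: m_def)
  have [measurable]: "A \<in> sets M" using A core_sets by auto
  have AU [measurable]: "A \<in> sets (sigma (space M) \<A>)"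
    using A core_sets core_subset_Pow by (subst sets_measure_of) auto
  define g :: "'a \<Rightarrow> ennreal" where "g = (\<lambda>u. inverse m * indicator A u)"
  have "core_measurable M \<A> g"
    unfolding core_measurable_iff[OF full_core] g_def by measurable
  moreover have "g v \<le> g u" if "core_le \<A> u v" for u v
    using that A by (auto simp: g_def core_le_def indicator_def)
  ultimately have "g \<in> core_decreasing M \<A>" by (auto simp: core_decreasing_def)
  moreover have "(\<integral>\<^sup>+u. g u \<partial>M) = inverse m * m"
    unfolding g_def m_def by (subst nn_integral_cmult_indicator) auto
  moreover have inv: "inverse m * m = 1" using m
    by (metis ennreal_divide_self divide_ennreal_def mult.commute less_top)
  ultimately have "(\<integral>\<^sup>+u. e2ennreal \<bar>f u\<bar> * g u \<partial>M) \<le> Linf_down_norm M \<A> f"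
    unfolding Linf_down_norm_def by (intro SUP_upper) auto
  also have "(\<integral>\<^sup>+u. e2ennreal \<bar>f u\<bar> * g u \<partial>M) = (\<integral>\<^sup>+u. inverse m * (e2ennreal \<bar>f u\<bar> * indicator A u) \<partial>M)"
    by (intro nn_integral_cong) (simp add: g_def ac_simps)
  also have "\<dots> = inverse m * (\<integral>\<^sup>+u\<in>A. e2ennreal \<bar>f u\<bar> \<partial>M)"
    by (rule nn_integral_cmult) measurable
  finally have "m * (inverse m * (\<integral>\<^sup>+u\<in>A. e2ennreal \<bar>f u\<bar> \<partial>M)) \<le> m * Linf_down_norm M \<A> f"
    by (rule mult_left_mono) simp
  then show ?thesis using inv by (simp add: mult.assoc[symmetric] mult.commute m_def)
qed

lemma Linf_down_norm_leI:
  assumes f [measurable]: "f \<in> borel_measurable M"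
    and le: "\<And>A. A \<in> \<A> \<Longrightarrow> (\<integral>\<^sup>+u\<in>A. e2ennreal \<bar>f u\<bar> \<partial>M) \<le> C * emeasure M A"
  shows "Linf_down_norm M \<A> f \<le> C"
proof (cases "C = top")
  case False
  then have C: "C < top" by (simp add: less_top)
  show ?thesis unfolding Linf_down_norm_def
  proof (rule SUP_least, clarify)
    fix g assume g: "g \<in> core_decreasing M \<A>" "(\<integral>\<^sup>+u. g u \<partial>M) \<le> 1"
    have "(\<integral>\<^sup>+u. e2ennreal \<bar>f u\<bar> * g u \<partial>M) \<le> C * (\<integral>\<^sup>+u. g u \<partial>M)"
      by (rule nn_integral_core_decreasing_le[OF g(1) _ C le]) auto
    also have "\<dots> \<le> C * 1" using g(2) by (rule mult_left_mono) simp
    finally show "(\<integral>\<^sup>+u. e2ennreal \<bar>f u\<bar> * g u \<partial>M) \<le> C" by simp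
  qed
qed simp

end

section \<open>The K-functional and linear majorants\<close>

lemma finite_chain_enum:
  assumes "finite \<F>" "chain\<^sub>\<subseteq> \<F>" "{} \<in> \<F>"
  shows "\<exists>B n. B 0 = {} \<and> (\<forall>i<n. B i \<subset> B (Suc i)) \<and> B ` {..n} = \<F>"
  using assms
proof (induction "card \<F>" arbitrary: \<F> rule: less_induct)
  case less
  show ?case
  proof (cases "\<F> = {{}}")
    case True
    then show ?thesis by (intro exI[of _ "\<lambda>_. {}"] exI[of _ 0]) auto
  next
    case False
    have "\<F> \<noteq> {}" using less by auto
    then obtain T where T: "T \<in> \<F>" "\<And>A. A \<in> \<F> \<Longrightarrow> \<not> T \<subset> A"
      using less.prems(1) by (metis finite_has_maximal psubsetE subset_antisym)
    have max: "A \<subseteq> T" if "A \<in> \<F>" for A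
      using T that less.prems(2) unfolding chain_subset_def by blast
    have "T \<noteq> {}" using max False less.prems by fastforce
    have "\<exists>B n. B 0 = {} \<and> (\<forall>i<n. B i \<subset> B (Suc i)) \<and> B ` {..n} = \<F> - {T}"
    proof (rule less.hyps)
      show "card (\<F> - {T}) < card \<F>" using T less by (intro card_Diff1_less)
      show "finite (\<F> - {T})" "chain\<^sub>\<subseteq> (\<F> - {T})" "{} \<in> \<F> - {T}"
        using less.prems \<open>T \<noteq> {}\<close> by (auto simp: chain_subset_def)
    qed
    then obtain B n where B: "B 0 = {}" "\<forall>i<n. B i \<subset> B (Suc i)" "B ` {..n} = \<F> - {T}"
      by (elim exE conjE) (rule that)
    have "B n \<in> \<F> - {T}" unfolding B(3)[symmetric] by simp
    then have "B n \<subset> T" using max[of "B n"] by auto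
    moreover have "(B(Suc n := T)) ` {..Suc n} = insert T (B ` {..n})"
    proof -
      have "{..n} \<inter> {i. i \<noteq> Suc n} = {..n}" by auto
      then show ?thesis by (simp add: atMost_Suc)
    qed
    ultimately show ?thesis using B T
      by (intro exI[of _ "B(Suc n := T)"] exI[of _ "Suc n"]) (auto simp: less_Suc_eq)
  qed
qed

lemma chain_mono:
  assumes "\<And>i. i < n \<Longrightarrow> B i \<subset> B (Suc i)" "i \<le> j" "j \<le> n"
  shows "B i \<subseteq> B j"
  using assms(2,3)
proof (induction j rule: dec_induct)
  case (step k)
  then show ?case using assms(1)[of k] by auto
qed simp

lemma emeasure_chain_split:
  assumes "B 0 = {}" "\<And>i. i \<le> n \<Longrightarrow> B i \<in> sets N" "\<And>i. i < n \<Longrightarrow> B i \<subset> B (Suc i)" "E \<in> sets N"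
  shows "emeasure N E = (\<Sum>i<n. emeasure N (E \<inter> (B (Suc i) - B i))) + emeasure N (E - B n)"
  using assms(2,3)
proof (induction n)
  case 0
  then show ?case using assms(1) by simp
next
  case (Suc n)
  have "emeasure N (E - B n) = emeasure N (E \<inter> (B (Suc n) - B n)) + emeasure N (E - B (Suc n))"
    using Suc.prems(1)[of n] Suc.prems(1)[of "Suc n"] Suc.prems(2)[of n] assms(4)
    by (subst plus_emeasure) (auto intro!: arg_cong[where f="emeasure N"])
  with Suc show ?case by (simp add: add.assoc)
qed

context full_core_space
begin

lemma finite_core_enum:
  assumes "finite \<F>" "\<F> \<subseteq> \<A>"
  shows "\<exists>B n. B 0 = {} \<and> (\<forall>i\<le>n. B i \<in> \<A>) \<and> (\<forall>i<n. B i \<subset> B (Suc i)) \<and>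
    B ` {..n} = insert {} \<F>"
proof -
  have "chain\<^sub>\<subseteq> (insert {} \<F>)"
    using assms core_comparable by (auto simp: chain_subset_def subset_iff)
  then have "\<exists>B n. B 0 = {} \<and> (\<forall>i<n. B i \<subset> B (Suc i)) \<and> B ` {..n} = insert {} \<F>"
    using assms(1) by (intro finite_chain_enum) simp_all
  then obtain B n where B: "B 0 = {}" "\<forall>i<n. B i \<subset> B (Suc i)" "B ` {..n} = insert {} \<F>"
    by (elim exE conjE) (rule that)
  have "B i \<in> \<A>" if "i \<le> n" for i
  proof -
    have "B i \<in> insert {} \<F>" unfolding B(3)[symmetric] using that by simp
    then show ?thesis using assms(2) core_empty by auto
  qed
  with B show ?thesis by (intro exI[of _ B] exI[of _ n] conjI allI impI) simp_all
qed

text \<open>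
  Along a finite chain \<open>B 0 \<subset> \<dots> \<subset> B n\<close> the first part takes its mass as early as possible: up to
  \<open>B i\<close> it takes the running maximum \<open>R i\<close> of \<open>G j - c m j\<close> over \<open>j \<le> i\<close>. What remains is at most
  \<open>G i - R i \<le> c m i\<close>, and \<open>R n \<le> p\<close> by the linear bound. The increments of \<open>R\<close> are at most those of
  \<open>G\<close>, so that the prescribed mass can be taken from the given measure by scaling it on the
  differences of the chain. The parts are recorded as contents only, as they will be passed to a
  limit.
\<close>

lemma finite_majorized_split:
  assumes N: "sets N = sets M" and p: "0 \<le> p" and c: "0 \<le> c"
    and le: "\<And>A. A \<in> \<A> \<Longrightarrow> emeasure N A \<le> ennreal p + ennreal c * emeasure M A"
    and fin: "finite \<F>" "\<F> \<subseteq> \<A>"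
  shows "\<exists>\<alpha> \<beta>. content M \<alpha> \<and> content M \<beta> \<and> (\<forall>E\<in>sets M. \<alpha> E + \<beta> E = emeasure N E) \<and>
    \<alpha> (space M) \<le> ennreal p \<and> (\<forall>A\<in>\<F>. \<beta> A \<le> ennreal c * emeasure M A)"
proof -
  obtain B n where B': "B 0 = {}" "\<forall>i\<le>n. B i \<in> \<A>" "\<forall>i<n. B i \<subset> B (Suc i)"
    "B ` {..n} = insert {} \<F>" using finite_core_enum[OF fin] by (elim exE conjE) (rule that)
  have B: "B 0 = {}" "\<And>i. i \<le> n \<Longrightarrow> B i \<in> \<A>" "\<And>i. i < n \<Longrightarrow> B i \<subset> B (Suc i)"
    "B ` {..n} = insert {} \<F>" using B' by simp_all
  have Bm: "B i \<subseteq> B j" if "i \<le> j" "j \<le> n" for i j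
    using chain_mono[of n B i j] B(3) that by simp
  have Bs: "B i \<in> sets M" if "i \<le> n" for i using B(2)[OF that] core_sets by auto
  define D where "D i = B (Suc i) - B i" for i
  have Ds: "D i \<in> sets M" if "i < n" for i using Bs that by (auto simp: D_def)
  have finN: "emeasure N A < top" if "A \<in> \<A>" for A
    using le[OF that] core_emeasure_finite[OF that]
    by (metis (no_types, lifting) ennreal_add_less_top ennreal_less_top ennreal_mult_less_top le_less_trans)
  define G where "G i = measure N (B i)" for i
  define m where "m i = measure M (B i)" for i
  have G: "emeasure N (B i) = ennreal (G i)" if "i \<le> n" for i
    using finN[OF B(2)[OF that]] by (simp add: G_def emeasure_eq_ennreal_measure less_top)
  have m: "emeasure M (B i) = ennreal (m i)" if "i \<le> n" for i
    using core_emeasure_eq[OF B(2)[OF that]] by (simp add: m_def)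
  have nn: "0 \<le> G i" "0 \<le> m i" for i by (auto simp: G_def m_def)
  have leG: "G i \<le> p + c * m i" if "i \<le> n" for i
    using le[OF B(2)[OF that]] p c nn[of i] unfolding G[OF that] m[OF that]
    by (simp add: ennreal_mult[symmetric] ennreal_plus[symmetric] del: ennreal_plus)
  have GD: "emeasure N (D i) = ennreal (G (Suc i) - G i)" if "i < n" for i
    using that B(3)[OF that] Bs[of i] Bs[of "Suc i"] G[of i] G[of "Suc i"] N nn
    by (simp add: D_def emeasure_Diff ennreal_minus psubset_imp_subset)
  have Gmono: "G i \<le> G (Suc i)" and mmono: "m i \<le> m (Suc i)" if "i < n" for i
  proof -
    have "ennreal (G i) \<le> ennreal (G (Suc i))" "ennreal (m i) \<le> ennreal (m (Suc i))"
      using that B(3)[OF that] Bs[of "Suc i"] N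
      by (auto simp: G[symmetric] m[symmetric] intro!: emeasure_mono)
    then show "G i \<le> G (Suc i)" "m i \<le> m (Suc i)" using nn by (auto simp: ennreal_le_iff)
  qed
  \<comment> \<open>the mass taken by the first part within \<open>B i\<close>\<close>
  define R where "R i = Max ((\<lambda>j. G j - c * m j) ` {..i})" for i
  have R0: "R 0 = 0" using B(1) by (simp add: R_def G_def m_def)
  have RSuc: "R (Suc i) = max (R i) (G (Suc i) - c * m (Suc i))" for i
    unfolding R_def atMost_Suc image_insert by (subst Max_insert) (auto simp: max.commute)
  have Rge: "G i - c * m i \<le> R i" for i by (auto simp: R_def intro!: Max_ge)
  have Rle: "R i \<le> p" if "i \<le> n" for i
    using leG that unfolding R_def by (subst Max_le_iff) (auto simp: algebra_simps)
  have Rmono: "R i \<le> R (Suc i)" for i by (simp add: RSuc)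
  have Rinc: "R (Suc i) - R i \<le> G (Suc i) - G i" if "i < n" for i
    using Rge[of i] mmono[OF that] Gmono[OF that] mult_left_mono[OF mmono[OF that] c]
    by (auto simp: RSuc max_def)
  \<comment> \<open>the fraction taken on the difference \<open>D i\<close>\<close>
  define t where "t i = (R (Suc i) - R i) / (G (Suc i) - G i)" for i
  have t: "0 \<le> t i" "t i \<le> 1" if "i < n" for i
    using Rmono[of i] Rinc[OF that] Gmono[OF that] by (auto simp: t_def divide_le_eq_1)
  have tG: "t i * (G (Suc i) - G i) = R (Suc i) - R i" if "i < n" for i
    using Rmono[of i] Rinc[OF that] Gmono[OF that] by (auto simp: t_def)
  define \<alpha> where "\<alpha> E = (\<Sum>i<n. ennreal (t i) * emeasure N (E \<inter> D i))" for E
  define \<beta> where "\<beta> E = (\<Sum>i<n. ennreal (1 - t i) * emeasure N (E \<inter> D i)) + emeasure N (E - B n)" for E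
  note cN = content_emeasure[OF N]
  have "content M \<alpha>" unfolding \<alpha>_def[abs_def]
    by (intro content_sum content_cmult content_Int cN Ds) auto
  moreover have "content M \<beta>" unfolding \<beta>_def[abs_def]
    by (intro content_add content_sum content_cmult content_Int content_Diff cN Ds Bs) auto
  moreover have "\<alpha> E + \<beta> E = emeasure N E" if E: "E \<in> sets M" for E
  proof -
    have one: "ennreal (t i) * x + ennreal (1 - t i) * x = x" if "i < n" for i x
      using t[OF that] by (simp add: distrib_right[symmetric] ennreal_plus[symmetric] del: ennreal_plus)
    have "\<alpha> E + \<beta> E = (\<Sum>i<n. ennreal (t i) * emeasure N (E \<inter> D i) + ennreal (1 - t i) * emeasure N (E \<inter> D i))
        + emeasure N (E - B n)"
      by (simp add: \<alpha>_def \<beta>_def sum.distrib add.assoc)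
    also have "\<dots> = (\<Sum>i<n. emeasure N (E \<inter> D i)) + emeasure N (E - B n)"
      using one by (intro arg_cong2[where f="(+)"] sum.cong) auto
    also have "\<dots> = emeasure N E"
      unfolding D_def by (rule emeasure_chain_split[symmetric]) (use B Bs N E in auto)
    finally show ?thesis .
  qed
  moreover have "\<alpha> (space M) \<le> ennreal p"
  proof -
    have "\<alpha> (space M) = (\<Sum>i<n. ennreal (R (Suc i) - R i))"
      unfolding \<alpha>_def
    proof (intro sum.cong refl)
      fix i assume "i \<in> {..<n}"
      then have i: "i < n" by simp
      have "space M \<inter> D i = D i" using sets.sets_into_space[OF Ds[OF i]] by blast
      then show "ennreal (t i) * emeasure N (space M \<inter> D i) = ennreal (R (Suc i) - R i)"
        using t[OF i] Gmono[OF i] by (simp add: GD[OF i] ennreal_mult[symmetric] tG[OF i])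
    qed
    also have "\<dots> = ennreal (R n - R 0)"
      using Rmono by (simp add: sum_ennreal sum_lessThan_telescope)
    also have "\<dots> \<le> ennreal p" using R0 Rle[of n] by (intro ennreal_leI) simp
    finally show ?thesis .
  qed
  moreover have "\<beta> (B k) \<le> ennreal c * emeasure M (B k)" if k: "k \<le> n" for k
  proof -
    have "B k - B n = {}" using Bm[of k n] k by auto
    then have "\<beta> (B k) = (\<Sum>i<n. ennreal (1 - t i) * emeasure N (B k \<inter> D i))"
      by (simp only: \<beta>_def emeasure_empty add_0_right)
    also have "\<dots> = (\<Sum>i<k. ennreal (1 - t i) * emeasure N (D i))"
    proof -
      have "B k \<inter> D i = (if i < k then D i else {})" if "i < n" for i
        using Bm[of "Suc i" k] Bm[of k i] that k
        by (auto simp: D_def)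
      then show ?thesis
        using k by (intro sum.mono_neutral_cong_right) auto
    qed
    also have "\<dots> = (\<Sum>i<k. ennreal ((G (Suc i) - R (Suc i)) - (G i - R i)))"
    proof (intro sum.cong refl)
      fix i assume "i \<in> {..<k}"
      then have i: "i < n" using k by simp
      have "(1 - t i) * (G (Suc i) - G i) = (G (Suc i) - R (Suc i)) - (G i - R i)"
        using tG[OF i] by (simp add: algebra_simps)
      then show "ennreal (1 - t i) * emeasure N (D i) = ennreal ((G (Suc i) - R (Suc i)) - (G i - R i))"
        using t[OF i] Gmono[OF i] by (simp add: GD[OF i] ennreal_mult[symmetric])
    qed
    also have "\<dots> = ennreal ((G k - R k) - (G 0 - R 0))"
    proof (subst sum_ennreal)
      show "0 \<le> (G (Suc i) - R (Suc i)) - (G i - R i)" if "i \<in> {..<k}" for i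
        using Rinc[of i] that k by auto
      show "ennreal (\<Sum>i<k. (G (Suc i) - R (Suc i)) - (G i - R i)) = ennreal ((G k - R k) - (G 0 - R 0))"
        using sum_lessThan_telescope[of "\<lambda>i. G i - R i" k] by simp
    qed
    also have "\<dots> \<le> ennreal (c * m k)"
      using Rge[of k] R0 B(1) by (intro ennreal_leI) (simp add: G_def)
    also have "\<dots> = ennreal c * emeasure M (B k)"
      using c nn by (simp add: m[OF k] ennreal_mult)
    finally show ?thesis .
  qed
  then have "\<forall>A\<in>\<F>. \<beta> A \<le> ennreal c * emeasure M A"
    using B(4) by (metis (no_types, lifting) atMost_iff image_iff insertCI)
  ultimately show ?thesis by blast
qed

text \<open>
  A limit of the splittings for finite subsets of the core. The countably additive parts of the two limit
  contents still add up to the measure \<open>h\<mu>\<close>, because taking this part is additive.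
\<close>

lemma majorized_split:
  assumes h [measurable]: "h \<in> borel_measurable M" and p: "0 \<le> p" and c: "0 \<le> c"
    and le: "\<And>A. A \<in> \<A> \<Longrightarrow> (\<integral>\<^sup>+u\<in>A. h u \<partial>M) \<le> ennreal p + ennreal c * emeasure M A"
  shows "\<exists>a b. a \<in> borel_measurable M \<and> b \<in> borel_measurable M \<and> (AE u in M. h u = a u + b u) \<and>
    (\<integral>\<^sup>+u. a u \<partial>M) \<le> ennreal p \<and> (\<forall>A\<in>\<A>. (\<integral>\<^sup>+u\<in>A. b u \<partial>M) \<le> ennreal c * emeasure M A)"
proof -
  define N where "N = density M h"
  have N: "sets N = sets M" by (simp add: N_def)
  have NA: "emeasure N E = (\<integral>\<^sup>+u\<in>E. h u \<partial>M)" if "E \<in> sets M" for E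
    using that by (simp add: N_def emeasure_density)
  have le': "emeasure N A \<le> ennreal p + ennreal c * emeasure M A" if "A \<in> \<A>" for A
    using le[OF that] core_sets[OF that] by (simp add: NA)
  define good where "good \<F> \<alpha> \<beta> \<longleftrightarrow> content M \<alpha> \<and> content M \<beta> \<and>
      (\<forall>E\<in>sets M. \<alpha> E + \<beta> E = emeasure N E) \<and>
      \<alpha> (space M) \<le> ennreal p \<and> (\<forall>A\<in>\<F>. \<beta> A \<le> ennreal c * emeasure M A)" for \<F> \<alpha> \<beta>
  have "\<exists>\<alpha> \<beta>. finite \<F> \<and> \<F> \<subseteq> \<A> \<longrightarrow> good \<F> \<alpha> \<beta>" for \<F>
    unfolding good_def using finite_majorized_split[OF N p c le', of \<F>] by blast
  then obtain X Y where "\<And>\<F>. finite \<F> \<and> \<F> \<subseteq> \<A> \<longrightarrow> good \<F> (X \<F>) (Y \<F>)"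
    by metis
  then have XY: "content M (X \<F>)" "content M (Y \<F>)"
      "\<And>E. E \<in> sets M \<Longrightarrow> X \<F> E + Y \<F> E = emeasure N E"
      "X \<F> (space M) \<le> ennreal p" "\<And>A. A \<in> \<F> \<Longrightarrow> Y \<F> A \<le> ennreal c * emeasure M A"
    if "finite \<F> \<and> \<F> \<subseteq> \<A>" for \<F>
    using that unfolding good_def by blast+
  obtain F L where F: "F \<le> finite_subsets_at_top \<A>" "F \<noteq> bot"
    and lim: "\<forall>i. ((\<lambda>\<F>. (if fst i then X \<F> else Y \<F>) (snd i)) \<longlongrightarrow> L i) F"
    by (rule convergent_subfilter[where X="\<lambda>\<F> i. (if fst i then X \<F> else Y \<F>) (snd i)",
          OF finite_subsets_at_top_neq_bot[of \<A>]]) (rule that)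
  define \<alpha> where "\<alpha> E = L (True, E)" for E
  define \<beta> where "\<beta> E = L (False, E)" for E
  have lim': "((\<lambda>\<F>. X \<F> E) \<longlongrightarrow> \<alpha> E) F" "((\<lambda>\<F>. Y \<F> E) \<longlongrightarrow> \<beta> E) F" for E
    using lim[THEN spec, of "(True, E)"] lim[THEN spec, of "(False, E)"] by (auto simp: \<alpha>_def \<beta>_def)
  have ev: "eventually P F" if "eventually P (finite_subsets_at_top \<A>)" for P
    using F(1) that by (rule filter_leD)
  have fin: "eventually (\<lambda>\<F>. finite \<F> \<and> \<F> \<subseteq> \<A>) F"
    by (intro ev eventually_finite_subsets_at_top_weakI) auto
  have c\<alpha>: "content M \<alpha>" and c\<beta>: "content M \<beta>"
    by (rule content_limit[OF F(2) eventually_mono[OF fin XY(1)] lim'(1)]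
        content_limit[OF F(2) eventually_mono[OF fin XY(2)] lim'(2)], assumption)+
  have sum: "\<alpha> E + \<beta> E = emeasure N E" if E: "E \<in> sets M" for E
  proof (rule tendsto_unique[OF F(2)])
    show "((\<lambda>\<F>. X \<F> E + Y \<F> E) \<longlongrightarrow> \<alpha> E + \<beta> E) F" by (intro tendsto_add lim')
    have "eventually (\<lambda>\<F>. emeasure N E = X \<F> E + Y \<F> E) F"
      using fin by eventually_elim (use XY E in auto)
    then show "((\<lambda>\<F>. X \<F> E + Y \<F> E) \<longlongrightarrow> emeasure N E) F"
      by (rule Lim_transform_eventually[OF tendsto_const])
  qed
  have \<alpha>_le: "\<alpha> (space M) \<le> ennreal p"
    by (rule tendsto_upperbound[OF lim'(1) eventually_mono[OF fin XY(4)] F(2)])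
  have \<beta>_le: "\<beta> A \<le> ennreal c * emeasure M A" if A: "A \<in> \<A>" for A
  proof (rule tendsto_upperbound[OF lim'(2) _ F(2)])
    have "eventually (\<lambda>\<F>. {A} \<subseteq> \<F>) F"
      using A by (intro ev) (auto simp: eventually_finite_subsets_at_top intro!: exI[of _ "{A}"])
    with fin show "eventually (\<lambda>\<F>. Y \<F> A \<le> ennreal c * emeasure M A) F"
      by eventually_elim (use XY in auto)
  qed
  define a where "a = RN_deriv M (sigma_part M \<alpha>)"
  define b where "b = RN_deriv M (sigma_part M \<beta>)"
  have [measurable]: "a \<in> borel_measurable M" "b \<in> borel_measurable M" by (auto simp: a_def b_def)
  have null: "\<alpha> E = 0 \<and> \<beta> E = 0" if "E \<in> null_sets M" for E
  proof -
    have "emeasure N E = 0" using that by (subst NA) (auto simp: nn_integral_null_set)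
    then show ?thesis using sum[of E] that by auto
  qed
  have "absolutely_continuous M (sigma_part M \<nu>)"
    if "content M \<nu>" "\<And>E. E \<in> null_sets M \<Longrightarrow> \<nu> E = 0" for \<nu>
    unfolding absolutely_continuous_def
  proof
    fix E assume E: "E \<in> null_sets M"
    then have "emeasure (sigma_part M \<nu>) E \<le> \<nu> E" using that by (intro emeasure_sigma_part_le) auto
    then show "E \<in> null_sets (sigma_part M \<nu>)" using E that(2)[OF E]
      by (auto simp: null_sets_def)
  qed
  then have "absolutely_continuous M (sigma_part M \<alpha>)" "absolutely_continuous M (sigma_part M \<beta>)"
    using null c\<alpha> c\<beta> by blast+
  then have da: "density M a = sigma_part M \<alpha>" and db: "density M b = sigma_part M \<beta>"
    unfolding a_def b_def by (simp_all add: density_RN_deriv)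
  have ia: "(\<integral>\<^sup>+u\<in>E. a u \<partial>M) = emeasure (sigma_part M \<alpha>) E"
    and ib: "(\<integral>\<^sup>+u\<in>E. b u \<partial>M) = emeasure (sigma_part M \<beta>) E" if "E \<in> sets M" for E
    using that by (auto simp flip: da db simp: emeasure_density)
  have "density M h = density M (\<lambda>u. a u + b u)"
  proof (rule measure_eqI)
    fix E assume "E \<in> sets (density M h)"
    then have E: "E \<in> sets M" by simp
    have "emeasure (density M (\<lambda>u. a u + b u)) E = (\<integral>\<^sup>+u\<in>E. a u \<partial>M) + (\<integral>\<^sup>+u\<in>E. b u \<partial>M)"
      using E by (subst emeasure_density) (auto simp: distrib_right nn_integral_add)
    also have "\<dots> = emeasure (sigma_part M (\<lambda>E. \<alpha> E + \<beta> E)) E"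
      unfolding ia[OF E] ib[OF E] by (rule emeasure_sigma_part_add[OF c\<alpha> c\<beta> E, symmetric])
    also have "\<dots> = emeasure N E"
      by (rule emeasure_sigma_part_eq[OF content_add[OF c\<alpha> c\<beta>] E N sum])
    finally show "emeasure (density M h) E = emeasure (density M (\<lambda>u. a u + b u)) E" by (simp add: N_def)
  qed simp
  then have "AE u in M. h u = a u + b u" by (intro density_unique) auto
  moreover have "(\<integral>\<^sup>+u. a u \<partial>M) \<le> ennreal p"
  proof -
    have "(\<integral>\<^sup>+u. a u \<partial>M) = (\<integral>\<^sup>+u\<in>space M. a u \<partial>M)" by (intro nn_integral_cong) auto
    also have "\<dots> \<le> \<alpha> (space M)" by (subst ia) (auto intro: emeasure_sigma_part_le c\<alpha>)
    finally show ?thesis using \<alpha>_le by simp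
  qed
  moreover have "(\<integral>\<^sup>+u\<in>A. b u \<partial>M) \<le> ennreal c * emeasure M A" if A: "A \<in> \<A>" for A
    using \<beta>_le[OF A] emeasure_sigma_part_le[OF c\<beta>, of A] A core_sets by (subst ib) (auto intro: order_trans)
  ultimately show ?thesis by (intro exI[of _ a] exI[of _ b]) auto
qed

end

lemma e2ennreal_add: "0 \<le> x \<Longrightarrow> 0 \<le> y \<Longrightarrow> e2ennreal (x + y) = e2ennreal x + e2ennreal y"
  by (metis e2ennreal_enn2ereal enn2ereal_e2ennreal plus_ennreal.rep_eq)

lemma e2ennreal_abs_add_le: "e2ennreal \<bar>x + y\<bar> \<le> e2ennreal \<bar>x\<bar> + e2ennreal \<bar>y\<bar>"
  using e2ennreal_mono[OF ereal_abs_add[of x y]] by (simp add: e2ennreal_add)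

text \<open>
  The value at \<open>0\<close> is \<open>1\<close>, which makes multiplication by the sign an involution that preserves
  absolute values.
\<close>

definition ereal_sign :: "ereal \<Rightarrow> ereal" where
  "ereal_sign x = (if x < 0 then - 1 else 1)"

lemma measurable_ereal_sign [measurable]: "ereal_sign \<in> borel_measurable borel"
  unfolding ereal_sign_def[abs_def] by measurable

lemma abs_ereal_sign_mult [simp]: "\<bar>ereal_sign x * y\<bar> = \<bar>y\<bar>"
  by (cases y) (auto simp: ereal_sign_def)

lemma ereal_sign_mult_self [simp]: "ereal_sign x * x = \<bar>x\<bar>"
  by (cases x) (auto simp: ereal_sign_def)

lemma ereal_sign_mult_abs [simp]: "ereal_sign x * \<bar>x\<bar> = x"
  by (cases x) (auto simp: ereal_sign_def)

lemma ereal_sign_distrib: "ereal_sign x * (y + z) = ereal_sign x * y + ereal_sign x * z"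
  if "\<bar>y\<bar> \<noteq> \<infinity>" "\<bar>z\<bar> \<noteq> \<infinity>"
  using that by (cases y; cases z) (auto simp: ereal_sign_def)

context full_core_space
begin

abbreviation K_core :: "('a \<Rightarrow> ereal) \<Rightarrow> real \<Rightarrow> ennreal" where
  "K_core \<equiv> K_functional M (L1 M) (Linf_down M \<A>)"

text \<open>
  Valid for every splitting of \<open>f\<close>; this gives the lower bound for the K-functional and the
  local integrability of members of the sum space.
\<close>

lemma core_integral_le_split:
  assumes f [measurable]: "f \<in> borel_measurable M" and A: "A \<in> \<A>"
    and f01: "f\<^sub>0 \<in> fst (L1 M)" "f\<^sub>1 \<in> fst (Linf_down M \<A>)" and eq: "AE u in M. f\<^sub>0 u + f\<^sub>1 u = f u"
  shows "(\<integral>\<^sup>+u\<in>A. e2ennreal \<bar>f u\<bar> \<partial>M) \<le> L1_norm M f\<^sub>0 + emeasure M A * Linf_down_norm M \<A> f\<^sub>1"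
proof -
  have [measurable]: "f\<^sub>0 \<in> borel_measurable M" "f\<^sub>1 \<in> borel_measurable M" "A \<in> sets M"
    using f01 A by (auto simp: L1_def Linf_down_def)
  have "(\<integral>\<^sup>+u\<in>A. e2ennreal \<bar>f u\<bar> \<partial>M) \<le> (\<integral>\<^sup>+u. e2ennreal \<bar>f\<^sub>0 u\<bar> + e2ennreal \<bar>f\<^sub>1 u\<bar> * indicator A u \<partial>M)"
  proof (rule nn_integral_mono_AE)
    show "AE u in M. e2ennreal \<bar>f u\<bar> * indicator A u
        \<le> e2ennreal \<bar>f\<^sub>0 u\<bar> + e2ennreal \<bar>f\<^sub>1 u\<bar> * indicator A u"
      using eq
    proof eventually_elim
      case (elim u)
      then show ?case
        using e2ennreal_abs_add_le[of "f\<^sub>0 u" "f\<^sub>1 u"] by (auto simp: indicator_def)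
    qed
  qed
  also have "\<dots> = L1_norm M f\<^sub>0 + (\<integral>\<^sup>+u\<in>A. e2ennreal \<bar>f\<^sub>1 u\<bar> \<partial>M)"
    unfolding L1_norm_def by (rule nn_integral_add) measurable
  also have "\<dots> \<le> L1_norm M f\<^sub>0 + emeasure M A * Linf_down_norm M \<A> f\<^sub>1"
    using core_integral_le_norm[of f\<^sub>1 A] A by (intro add_left_mono) (simp add: mult.commute)
  finally show ?thesis .
qed

lemma core_integral_le_K:
  assumes f: "f \<in> borel_measurable M" and A: "A \<in> \<A>"
  shows "(\<integral>\<^sup>+u\<in>A. e2ennreal \<bar>f u\<bar> \<partial>M) \<le> K_core f (measure M A)"
  unfolding K_functional_def
  using core_integral_le_split[OF f A]
  by (intro Inf_greatest) (auto simp: core_emeasure_eq[OF A] L1_def Linf_down_def)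

lemma sum_space_properties:
  assumes f: "f \<in> sum_space M (L1 M) (Linf_down M \<A>)"
  shows "f \<in> borel_measurable M" "\<And>A. A \<in> \<A> \<Longrightarrow> (\<integral>\<^sup>+u\<in>A. e2ennreal \<bar>f u\<bar> \<partial>M) < top"
    "AE u in M. \<bar>f u\<bar> \<noteq> \<infinity>"
proof -
  show fm [measurable]: "f \<in> borel_measurable M" using f by (simp add: sum_space_def)
  obtain f\<^sub>0 f\<^sub>1 where f01: "f\<^sub>0 \<in> fst (L1 M)" "f\<^sub>1 \<in> fst (Linf_down M \<A>)" "AE u in M. f\<^sub>0 u + f\<^sub>1 u = f u"
    using f by (auto simp: sum_space_def)
  show fin: "(\<integral>\<^sup>+u\<in>A. e2ennreal \<bar>f u\<bar> \<partial>M) < top" if A: "A \<in> \<A>" for A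
  proof -
    have "L1_norm M f\<^sub>0 < top" "Linf_down_norm M \<A> f\<^sub>1 < top"
      using f01 by (auto simp: L1_def Linf_down_def)
    then show ?thesis
      using core_integral_le_split[OF fm A f01] core_emeasure_finite[OF A]
      by (meson ennreal_add_less_top ennreal_mult_less_top le_less_trans)
  qed
  show "AE u in M. \<bar>f u\<bar> \<noteq> \<infinity>"
  proof (rule AE_core)
    fix A assume A: "A \<in> \<A>"
    then have [measurable]: "A \<in> sets M" by auto
    have "AE u in M. e2ennreal \<bar>f u\<bar> * indicator A u \<noteq> \<infinity>"
      using fin[OF A] by (intro nn_integral_PInf_AE) auto
    then show "AE u in M. u \<in> A \<longrightarrow> \<bar>f u\<bar> \<noteq> \<infinity>"
      by eventually_elim (auto simp: e2ennreal_infty)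
  qed
qed

text \<open>
  The splitting of \<open>\<bar>f\<bar>\<close> in \<open>majorized_split\<close>, multiplied by the sign of \<open>f\<close>, competes in the infimum
  that defines the K-functional.
\<close>

lemma K_le_line:
  assumes f [measurable]: "f \<in> borel_measurable M" and fin: "AE u in M. \<bar>f u\<bar> \<noteq> \<infinity>"
    and p: "0 \<le> p" and c: "0 \<le> c"
    and le: "\<And>A. A \<in> \<A> \<Longrightarrow> (\<integral>\<^sup>+u\<in>A. e2ennreal \<bar>f u\<bar> \<partial>M) \<le> ennreal p + ennreal c * emeasure M A"
  shows "K_core f t \<le> ennreal p + ennreal t * ennreal c"
proof -
  obtain a b where ab [measurable]: "a \<in> borel_measurable M" "b \<in> borel_measurable M"
    and eq: "AE u in M. e2ennreal \<bar>f u\<bar> = a u + b u" and a: "(\<integral>\<^sup>+u. a u \<partial>M) \<le> ennreal p"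
    and b: "\<forall>A\<in>\<A>. (\<integral>\<^sup>+u\<in>A. b u \<partial>M) \<le> ennreal c * emeasure M A"
    using majorized_split[of "\<lambda>u. e2ennreal \<bar>f u\<bar>", OF _ p c le] by (elim exE conjE meta_impE) simp_all
  define f\<^sub>0 where "f\<^sub>0 u = ereal_sign (f u) * enn2ereal (a u)" for u
  define f\<^sub>1 where "f\<^sub>1 u = ereal_sign (f u) * enn2ereal (b u)" for u
  have [measurable]: "f\<^sub>0 \<in> borel_measurable M" "f\<^sub>1 \<in> borel_measurable M"
    unfolding f\<^sub>0_def[abs_def] f\<^sub>1_def[abs_def] by measurable
  have abs: "e2ennreal \<bar>f\<^sub>0 u\<bar> = a u" "e2ennreal \<bar>f\<^sub>1 u\<bar> = b u" for u
    by (simp_all add: f\<^sub>0_def f\<^sub>1_def e2ennreal_enn2ereal)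
  have n0: "L1_norm M f\<^sub>0 \<le> ennreal p" using a by (simp add: L1_norm_def abs)
  have n1: "Linf_down_norm M \<A> f\<^sub>1 \<le> ennreal c"
    by (rule Linf_down_norm_leI) (use b in \<open>auto simp: abs\<close>)
  have "AE u in M. f\<^sub>0 u + f\<^sub>1 u = f u"
    using eq fin
  proof eventually_elim
    case (elim u)
    have "enn2ereal (a u) + enn2ereal (b u) = enn2ereal (e2ennreal \<bar>f u\<bar>)"
      using elim(1) by (simp add: plus_ennreal.rep_eq)
    then have s: "enn2ereal (a u) + enn2ereal (b u) = \<bar>f u\<bar>" by (simp add: enn2ereal_e2ennreal)
    then have "\<bar>enn2ereal (a u)\<bar> \<noteq> \<infinity>" "\<bar>enn2ereal (b u)\<bar> \<noteq> \<infinity>" using elim(2) by auto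
    then have "f\<^sub>0 u + f\<^sub>1 u = ereal_sign (f u) * (enn2ereal (a u) + enn2ereal (b u))"
      by (simp add: f\<^sub>0_def f\<^sub>1_def ereal_sign_distrib)
    then show ?case by (simp add: s)
  qed
  moreover have "f\<^sub>0 \<in> fst (L1 M)" "f\<^sub>1 \<in> fst (Linf_down M \<A>)"
    using n0 n1 by (auto simp: L1_def Linf_down_def intro: le_less_trans)
  ultimately have "K_core f t \<le> L1_norm M f\<^sub>0 + ennreal t * Linf_down_norm M \<A> f\<^sub>1"
    unfolding K_functional_def
    by (intro Inf_lower CollectI exI[of _ f\<^sub>0] exI[of _ f\<^sub>1]) (simp_all add: L1_def Linf_down_def)
  also have "\<dots> \<le> ennreal p + ennreal t * ennreal c" by (intro add_mono mult_left_mono n0 n1) simp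
  finally show ?thesis .
qed

text \<open>
  Take \<open>t = \<mu>(A)\<close> and insert the inequality of K-functionals between the lower bound for \<open>f\<close> and the
  upper bound for \<open>g\<close>. On null sets, where there is no such \<open>t > 0\<close>, the left-hand side vanishes.
\<close>

lemma K_le_imp_majorants:
  assumes f: "f \<in> borel_measurable M" and g: "g \<in> borel_measurable M" "AE u in M. \<bar>g u\<bar> \<noteq> \<infinity>"
    and K: "\<forall>t>0. K_core f t \<le> K_core g t" and p: "0 \<le> p" and c: "0 \<le> c"
    and le: "\<And>B. B \<in> \<A> \<Longrightarrow> (\<integral>\<^sup>+u\<in>B. e2ennreal \<bar>g u\<bar> \<partial>M) \<le> ennreal p + ennreal c * emeasure M B"
    and A: "A \<in> \<A>"
  shows "(\<integral>\<^sup>+u\<in>A. e2ennreal \<bar>f u\<bar> \<partial>M) \<le> ennreal p + ennreal c * emeasure M A"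
proof (cases "emeasure M A = 0")
  case True
  then have "A \<in> null_sets M" using A core_sets by auto
  then show ?thesis by (simp add: nn_integral_null_set)
next
  case False
  then have t: "0 < measure M A" using core_emeasure_eq[OF A] by (cases "measure M A = 0") (auto simp: less_le)
  have "(\<integral>\<^sup>+u\<in>A. e2ennreal \<bar>f u\<bar> \<partial>M) \<le> K_core f (measure M A)" by (rule core_integral_le_K[OF f A])
  also have "\<dots> \<le> K_core g (measure M A)" using K t by blast
  also have "\<dots> \<le> ennreal p + ennreal (measure M A) * ennreal c" by (rule K_le_line[OF g p c le])
  finally show ?thesis by (simp add: core_emeasure_eq[OF A] mult.commute)
qed

end

section \<open>Concave majorants of finitely many points\<close>

text \<open>
  A member that is never the strict maximiser of \<open>b - c a\<close>, \<open>c \<ge> 0\<close>, can be dropped without changing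
  the maxima. What remains in the end, apart from \<open>z\<close>, are the vertices of the nondecreasing concave
  majorant of the points \<open>(a i, b i)\<close>.
\<close>

lemma concave_subfamily:
  fixes a b :: "'i \<Rightarrow> real"
  assumes "finite S" "z \<in> S"
  shows "\<exists>T\<subseteq>S. z \<in> T \<and> (\<forall>i\<in>S. \<forall>c\<ge>0. \<exists>j\<in>T. b i - c * a i \<le> b j - c * a j) \<and>
    (\<forall>i\<in>T - {z}. \<exists>c\<ge>0. \<forall>j\<in>T - {i}. b j - c * a j < b i - c * a i)"
  using assms
proof (induction "card S" arbitrary: S rule: less_induct)
  case less
  show ?case
  proof (cases "\<forall>i\<in>S - {z}. \<exists>c\<ge>0. \<forall>j\<in>S - {i}. b j - c * a j < b i - c * a i")
    case True
    then show ?thesis using less.prems by (intro exI[of _ S]) auto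
  next
    case False
    then obtain i where i: "i \<in> S" "i \<noteq> z"
      and red: "\<And>c. c \<ge> 0 \<Longrightarrow> \<exists>j\<in>S - {i}. b i - c * a i \<le> b j - c * a j"
      by (auto simp: not_less)
    have "card (S - {i}) < card S" using less.prems i by (intro card_Diff1_less)
    moreover have "finite (S - {i})" "z \<in> S - {i}" using less.prems i by auto
    ultimately obtain T where T: "T \<subseteq> S - {i}" "z \<in> T"
      "\<forall>k\<in>S - {i}. \<forall>c\<ge>0. \<exists>j\<in>T. b k - c * a k \<le> b j - c * a j"
      "\<forall>i\<in>T - {z}. \<exists>c\<ge>0. \<forall>j\<in>T - {i}. b j - c * a j < b i - c * a i"
      using less.hyps[of "S - {i}"] by (elim meta_impE exE conjE)
    have "\<exists>j\<in>T. b k - c * a k \<le> b j - c * a j" if k: "k \<in> S" and c: "c \<ge> 0" for k c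
    proof (cases "k = i")
      case True
      obtain l where "l \<in> S - {i}" "b i - c * a i \<le> b l - c * a l" using red[OF c] by auto
      moreover then obtain j where "j \<in> T" "b l - c * a l \<le> b j - c * a j" using T(3) c by blast
      ultimately show ?thesis using True by (intro bexI[of _ j]) auto
    qed (use T(3) k c in auto)
    then have "\<forall>k\<in>S. \<forall>c\<ge>0. \<exists>j\<in>T. b k - c * a k \<le> b j - c * a j" by blast
    with T show ?thesis by (intro exI[of _ T] conjI) auto
  qed
qed

text \<open>
  Spend an amount \<open>s\<close> of mass on consecutive cells, the \<open>j\<close>-th of capacity \<open>G (Suc j) - G j\<close>, filling
  them in order: the value is the fraction of cell \<open>j\<close> that gets filled.
\<close>

definition fill :: "(nat \<Rightarrow> real) \<Rightarrow> real \<Rightarrow> nat \<Rightarrow> real" where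
  "fill G s j = (min s (G (Suc j)) - min s (G j)) / (G (Suc j) - G j)"

text \<open>
  The points \<open>(a j, G j)\<close>, for \<open>j \<le> m\<close>, form a concave chain that starts at the origin. The slopes in
  \<open>vertex\<close> are nonnegative, hence \<open>G\<close> increases strictly.
\<close>

locale concave_chain =
  fixes a G :: "nat \<Rightarrow> real" and m :: nat
  assumes zero: "a 0 = 0" "G 0 = 0"
    and a_less: "\<And>j. j < m \<Longrightarrow> a j < a (Suc j)"
    and vertex: "\<And>j. 0 < j \<Longrightarrow> j \<le> m \<Longrightarrow> \<exists>c\<ge>0. \<forall>l\<le>m. l \<noteq> j \<longrightarrow> G l - c * a l < G j - c * a j"
begin

lemma a_mono: "i \<le> j \<Longrightarrow> j \<le> m \<Longrightarrow> a i \<le> a j"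
proof (induction j rule: dec_induct)
  case (step j)
  then show ?case using a_less[of j] by simp
qed simp

lemma G_less: "j < m \<Longrightarrow> G j < G (Suc j)"
proof -
  assume j: "j < m"
  then obtain c where "c \<ge> 0" "G j - c * a j < G (Suc j) - c * a (Suc j)"
    using vertex[of "Suc j"] by auto
  moreover have "c * a j \<le> c * a (Suc j)" using a_less[OF j] \<open>c \<ge> 0\<close> by (intro mult_left_mono) auto
  ultimately show ?thesis by linarith
qed

lemma G_mono: "i \<le> j \<Longrightarrow> j \<le> m \<Longrightarrow> G i \<le> G j"
proof (induction j rule: dec_induct)
  case (step j)
  then show ?case using G_less[of j] by simp
qed simp

text \<open>
  The slope of an edge lies between the slopes \<open>c\<close> at which its two end points are strict maximisers.
\<close>

lemma edge_supports:
  assumes k: "k < m" and l: "l \<le> m"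
  defines "\<sigma> \<equiv> (G (Suc k) - G k) / (a (Suc k) - a k)"
  shows "G l - \<sigma> * a l \<le> G k - \<sigma> * a k"
proof -
  have pos: "0 < a (Suc k) - a k" using a_less[OF k] by simp
  have \<sigma>: "\<sigma> * (a (Suc k) - a k) = G (Suc k) - G k" using pos by (simp add: \<sigma>_def)
  consider "l \<le> k" "l \<noteq> k" | "l = k \<or> l = Suc k" | "Suc k < l" by linarith
  then show ?thesis
  proof cases
    case 1
    then have "0 < k" by simp
    then obtain c where c: "\<And>l. l \<le> m \<Longrightarrow> l \<noteq> k \<Longrightarrow> G l - c * a l < G k - c * a k"
      using vertex[of k] k by auto
    have "\<sigma> * (a (Suc k) - a k) < c * (a (Suc k) - a k)"
      using c[of "Suc k"] k \<sigma> by (simp add: algebra_simps)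
    then have "\<sigma> \<le> c" using pos by simp
    then have "\<sigma> * (a k - a l) \<le> c * (a k - a l)"
      using a_mono[of l k] 1 k by (intro mult_right_mono) auto
    also have "\<dots> < G k - G l" using c[of l] 1 l by (simp add: algebra_simps)
    finally show ?thesis by (simp add: algebra_simps)
  next
    case 2
    then show ?thesis using \<sigma> by (auto simp: algebra_simps)
  next
    case 3
    obtain c where c: "\<And>l. l \<le> m \<Longrightarrow> l \<noteq> Suc k \<Longrightarrow> G l - c * a l < G (Suc k) - c * a (Suc k)"
      using vertex[of "Suc k"] k by auto
    have "c * (a (Suc k) - a k) < \<sigma> * (a (Suc k) - a k)"
      using c[of k] k \<sigma> by (simp add: algebra_simps)
    then have "c \<le> \<sigma>" using pos by simp
    then have "c * (a l - a (Suc k)) \<le> \<sigma> * (a l - a (Suc k))"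
      using a_mono[of "Suc k" l] 3 l by (intro mult_right_mono) auto
    moreover have "G l - G (Suc k) < c * (a l - a (Suc k))" using c[of l] 3 l by (simp add: algebra_simps)
    ultimately show ?thesis using \<sigma> by (simp add: algebra_simps)
  qed
qed

lemma fill_mono: "j < m \<Longrightarrow> s \<le> s' \<Longrightarrow> fill G s j \<le> fill G s' j"
  using G_less[of j] unfolding fill_def by (intro divide_right_mono) (auto simp: min_def)

lemma fill_0: "j < m \<Longrightarrow> fill G 0 j = 0"
  using G_mono[of 0 j] G_mono[of 0 "Suc j"] zero by (simp add: fill_def)

lemma fill_le_1: "j < m \<Longrightarrow> fill G s j \<le> 1"
  using G_less[of j] by (auto simp: fill_def divide_le_eq_1 min_def)

lemma fill_nonneg: "j < m \<Longrightarrow> 0 \<le> s \<Longrightarrow> 0 \<le> fill G s j"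
  using fill_mono[of j 0 s] fill_0 by simp

lemma fill_mult: "j < m \<Longrightarrow> fill G s j * (G (Suc j) - G j) = min s (G (Suc j)) - min s (G j)"
  using G_less[of j] by (simp add: fill_def)

lemma sum_fill: "0 \<le> s \<Longrightarrow> s \<le> G m \<Longrightarrow> (\<Sum>j<m. fill G s j * (G (Suc j) - G j)) = s"
  using sum_lessThan_telescope[of "\<lambda>j. min s (G j)" m] by (simp add: fill_mult zero)

text \<open>
  Filling up to level \<open>s\<close> means to take all cells before some \<open>k\<close> and a fraction \<open>t\<close> of cell \<open>k\<close>.
  The cumulated \<open>d\<close>-mass is at most \<open>C a\<close> at the vertices, so by linear interpolation the mass taken is at
  most \<open>C a'\<close>, where \<open>a'\<close> is the abscissa at which the concave chain reaches the height \<open>s\<close>. The line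
  through the edge \<open>k\<close> supports the chain, and comparison with it gives \<open>a' \<le> x\<close>.
\<close>

lemma sum_fill_le:
  fixes d :: "nat \<Rightarrow> ennreal"
  assumes s: "0 \<le> s" "s \<le> G m" and sx: "\<And>c. c \<ge> 0 \<Longrightarrow> \<exists>j\<le>m. s \<le> G j - c * a j + c * x"
    and d: "\<And>k. k \<le> m \<Longrightarrow> (\<Sum>j<k. d j) \<le> C * ennreal (a k)"
  shows "(\<Sum>j<m. ennreal (fill G s j) * d j) \<le> C * ennreal x"
proof (cases "m = 0")
  case False
  \<comment> \<open>the cell in which the level \<open>s\<close> is reached\<close>
  define k where "k = (GREATEST k. k < m \<and> G k \<le> s)"
  have ex: "0 < m \<and> G 0 \<le> s" using False s zero by simp
  have k: "k < m" "G k \<le> s"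
    using GreatestI_nat[of "\<lambda>k. k < m \<and> G k \<le> s", OF ex, of m] by (auto simp: k_def)
  have sk: "s \<le> G (Suc k)"
  proof (cases "Suc k = m")
    case False
    then have "\<not> G (Suc k) \<le> s"
      using Greatest_le_nat[of "\<lambda>k. k < m \<and> G k \<le> s" "Suc k" m] k by (auto simp: k_def)
    then show ?thesis by simp
  qed (use s in simp)
  define t where "t = fill G s k"
  have t: "0 \<le> t" "t \<le> 1" using fill_nonneg fill_le_1 k s by (auto simp: t_def)
  have tG: "t * (G (Suc k) - G k) = s - G k"
    using fill_mult[OF k(1), of s] sk k by (simp add: t_def)
  have one: "fill G s j = 1" if "j < k" for j
    using G_mono[of "Suc j" k] G_less[of j] that k by (simp add: fill_def)
  have nil: "fill G s j = 0" if "k < j" "j < m" for j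
    using G_mono[of "Suc k" j] G_mono[of "Suc k" "Suc j"] that sk by (simp add: fill_def)
  have "(\<Sum>j<m. ennreal (fill G s j) * d j) = (\<Sum>j<Suc k. ennreal (fill G s j) * d j)"
    using k nil by (intro sum.mono_neutral_right) auto
  also have "\<dots> = (\<Sum>j<k. d j) + ennreal t * d k" using one by (simp add: t_def)
  also have "\<dots> = ennreal (1 - t) * (\<Sum>j<k. d j) + ennreal t * (\<Sum>j<Suc k. d j)"
  proof -
    have "ennreal (1 - t) * y + ennreal t * (y + z) = y + ennreal t * z" for y z
    proof -
      have "ennreal (1 - t) * y + ennreal t * (y + z) = (ennreal (1 - t) + ennreal t) * y + ennreal t * z"
        by (simp add: distrib_left distrib_right add.assoc)
      then show ?thesis using t by (simp add: ennreal_plus[symmetric] del: ennreal_plus)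
    qed
    then show ?thesis by simp
  qed
  also have "\<dots> \<le> ennreal (1 - t) * (C * ennreal (a k)) + ennreal t * (C * ennreal (a (Suc k)))"
    using k by (intro add_mono mult_left_mono d) auto
  also have "\<dots> = C * (ennreal (1 - t) * ennreal (a k) + ennreal t * ennreal (a (Suc k)))"
    by (simp add: distrib_left mult.left_commute)
  also have "\<dots> = C * ennreal ((1 - t) * a k + t * a (Suc k))"
    using t a_mono[of 0 k] a_mono[of 0 "Suc k"] zero k by (simp add: ennreal_mult ennreal_plus)
  also have "\<dots> \<le> C * ennreal x"
  proof (intro mult_left_mono ennreal_leI)
    define \<sigma> where "\<sigma> = (G (Suc k) - G k) / (a (Suc k) - a k)"
    have \<sigma>: "0 < \<sigma>" "\<sigma> * (a (Suc k) - a k) = G (Suc k) - G k"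
      using a_less[OF k(1)] G_less[OF k(1)] by (auto simp: \<sigma>_def)
    obtain j where "j \<le> m" "s \<le> G j - \<sigma> * a j + \<sigma> * x" using sx[of \<sigma>] \<sigma> by auto
    then have "s - G k \<le> \<sigma> * (x - a k)"
      using edge_supports[OF k(1), of j, folded \<sigma>_def] by (simp add: algebra_simps)
    moreover have "\<sigma> * (t * (a (Suc k) - a k)) = s - G k"
      by (metis tG \<sigma>(2) mult.left_commute)
    ultimately have "\<sigma> * (t * (a (Suc k) - a k)) \<le> \<sigma> * (x - a k)" by simp
    then have "t * (a (Suc k) - a k) \<le> x - a k" using \<sigma>(1) by simp
    then show "(1 - t) * a k + t * a (Suc k) \<le> x" by (simp add: algebra_simps)
  qed simp
  finally show ?thesis .
qed simp

end

section \<open>Transport of mass along the core\<close>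

text \<open>
  The content \<open>\<Lambda> h\<close> describes where the mass \<open>h\<mu>\<close> is moved to. All clauses are closed
  conditions on the values \<open>\<Lambda> h E\<close>, so they survive pointwise limits.
\<close>

definition transport :: "'a measure \<Rightarrow> (('a \<Rightarrow> ennreal) \<Rightarrow> 'a set \<Rightarrow> ennreal) \<Rightarrow> bool" where
  "transport M \<Lambda> \<longleftrightarrow>
    (\<forall>h\<in>borel_measurable M. content M (\<Lambda> h) \<and> (\<forall>E\<in>null_sets M. \<Lambda> h E = 0) \<and>
       \<Lambda> h (space M) \<le> (\<integral>\<^sup>+u. h u \<partial>M)) \<and>
    (\<forall>h\<in>borel_measurable M. \<forall>k\<in>borel_measurable M. \<forall>E\<in>sets M.
       \<Lambda> (\<lambda>u. h u + k u) E = \<Lambda> h E + \<Lambda> k E) \<and>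
    (\<forall>h\<in>borel_measurable M. \<forall>c. \<forall>E\<in>sets M. \<Lambda> (\<lambda>u. ennreal c * h u) E = ennreal c * \<Lambda> h E) \<and>
    (\<forall>h\<in>borel_measurable M. \<forall>k\<in>borel_measurable M. \<forall>E\<in>sets M.
       (AE u in M. h u = k u) \<longrightarrow> \<Lambda> h E = \<Lambda> k E)"

lemma ennreal_divide_mult_le: "x / y * y \<le> (x :: ennreal)"
proof (cases "y = 0 \<or> y = top")
  case True
  then show ?thesis by auto
next
  case False
  then show ?thesis
    by (metis divide_ennreal_def ennreal_divide_self less_top mult.assoc mult.commute mult.right_neutral order_refl)
qed

context full_core_space
begin

text \<open>
  For each slope \<open>c\<close> some core set \<open>B\<close> satisfies the strict inequality for \<open>r F\<close>, \<open>r < 1\<close>: otherwise a line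
  of slope \<open>c\<close> would lie above all points of \<open>G\<close> but not above \<open>(\<mu>(A), F(A))\<close>. The set of slopes served by
  \<open>B\<close> is open, slopes above \<open>F(A) / \<mu>(A)\<close> are served by the empty set, and the remaining ones
  form a compact interval.
\<close>

lemma finite_witnesses:
  assumes N: "sets Nf = sets M" "sets Ng = sets M" and ac: "absolutely_continuous M Nf"
    and fin: "\<And>A. A \<in> \<A> \<Longrightarrow> emeasure Nf A < top" "\<And>A. A \<in> \<A> \<Longrightarrow> emeasure Ng A < top"
    and maj: "\<And>p c A. 0 \<le> p \<Longrightarrow> 0 \<le> c \<Longrightarrow> A \<in> \<A> \<Longrightarrow>
      (\<And>B. B \<in> \<A> \<Longrightarrow> emeasure Ng B \<le> ennreal p + ennreal c * emeasure M B) \<Longrightarrow>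
      emeasure Nf A \<le> ennreal p + ennreal c * emeasure M A"
    and r: "0 < r" "r < 1" and A: "A \<in> \<A>"
  shows "\<exists>\<B>\<subseteq>\<A>. finite \<B> \<and>
    (\<forall>c\<ge>0. \<exists>B\<in>\<B>. r * measure Nf A \<le> measure Ng B - c * measure M B + c * measure M A)"
proof (cases "measure Nf A = 0")
  case True
  then show ?thesis using core_empty by (intro exI[of _ "{{}}"]) auto
next
  case False
  define F where "F = measure Nf A"
  define x where "x = measure M A"
  have F: "0 < F" using False by (simp add: F_def less_le)
  have eNf: "emeasure Nf A = ennreal F" using fin(1)[OF A] by (simp add: F_def emeasure_eq_ennreal_measure less_top)
  have eNg: "emeasure Ng B = ennreal (measure Ng B)" if "B \<in> \<A>" for B
    using fin(2)[OF that] by (simp add: emeasure_eq_ennreal_measure less_top)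
  have x: "0 < x"
  proof (rule ccontr)
    assume "\<not> 0 < x"
    then have "x = 0" by (simp add: x_def less_le)
    then have "emeasure M A = 0" using core_emeasure_eq[OF A] by (simp add: x_def)
    then have "emeasure Nf A = 0" using absolutely_continuousD[OF ac] A core_sets by blast
    then show False using eNf F by simp
  qed
  define U where "U B = {c. r * F < measure Ng B - c * measure M B + c * x}" for B
  have "open (U B)" for B
    unfolding U_def by (intro open_Collect_less continuous_intros)
  moreover have "{0..F / x} \<subseteq> (\<Union>B\<in>\<A>. U B)"
  proof
    fix c assume c: "c \<in> {0..F / x}"
    show "c \<in> (\<Union>B\<in>\<A>. U B)"
    proof (rule ccontr)
      assume "\<not> ?thesis"
      then have le: "measure Ng B \<le> (r * F - c * x) + c * measure M B" if "B \<in> \<A>" for B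
        using that by (auto simp: U_def not_less algebra_simps)
      have p: "0 \<le> r * F - c * x" using le[OF core_empty] by simp
      have "emeasure Nf A \<le> ennreal (r * F - c * x) + ennreal c * emeasure M A"
      proof (rule maj[OF p _ A])
        fix B assume B: "B \<in> \<A>"
        have "ennreal (measure Ng B) \<le> ennreal ((r * F - c * x) + c * measure M B)"
          by (rule ennreal_leI[OF le[OF B]])
        also have "\<dots> = ennreal (r * F - c * x) + ennreal c * ennreal (measure M B)"
          using p c by (simp add: ennreal_mult)
        finally show "emeasure Ng B \<le> ennreal (r * F - c * x) + ennreal c * emeasure M B"
          by (simp only: eNg[OF B] core_emeasure_eq[OF B])
      qed (use c in auto)
      also have "\<dots> = ennreal (r * F - c * x + c * x)"
        using p c x
        by (simp add: core_emeasure_eq[OF A] x_def[symmetric] ennreal_mult[symmetric] ennreal_plus[symmetric]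
            del: ennreal_plus)
      finally have "F \<le> r * F" using r F by (simp add: eNf ennreal_le_iff)
      then show False using r F by simp
    qed
  qed
  ultimately obtain \<B> where B: "\<B> \<subseteq> \<A>" "finite \<B>" "{0..F / x} \<subseteq> (\<Union>B\<in>\<B>. U B)"
    using compactE_image[OF compact_Icc, of \<A> U 0 "F / x"] by metis
  have "\<exists>B\<in>insert {} \<B>. r * F \<le> measure Ng B - c * measure M B + c * x" if c: "0 \<le> c" for c
  proof (cases "c \<le> F / x")
    case True
    then obtain B where "B \<in> \<B>" "c \<in> U B" using B(3) c by auto
    then show ?thesis by (intro bexI[of _ B]) (auto simp: U_def)
  next
    case False
    then have "F < c * x" using x by (simp add: field_simps)
    moreover have "r * F \<le> F" using r F by simp
    ultimately show ?thesis by (intro bexI[of _ "{}"]) auto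
  qed
  then show ?thesis
    using B core_empty by (intro exI[of _ "insert {} \<B>"]) (auto simp: F_def x_def)
qed

text \<open>
  Two consecutive members of equal measure differ by a null set, so they give the same point and
  cannot both be vertices. Hence the abscissae increase strictly.
\<close>

lemma concave_core_chain:
  assumes N: "sets N = sets M" and ac: "absolutely_continuous M N"
    and finN: "\<forall>A\<in>\<A>. emeasure N A < top"
    and \<B>: "finite \<B>" "\<B> \<subseteq> \<A>"
  shows "\<exists>B m. B 0 = {} \<and> (\<forall>i\<le>m. B i \<in> \<A>) \<and> (\<forall>i<m. B i \<subset> B (Suc i)) \<and>
    concave_chain (\<lambda>j. measure M (B j)) (\<lambda>j. measure N (B j)) m \<and>
    (\<forall>D\<in>\<B>. \<forall>c\<ge>0. \<exists>j\<le>m. measure N D - c * measure M D \<le> measure N (B j) - c * measure M (B j))"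
proof -
  obtain T where T: "T \<subseteq> insert {} \<B>" "{} \<in> T"
    "\<forall>D\<in>insert {} \<B>. \<forall>c\<ge>0. \<exists>B\<in>T. measure N D - c * measure M D \<le> measure N B - c * measure M B"
    "\<forall>D\<in>T - {{}}. \<exists>c\<ge>0. \<forall>B\<in>T - {D}. measure N B - c * measure M B < measure N D - c * measure M D"
    using concave_subfamily[of "insert {} \<B>" "{}" "measure N" "measure M"] \<B>(1)
    by (elim meta_impE exE conjE) simp_all
  have fT: "finite T" "T \<subseteq> \<A>" using T(1) \<B> core_empty finite_subset by auto
  obtain B m where B: "B 0 = {}" "\<forall>i\<le>m. B i \<in> \<A>" "\<forall>i<m. B i \<subset> B (Suc i)" "B ` {..m} = insert {} T"
    using finite_core_enum[OF fT] by (elim exE conjE) (rule that)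
  have BT: "B ` {..m} = T" using B(4) T(2) by auto
  have less: "B i \<subset> B j" if "i < j" "j \<le> m" for i j
  proof -
    have "B i \<subset> B (Suc i)" using B(3) that by simp
    also have "B (Suc i) \<subseteq> B j" using chain_mono[of m B "Suc i" j] B(3) that by simp
    finally show ?thesis .
  qed
  have vertex: "\<exists>c\<ge>0. \<forall>l\<le>m. l \<noteq> j \<longrightarrow> measure N (B l) - c * measure M (B l) < measure N (B j) - c * measure M (B j)"
    if j: "0 < j" "j \<le> m" for j
  proof -
    have "B j \<in> T - {{}}" using BT less[of 0 j] j B(1) by auto
    then obtain c where c: "c \<ge> 0" "\<forall>D\<in>T - {B j}. measure N D - c * measure M D < measure N (B j) - c * measure M (B j)"
      using T(4) by blast
    have "B l \<in> T - {B j}" if "l \<le> m" "l \<noteq> j" for l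
      using that BT less[of l j] less[of j l] j by (cases "l < j") auto
    then show ?thesis using c by blast
  qed
  have "concave_chain (\<lambda>j. measure M (B j)) (\<lambda>j. measure N (B j)) m"
  proof
    fix j assume j: "j < m"
    have Bj: "B j \<in> \<A>" "B (Suc j) \<in> \<A>" "B j \<subset> B (Suc j)" using B j by auto
    have fm: "B (Suc j) \<in> fmeasurable M" "B (Suc j) \<in> fmeasurable N"
      using Bj core_emeasure_finite finN N core_sets by (auto intro!: fmeasurableI)
    have le: "measure M (B j) \<le> measure M (B (Suc j))"
      using Bj fm core_sets by (intro measure_mono_fmeasurable) auto
    show "measure M (B j) < measure M (B (Suc j))"
    proof (rule ccontr)
      assume "\<not> ?thesis"
      then have eq: "measure M (B j) = measure M (B (Suc j))" using le by simp
      have "emeasure M (B (Suc j) - B j) = 0"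
        using Bj eq core_emeasure_finite[OF Bj(1)] core_sets
        by (subst emeasure_Diff) (auto simp: core_emeasure_eq less_top)
      then have "emeasure N (B (Suc j) - B j) = 0"
        using absolutely_continuousD[OF ac] Bj core_sets by blast
      moreover have "emeasure N (B (Suc j)) = emeasure N (B j) + emeasure N (B (Suc j) - B j)"
        using Bj core_sets N by (subst plus_emeasure) (auto intro!: arg_cong[where f="emeasure N"])
      ultimately have "measure N (B (Suc j)) = measure N (B j)" by (simp add: measure_def)
      moreover obtain c where "\<forall>l\<le>m. l \<noteq> Suc j \<longrightarrow> measure N (B l) - c * measure M (B l)
          < measure N (B (Suc j)) - c * measure M (B (Suc j))"
        using vertex[of "Suc j"] j by auto
      then have "measure N (B j) - c * measure M (B j) < measure N (B (Suc j)) - c * measure M (B (Suc j))"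
        using j by simp
      ultimately show False using eq by simp
    qed
  qed (use B(1) vertex in auto)
  moreover have "\<exists>j\<le>m. measure N D - c * measure M D \<le> measure N (B j) - c * measure M (B j)"
    if "D \<in> \<B>" "c \<ge> 0" for D c
  proof -
    obtain E where "E \<in> T" "measure N D - c * measure M D \<le> measure N E - c * measure M E"
      using T(3) \<open>D \<in> \<B>\<close> \<open>c \<ge> 0\<close> by blast
    then show ?thesis unfolding BT[symmetric] by auto
  qed
  ultimately show ?thesis using B by (intro exI[of _ B] exI[of _ m]) auto
qed

text \<open>
  Let \<open>D j\<close> be the differences of a concave chain \<open>B\<close> for \<open>g\<close>, and \<open>E i\<close> those of the finite chain
  \<open>A\<close> of prescribed core sets. Line up both mass distributions by level: the cell \<open>D j\<close> of \<open>g\<close> occupies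
  the levels from \<open>G j\<close> to \<open>G (Suc j)\<close>, the cell \<open>E i\<close> of \<open>r f\<close> those from \<open>s i\<close> to \<open>s (Suc i)\<close>. The
  fraction \<open>q i j\<close> of the mass in \<open>D j\<close> whose levels belong to \<open>E i\<close> is moved to \<open>E i\<close> and distributed there
  in proportion to \<open>f\<close>. The set \<open>A k\<close> then receives the mass of the levels below \<open>s k\<close>, and since \<open>s k\<close>
  lies below the concave chain at the abscissa \<open>\<mu>(A k)\<close>, the bound follows from \<open>sum_fill_le\<close>.
\<close>

lemma finite_transport:
  assumes [measurable]: "f \<in> borel_measurable M" "g \<in> borel_measurable M"
    and fin: "\<And>A. A \<in> \<A> \<Longrightarrow> (\<integral>\<^sup>+u\<in>A. f u \<partial>M) < top" "\<And>A. A \<in> \<A> \<Longrightarrow> (\<integral>\<^sup>+u\<in>A. g u \<partial>M) < top"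
    and maj: "\<And>p c A. 0 \<le> p \<Longrightarrow> 0 \<le> c \<Longrightarrow> A \<in> \<A> \<Longrightarrow>
      (\<And>B. B \<in> \<A> \<Longrightarrow> (\<integral>\<^sup>+u\<in>B. g u \<partial>M) \<le> ennreal p + ennreal c * emeasure M B) \<Longrightarrow>
      (\<integral>\<^sup>+u\<in>A. f u \<partial>M) \<le> ennreal p + ennreal c * emeasure M A"
    and r: "0 < r" "r < 1" and \<F>: "finite \<F>" "\<F> \<subseteq> \<A>"
  shows "\<exists>\<Lambda>. transport M \<Lambda> \<and>
    (\<forall>A\<in>\<F>. \<forall>h\<in>borel_measurable M. \<forall>C.
       (\<forall>B\<in>\<A>. (\<integral>\<^sup>+u\<in>B. h u \<partial>M) \<le> C * emeasure M B) \<longrightarrow> \<Lambda> h A \<le> C * emeasure M A) \<and>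
    (\<forall>A\<in>\<F>. \<forall>E\<in>sets M. E \<subseteq> A \<longrightarrow> \<Lambda> g E = ennreal r * (\<integral>\<^sup>+u\<in>E. f u \<partial>M))"
proof -
  define Nf where "Nf = density M f"
  define Ng where "Ng = density M g"
  have Nsets [simp]: "sets Nf = sets M" "sets Ng = sets M" by (simp_all add: Nf_def Ng_def)
  have ac: "absolutely_continuous M Nf" "absolutely_continuous M Ng"
    unfolding Nf_def Ng_def by (auto intro!: absolutely_continuousI_density)
  have Nf: "emeasure Nf E = (\<integral>\<^sup>+u\<in>E. f u \<partial>M)" and Ng: "emeasure Ng E = (\<integral>\<^sup>+u\<in>E. g u \<partial>M)"
    if "E \<in> sets M" for E using that by (auto simp: Nf_def Ng_def emeasure_density)
  have finN: "emeasure Nf A < top" "emeasure Ng A < top" if "A \<in> \<A>" for A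
    using fin[OF that] core_sets[OF that] by (auto simp: Nf Ng)
  have finN2: "\<forall>A\<in>\<A>. emeasure Ng A < top" using finN(2) by blast
  have majN: "emeasure Nf A \<le> ennreal p + ennreal c * emeasure M A"
    if "0 \<le> p" "0 \<le> c" "A \<in> \<A>" "\<And>B. B \<in> \<A> \<Longrightarrow> emeasure Ng B \<le> ennreal p + ennreal c * emeasure M B" for p c A
  proof -
    have "(\<integral>\<^sup>+u\<in>B. g u \<partial>M) \<le> ennreal p + ennreal c * emeasure M B" if "B \<in> \<A>" for B
      using \<open>\<And>B. B \<in> \<A> \<Longrightarrow> emeasure Ng B \<le> _\<close>[OF that] Ng[OF core_sets[OF that]] by simp
    from maj[OF that(1-3) this] show ?thesis using Nf[OF core_sets[OF that(3)]] by simp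
  qed
  \<comment> \<open>core sets witnessing that \<open>r F(A)\<close> lies below the majorant of \<open>G\<close>\<close>
  define W where "W A = (SOME \<B>. \<B> \<subseteq> \<A> \<and> finite \<B> \<and>
    (\<forall>c\<ge>0. \<exists>B\<in>\<B>. r * measure Nf A \<le> measure Ng B - c * measure M B + c * measure M A))" for A
  have W: "W A \<subseteq> \<A> \<and> finite (W A) \<and>
    (\<forall>c\<ge>0. \<exists>B\<in>W A. r * measure Nf A \<le> measure Ng B - c * measure M B + c * measure M A)"
    if A: "A \<in> \<A>" for A
    unfolding W_def by (rule someI_ex) (rule finite_witnesses[OF Nsets ac(1) finN majN r A])
  define \<B> where "\<B> = (\<Union>A\<in>insert {} \<F>. W A)"
  have \<F>': "A \<in> \<A>" if "A \<in> insert {} \<F>" for A using that \<F> core_empty by auto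
  have \<B>: "finite \<B>" "\<B> \<subseteq> \<A>" using W[OF \<F>'] \<F>(1) unfolding \<B>_def by (blast intro: finite_UN_I)+
  obtain B m where B: "B 0 = {}" "\<forall>i\<le>m. B i \<in> \<A>" "\<forall>i<m. B i \<subset> B (Suc i)"
    and cc: "concave_chain (\<lambda>j. measure M (B j)) (\<lambda>j. measure Ng (B j)) m"
    and dom: "\<forall>D\<in>\<B>. \<forall>c\<ge>0. \<exists>j\<le>m. measure Ng D - c * measure M D \<le> measure Ng (B j) - c * measure M (B j)"
    using concave_core_chain[OF Nsets(2) ac(2) finN2 \<B>] by (elim exE conjE) (rule that)
  obtain A n where A: "A 0 = {}" "\<forall>i\<le>n. A i \<in> \<A>" "\<forall>i<n. A i \<subset> A (Suc i)" "A ` {..n} = insert {} \<F>"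
    using finite_core_enum[OF \<F>] by (elim exE conjE) (rule that)
  define a where "a j = measure M (B j)" for j
  define G where "G j = measure Ng (B j)" for j
  interpret concave_chain a G m using cc by (simp add: a_def[abs_def] G_def[abs_def])
  have Bs: "B j \<in> sets M" if "j \<le> m" for j using B(2) that core_sets by blast
  have As: "A i \<in> sets M" if "i \<le> n" for i using A(2) that core_sets by blast
  define D where "D j = B (Suc j) - B j" for j
  define E where "E i = A (Suc i) - A i" for i
  have Ds: "D j \<in> sets M" if "j < m" for j using Bs that by (auto simp: D_def)
  have Es: "E i \<in> sets M" if "i < n" for i using As that by (auto simp: E_def)
  have Am: "A i \<subseteq> A j" if "i \<le> j" "j \<le> n" for i j using chain_mono[of n A i j] A(3) that by simp
  have Bm: "B i \<subseteq> B j" if "i \<le> j" "j \<le> m" for i j using chain_mono[of m B i j] B(3) that by simp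
  have eA: "emeasure M (A i) = ennreal (measure M (A i))" "emeasure Nf (A i) = ennreal (measure Nf (A i))"
    if "i \<le> n" for i
    using core_emeasure_eq[of "A i"] finN(1)[of "A i"] A(2) that by (auto simp: emeasure_eq_ennreal_measure less_top)
  have eB: "emeasure M (B j) = ennreal (a j)" "emeasure Ng (B j) = ennreal (G j)" if "j \<le> m" for j
    using core_emeasure_eq[of "B j"] finN(2)[of "B j"] B(2) that
    by (auto simp: a_def G_def emeasure_eq_ennreal_measure less_top)
  define F where "F i = measure Nf (A i)" for i
  define s where "s i = r * F i" for i
  have NE: "emeasure Nf (E i) = ennreal (F (Suc i) - F i)" and F_mono: "F i \<le> F (Suc i)" if i: "i < n" for i
  proof -
    have sub: "A i \<subseteq> A (Suc i)" using A(3) i by auto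
    show "emeasure Nf (E i) = ennreal (F (Suc i) - F i)"
      unfolding E_def using sub As[of i] As[of "Suc i"] i eA(2)[of i] eA(2)[of "Suc i"]
      by (subst emeasure_Diff) (auto simp: F_def ennreal_minus)
    have "ennreal (F i) \<le> ennreal (F (Suc i))"
      unfolding F_def using emeasure_mono[OF sub, of Nf] As[of "Suc i"] i eA(2)[of i] eA(2)[of "Suc i"] by simp
    then show "F i \<le> F (Suc i)" by (simp add: F_def)
  qed
  have s0: "s 0 = 0" using A(1) by (simp add: s_def F_def)
  have s_mono: "s i \<le> s (Suc i)" if "i < n" for i using F_mono[OF that] r by (simp add: s_def)
  have s_nn: "0 \<le> s i" for i using r by (simp add: s_def F_def)
  have s_line: "\<exists>j\<le>m. s i \<le> G j - c * a j + c * measure M (A i)" if i: "i \<le> n" and c: "0 \<le> c" for i c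
  proof -
    have Ai: "A i \<in> insert {} \<F>" unfolding A(4)[symmetric] using i by simp
    obtain X where X: "X \<in> W (A i)" "s i \<le> measure Ng X - c * measure M X + c * measure M (A i)"
      using W[OF \<F>'[OF Ai]] c unfolding s_def F_def by blast
    then have "X \<in> \<B>" using Ai by (auto simp: \<B>_def)
    then obtain j where "j \<le> m" "measure Ng X - c * measure M X \<le> G j - c * a j"
      using dom c unfolding a_def G_def by blast
    with X show ?thesis by (intro exI[of _ j]) auto
  qed
  have s_le: "s i \<le> G m" if i: "i \<le> n" for i
    using s_line[OF i, of 0] G_mono by force
  define q where "q i j = fill G (s (Suc i)) j - fill G (s i) j" for i j
  have q: "0 \<le> q i j" if "i < n" "j < m" for i j using fill_mono[OF that(2) s_mono[OF that(1)]] by (simp add: q_def)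
  define H where "H h X = (\<integral>\<^sup>+u\<in>X. h u \<partial>M)" for h :: "'a \<Rightarrow> ennreal" and X
  \<comment> \<open>the total mass sent to \<open>E i\<close>, per unit of \<open>f\<close>-mass\<close>
  define w where "w h i = (\<Sum>j<m. ennreal (q i j) * H h (D j)) / emeasure Nf (E i)" for h i
  define \<Lambda> where "\<Lambda> h X = (\<Sum>i<n. w h i * emeasure Nf (X \<inter> E i))" for h X
  have H_density: "H h X = emeasure (density M h) X" if "h \<in> borel_measurable M" "X \<in> sets M" for h X
    using that by (simp add: H_def emeasure_density)
  have content: "content M (\<Lambda> h)" for h
    unfolding \<Lambda>_def[abs_def] by (intro content_sum content_cmult content_Int content_emeasure Es) auto
  have null: "\<Lambda> h X = 0" if X: "X \<in> null_sets M" for h X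
  proof -
    have "emeasure Nf (X \<inter> E i) = 0" if "i < n" for i
    proof -
      have "X \<inter> E i \<in> null_sets M" using null_set_Int2[OF X Es[OF that]] by (simp add: Int_commute)
      then show ?thesis using absolutely_continuousD[OF ac(1)] by auto
    qed
    then show ?thesis by (simp add: \<Lambda>_def)
  qed
  have upto: "\<Lambda> h (A k) \<le> (\<Sum>j<m. ennreal (fill G (s k) j) * H h (D j))" if k: "k \<le> n" for h k
  proof -
    have "\<Lambda> h (A k) = (\<Sum>i<k. w h i * emeasure Nf (E i))"
    proof -
      have "A k \<inter> E i = (if i < k then E i else {})" if "i < n" for i
        using Am[of "Suc i" k] Am[of k i] that k by (auto simp: E_def)
      then show ?thesis
        unfolding \<Lambda>_def using k by (intro sum.mono_neutral_cong_right) auto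
    qed
    also have "\<dots> \<le> (\<Sum>i<k. \<Sum>j<m. ennreal (q i j) * H h (D j))"
      unfolding w_def by (intro sum_mono ennreal_divide_mult_le)
    also have "\<dots> = (\<Sum>j<m. (\<Sum>i<k. ennreal (q i j)) * H h (D j))"
      by (subst sum.swap) (simp add: sum_distrib_right)
    also have "\<dots> = (\<Sum>j<m. ennreal (fill G (s k) j) * H h (D j))"
    proof (intro sum.cong refl arg_cong2[where f="(*)"])
      fix j assume j: "j \<in> {..<m}"
      have "(\<Sum>i<k. ennreal (q i j)) = ennreal (\<Sum>i<k. q i j)" using q j k by (intro sum_ennreal) auto
      also have "(\<Sum>i<k. q i j) = fill G (s k) j - fill G (s 0) j"
        unfolding q_def by (rule sum_lessThan_telescope)
      finally show "(\<Sum>i<k. ennreal (q i j)) = ennreal (fill G (s k) j)" using fill_0 j by (simp add: s0)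
    qed
    finally show ?thesis .
  qed
  have H_split: "(\<Sum>j<k. H h (D j)) \<le> H h X" if h: "h \<in> borel_measurable M" and k: "k \<le> m" and X: "X \<in> sets M" "B k \<subseteq> X" for h k X
  proof -
    have "X \<inter> D j = D j" if "j < k" for j using Bm[of "Suc j" k] that k X(2) by (auto simp: D_def)
    then have "(\<Sum>j<k. H h (D j)) = (\<Sum>j<k. emeasure (density M h) (X \<inter> D j))"
      using h Ds k by (intro sum.cong) (auto simp: H_density)
    also have "\<dots> \<le> (\<Sum>j<k. emeasure (density M h) (X \<inter> D j)) + emeasure (density M h) (X - B k)" by simp
    also have "\<dots> = emeasure (density M h) X"
      unfolding D_def by (rule emeasure_chain_split[symmetric]) (use B Bs k X in auto)
    finally show ?thesis using h X by (simp add: H_density)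
  qed
  have total: "\<Lambda> h (space M) \<le> (\<integral>\<^sup>+u. h u \<partial>M)" if h: "h \<in> borel_measurable M" for h
  proof -
    have "space M \<inter> E i = A n \<inter> E i" if "i < n" for i
      using Es[OF that] sets.sets_into_space Am[of "Suc i" n] that by (fastforce simp: E_def)
    then have "\<Lambda> h (space M) = \<Lambda> h (A n)" unfolding \<Lambda>_def by (intro sum.cong) auto
    also have "\<dots> \<le> (\<Sum>j<m. ennreal (fill G (s n) j) * H h (D j))" by (rule upto) simp
    also have "\<dots> \<le> (\<Sum>j<m. 1 * H h (D j))"
      using fill_le_1 by (intro sum_mono mult_right_mono) auto
    also have "\<dots> \<le> H h (space M)"
      using H_split[OF h order_refl, of "space M"] Bs[of m] sets.sets_into_space by auto
    also have "\<dots> = (\<integral>\<^sup>+u. h u \<partial>M)" unfolding H_def by (intro nn_integral_cong) auto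
    finally show ?thesis .
  qed
  have H_add: "H (\<lambda>u. h u + k u) X = H h X + H k X"
    if "h \<in> borel_measurable M" "k \<in> borel_measurable M" "X \<in> sets M" for h k X
    unfolding H_def using that by (simp add: distrib_right nn_integral_add)
  have H_cmult: "H (\<lambda>u. c * h u) X = c * H h X"
    if "h \<in> borel_measurable M" "X \<in> sets M" for h c X
    unfolding H_def using that by (simp add: mult.assoc nn_integral_cmult)
  have H_cong: "H h X = H k X" if "AE u in M. h u = k u" for h k X
    unfolding H_def using that by (intro nn_integral_cong_AE) auto
  have add: "\<Lambda> (\<lambda>u. h u + k u) X = \<Lambda> h X + \<Lambda> k X"
    if "h \<in> borel_measurable M" "k \<in> borel_measurable M" for h k X
  proof -
    have "w (\<lambda>u. h u + k u) i = w h i + w k i" for i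
      unfolding w_def using that Ds
      by (simp add: H_add distrib_left sum.distrib divide_ennreal_def distrib_right cong: sum.cong_simp)
    then show ?thesis by (simp add: \<Lambda>_def distrib_right sum.distrib)
  qed
  have cmult: "\<Lambda> (\<lambda>u. c * h u) X = c * \<Lambda> h X" if "h \<in> borel_measurable M" for h c X
  proof -
    have "(\<Sum>j<m. ennreal (q i j) * H (\<lambda>u. c * h u) (D j)) = c * (\<Sum>j<m. ennreal (q i j) * H h (D j))" for i
      unfolding sum_distrib_left using that Ds
      by (intro sum.cong refl) (simp add: H_cmult mult.left_commute)
    then have "w (\<lambda>u. c * h u) i = c * w h i" for i
      by (simp add: w_def divide_ennreal_def mult.assoc)
    then show ?thesis by (simp add: \<Lambda>_def sum_distrib_left mult.assoc)
  qed
  have cong: "\<Lambda> h X = \<Lambda> k X" if "AE u in M. h u = k u" for h k X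
    using H_cong[OF that] by (simp add: \<Lambda>_def w_def)
  have bound: "\<Lambda> h (A k) \<le> C * emeasure M (A k)"
    if k: "k \<le> n" and h: "h \<in> borel_measurable M" and le: "\<forall>B\<in>\<A>. H h B \<le> C * emeasure M B" for h C k
  proof -
    have "\<Lambda> h (A k) \<le> (\<Sum>j<m. ennreal (fill G (s k) j) * H h (D j))" by (rule upto[OF k])
    also have "\<dots> \<le> C * ennreal (measure M (A k))"
    proof (rule sum_fill_le[OF s_nn s_le[OF k]])
      show "\<exists>j\<le>m. s k \<le> G j - c * a j + c * measure M (A k)" if "0 \<le> c" for c by (rule s_line[OF k that])
      fix l assume l: "l \<le> m"
      have "(\<Sum>j<l. H h (D j)) \<le> H h (B l)" by (rule H_split[OF h l Bs[OF l] order_refl])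
      also have "\<dots> \<le> C * emeasure M (B l)" using le B(2) l by blast
      finally show "(\<Sum>j<l. H h (D j)) \<le> C * ennreal (a l)" by (simp add: eB[OF l])
    qed
    finally show ?thesis by (simp add: eA[OF k])
  qed
  have image: "\<Lambda> g X = ennreal r * emeasure Nf X" if k: "k \<le> n" and X: "X \<in> sets M" "X \<subseteq> A k" for k X
  proof -
    have "w g i * emeasure Nf (X \<inter> E i) = ennreal r * emeasure Nf (X \<inter> E i)" if i: "i < n" for i
    proof (cases "F i = F (Suc i)")
      case True
      then have "emeasure Nf (E i) = 0" by (simp add: NE[OF i])
      moreover have "emeasure Nf (X \<inter> E i) \<le> emeasure Nf (E i)" using Es[OF i] by (intro emeasure_mono) auto
      ultimately show ?thesis by simp
    next
      case False
      then have lt: "F i < F (Suc i)" using F_mono[OF i] by simp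
      have HD: "H g (D j) = ennreal (G (Suc j) - G j)" if j: "j < m" for j
      proof -
        have "H g (D j) = emeasure Ng (D j)" using Ds[OF j] by (simp add: H_def Ng)
        also have "\<dots> = ennreal (G (Suc j)) - ennreal (G j)"
          unfolding D_def using Bs[of j] Bs[of "Suc j"] j Bm[of j "Suc j"] eB(2)[of j] eB(2)[of "Suc j"]
          by (subst emeasure_Diff) auto
        finally show ?thesis by (simp add: ennreal_minus G_def)
      qed
      have "(\<Sum>j<m. ennreal (q i j) * H g (D j)) = (\<Sum>j<m. ennreal (q i j * (G (Suc j) - G j)))"
        using HD q[OF i] G_less by (intro sum.cong refl) (simp add: ennreal_mult less_imp_le)
      also have "\<dots> = ennreal (\<Sum>j<m. q i j * (G (Suc j) - G j))"
        using q[OF i] G_less by (intro sum_ennreal) (auto simp: less_imp_le)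
      also have "(\<Sum>j<m. q i j * (G (Suc j) - G j)) = s (Suc i) - s i"
        unfolding q_def left_diff_distrib sum_subtractf
        using sum_fill[OF s_nn s_le] i by simp
      finally have "w g i = ennreal (r * (F (Suc i) - F i)) / ennreal (F (Suc i) - F i)"
        by (simp add: w_def NE[OF i] s_def right_diff_distrib)
      also have "\<dots> = ennreal r" using lt r by (simp add: divide_ennreal)
      finally show ?thesis by simp
    qed
    then have "\<Lambda> g X = ennreal r * (\<Sum>i<n. emeasure Nf (X \<inter> E i))"
      by (simp add: \<Lambda>_def sum_distrib_left)
    also have "X - A n = {}" using X(2) Am[OF k order_refl] by auto
    then have "(\<Sum>i<n. emeasure Nf (X \<inter> E i)) = (\<Sum>i<n. emeasure Nf (X \<inter> E i)) + emeasure Nf (X - A n)"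
      by (simp only: emeasure_empty add_0_right)
    also have "\<dots> = emeasure Nf X"
      unfolding E_def by (rule emeasure_chain_split[symmetric]) (use A As X in auto)
    finally show ?thesis .
  qed
  have index: "\<exists>k\<le>n. X = A k" if "X \<in> \<F>" for X
  proof -
    have "X \<in> A ` {..n}" unfolding A(4) using that by simp
    then show ?thesis by auto
  qed
  have "transport M \<Lambda>"
    unfolding transport_def using content null total add cmult cong by auto
  moreover have "\<Lambda> h X \<le> C * emeasure M X"
    if "X \<in> \<F>" "h \<in> borel_measurable M" "\<forall>B\<in>\<A>. (\<integral>\<^sup>+u\<in>B. h u \<partial>M) \<le> C * emeasure M B" for X h C
    using index[OF that(1)] bound[of _ h C] that(2,3) by (auto simp: H_def)
  moreover have "\<Lambda> g Y = ennreal r * (\<integral>\<^sup>+u\<in>Y. f u \<partial>M)" if "X \<in> \<F>" "Y \<in> sets M" "Y \<subseteq> X" for X Y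
    using index[OF that(1)] image[OF _ that(2)] that(3) by (auto simp: Nf[OF that(2)])
  ultimately show ?thesis by (intro exI[of _ \<Lambda>] conjI ballI allI impI)
qed

end

lemma transportD:
  assumes "transport M \<Lambda>" and "h \<in> borel_measurable M"
  shows "content M (\<Lambda> h)" "E \<in> null_sets M \<Longrightarrow> \<Lambda> h E = 0" "\<Lambda> h (space M) \<le> (\<integral>\<^sup>+u. h u \<partial>M)"
    and "k \<in> borel_measurable M \<Longrightarrow> D \<in> sets M \<Longrightarrow> \<Lambda> (\<lambda>u. h u + k u) D = \<Lambda> h D + \<Lambda> k D"
    and "D \<in> sets M \<Longrightarrow> \<Lambda> (\<lambda>u. ennreal c * h u) D = ennreal c * \<Lambda> h D"
    and "k \<in> borel_measurable M \<Longrightarrow> D \<in> sets M \<Longrightarrow> AE u in M. h u = k u \<Longrightarrow> \<Lambda> h D = \<Lambda> k D"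
proof -
  note T = assms(1)[unfolded transport_def]
  show "content M (\<Lambda> h)" "E \<in> null_sets M \<Longrightarrow> \<Lambda> h E = 0" "\<Lambda> h (space M) \<le> (\<integral>\<^sup>+u. h u \<partial>M)"
    using T[THEN conjunct1, rule_format, OF assms(2)] by auto
  show "k \<in> borel_measurable M \<Longrightarrow> D \<in> sets M \<Longrightarrow> \<Lambda> (\<lambda>u. h u + k u) D = \<Lambda> h D + \<Lambda> k D"
    by (rule T[THEN conjunct2, THEN conjunct1, rule_format, OF assms(2)])
  show "D \<in> sets M \<Longrightarrow> \<Lambda> (\<lambda>u. ennreal c * h u) D = ennreal c * \<Lambda> h D"
    by (rule T[THEN conjunct2, THEN conjunct2, THEN conjunct1, rule_format, OF assms(2)])
  show "k \<in> borel_measurable M \<Longrightarrow> D \<in> sets M \<Longrightarrow> AE u in M. h u = k u \<Longrightarrow> \<Lambda> h D = \<Lambda> k D"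
    by (rule T[THEN conjunct2, THEN conjunct2, THEN conjunct2, rule_format, OF assms(2)])
qed

lemma transport_limit:
  fixes F :: "'n filter" and X :: "'n \<Rightarrow> ('a \<Rightarrow> ennreal) \<Rightarrow> 'a set \<Rightarrow> ennreal"
  assumes F: "F \<noteq> bot" and ev: "eventually (\<lambda>n. transport M (X n)) F"
    and lim: "\<And>h E. ((\<lambda>n. X n h E) \<longlongrightarrow> \<Lambda> h E) F"
  shows "transport M \<Lambda>"
proof -
  have eq: "L = R" if "eventually (\<lambda>n. l n = r n) F" "(l \<longlongrightarrow> L) F" "(r \<longlongrightarrow> R) F"
    for l r :: "'n \<Rightarrow> ennreal" and L R
    by (rule tendsto_unique[OF F Lim_transform_eventually[OF that(2,1)] that(3)])
  have ct: "content M (\<Lambda> h)" if h: "h \<in> borel_measurable M" for h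
  proof (rule content_limit[OF F _ lim])
    show "eventually (\<lambda>n. content M (X n h)) F"
      using ev by eventually_elim (rule transportD(1)[OF _ h])
  qed
  have null: "\<Lambda> h E = 0" if h: "h \<in> borel_measurable M" and E: "E \<in> null_sets M" for h E
  proof (rule eq[OF _ lim tendsto_const])
    show "eventually (\<lambda>n. X n h E = 0) F"
      using ev by eventually_elim (rule transportD(2)[OF _ h E])
  qed
  have le: "\<Lambda> h (space M) \<le> (\<integral>\<^sup>+u. h u \<partial>M)" if h: "h \<in> borel_measurable M" for h
  proof (rule tendsto_upperbound[OF lim _ F])
    show "eventually (\<lambda>n. X n h (space M) \<le> (\<integral>\<^sup>+u. h u \<partial>M)) F"
      using ev by eventually_elim (rule transportD(3)[OF _ h])
  qed
  have add: "\<Lambda> (\<lambda>u. h u + k u) E = \<Lambda> h E + \<Lambda> k E"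
    if h: "h \<in> borel_measurable M" and kE: "k \<in> borel_measurable M" "E \<in> sets M" for h k E
  proof (rule eq[OF _ lim tendsto_add[OF lim lim]])
    show "eventually (\<lambda>n. X n (\<lambda>u. h u + k u) E = X n h E + X n k E) F"
      using ev by eventually_elim (rule transportD(4)[OF _ h kE])
  qed
  have cm: "\<Lambda> (\<lambda>u. ennreal c * h u) E = ennreal c * \<Lambda> h E"
    if h: "h \<in> borel_measurable M" and E: "E \<in> sets M" for h c E
  proof (rule eq[OF _ lim ennreal_tendsto_cmult[OF _ lim]])
    show "eventually (\<lambda>n. X n (\<lambda>u. ennreal c * h u) E = ennreal c * X n h E) F"
      using ev by eventually_elim (rule transportD(5)[OF _ h E])
  qed simp
  have cong: "\<Lambda> h E = \<Lambda> k E"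
    if h: "h \<in> borel_measurable M" and kE: "k \<in> borel_measurable M" "E \<in> sets M" "AE u in M. h u = k u" for h k E
  proof (rule eq[OF _ lim lim])
    show "eventually (\<lambda>n. X n h E = X n k E) F"
      using ev by eventually_elim (rule transportD(6)[OF _ h kE])
  qed
  show ?thesis unfolding transport_def
    by (intro conjI ballI allI impI) (rule ct null le add cm cong; assumption)+
qed

context full_core_space
begin

text \<open>
  The limit of the transports of \<open>finite_transport\<close> as the finite set of core sets grows to the whole
  core and \<open>r\<close> tends to \<open>1\<close>.
\<close>

lemma exact_transport:
  assumes fg: "f \<in> borel_measurable M" "g \<in> borel_measurable M"
    and fin: "\<And>A. A \<in> \<A> \<Longrightarrow> (\<integral>\<^sup>+u\<in>A. f u \<partial>M) < top" "\<And>A. A \<in> \<A> \<Longrightarrow> (\<integral>\<^sup>+u\<in>A. g u \<partial>M) < top"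
    and maj: "\<And>p c A. 0 \<le> p \<Longrightarrow> 0 \<le> c \<Longrightarrow> A \<in> \<A> \<Longrightarrow>
      (\<And>B. B \<in> \<A> \<Longrightarrow> (\<integral>\<^sup>+u\<in>B. g u \<partial>M) \<le> ennreal p + ennreal c * emeasure M B) \<Longrightarrow>
      (\<integral>\<^sup>+u\<in>A. f u \<partial>M) \<le> ennreal p + ennreal c * emeasure M A"
  shows "\<exists>\<Lambda>. transport M \<Lambda> \<and>
    (\<forall>A\<in>\<A>. \<forall>h\<in>borel_measurable M. \<forall>C.
       (\<forall>B\<in>\<A>. (\<integral>\<^sup>+u\<in>B. h u \<partial>M) \<le> C * emeasure M B) \<longrightarrow> \<Lambda> h A \<le> C * emeasure M A) \<and>
    (\<forall>A\<in>\<A>. \<forall>E\<in>sets M. E \<subseteq> A \<longrightarrow> \<Lambda> g E = (\<integral>\<^sup>+u\<in>E. f u \<partial>M))"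
proof -
  define norm_bound where "norm_bound \<Lambda> A \<longleftrightarrow> (\<forall>h\<in>borel_measurable M. \<forall>C.
       (\<forall>B\<in>\<A>. (\<integral>\<^sup>+u\<in>B. h u \<partial>M) \<le> C * emeasure M B) \<longrightarrow> \<Lambda> h A \<le> C * emeasure M A)"
    for \<Lambda> :: "('a \<Rightarrow> ennreal) \<Rightarrow> 'a set \<Rightarrow> ennreal" and A
  define maps_to where "maps_to \<Lambda> r A \<longleftrightarrow> (\<forall>E\<in>sets M. E \<subseteq> A \<longrightarrow> \<Lambda> g E = ennreal r * (\<integral>\<^sup>+u\<in>E. f u \<partial>M))"
    for \<Lambda> :: "('a \<Rightarrow> ennreal) \<Rightarrow> 'a set \<Rightarrow> ennreal" and r A
  define good where "good \<F> r \<Lambda> \<longleftrightarrow> transport M \<Lambda> \<and> (\<forall>A\<in>\<F>. norm_bound \<Lambda> A) \<and> (\<forall>A\<in>\<F>. maps_to \<Lambda> r A)"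
    for \<F> r \<Lambda>
  define X where "X n = (SOME \<Lambda>. good (fst n) (snd n) \<Lambda>)" for n
  have X: "good (fst n) (snd n) (X n)" if "finite (fst n)" "fst n \<subseteq> \<A>" "0 < snd n" "snd n < 1" for n
  proof -
    have "\<exists>\<Lambda>. good (fst n) (snd n) \<Lambda>"
      unfolding good_def norm_bound_def maps_to_def
      by (rule finite_transport[OF fg fin maj that(3,4,1,2)])
    then show ?thesis unfolding X_def by (rule someI_ex[of "good (fst n) (snd n)"])
  qed
  define P where "P = finite_subsets_at_top \<A> \<times>\<^sub>F at_left (1::real)"
  have "P \<noteq> bot" by (simp add: P_def prod_filter_eq_bot finite_subsets_at_top_neq_bot)
  then obtain F L where F: "F \<le> P" "F \<noteq> bot"
    and lim: "\<forall>i. ((\<lambda>n. X n (fst i) (snd i)) \<longlongrightarrow> L i) F"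
    by (rule convergent_subfilter[where X="\<lambda>n i. X n (fst i) (snd i)"]) (rule that)
  define \<Lambda> where "\<Lambda> h E = L (h, E)" for h E
  have lim: "((\<lambda>n. X n h E) \<longlongrightarrow> \<Lambda> h E) F" for h E using lim[THEN spec, of "(h, E)"] by (simp add: \<Lambda>_def)
  have ev1: "eventually (\<lambda>n. Q (fst n)) F" if "eventually Q (finite_subsets_at_top \<A>)" for Q
    by (rule filter_leD[OF F(1)]) (unfold P_def eventually_prod_filter,
        rule exI[of _ Q], rule exI[of _ "\<lambda>_. True"], use that in simp)
  have ev2: "eventually (\<lambda>n. Q (snd n)) F" if "eventually Q (at_left 1)" for Q
    by (rule filter_leD[OF F(1)]) (unfold P_def eventually_prod_filter,
        rule exI[of _ "\<lambda>_. True"], rule exI[of _ Q], use that in simp)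
  have "eventually (\<lambda>r::real. 0 < r \<and> r < 1) (at_left 1)"
    using eventually_at_left_real[of 0 "1::real"] by simp
  then have "eventually (\<lambda>n. 0 < snd n \<and> snd n < 1) F" by (rule ev2)
  moreover have "eventually (\<lambda>n. finite (fst n) \<and> fst n \<subseteq> \<A>) F"
    by (intro ev1 eventually_finite_subsets_at_top_weakI) auto
  ultimately have good: "eventually (\<lambda>n. good (fst n) (snd n) (X n)) F"
    by eventually_elim (use X in auto)
  have mem: "eventually (\<lambda>n. A \<in> fst n) F" if "A \<in> \<A>" for A
  proof (rule ev1)
    show "eventually (\<lambda>\<F>. A \<in> \<F>) (finite_subsets_at_top \<A>)"
      using that by (auto simp: eventually_finite_subsets_at_top intro!: exI[of _ "{A}"])
  qed
  have "transport M \<Lambda>"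
    by (rule transport_limit[OF F(2) eventually_mono[OF good] lim]) (simp add: good_def)
  moreover have "\<Lambda> h A \<le> C * emeasure M A"
    if A: "A \<in> \<A>" and h: "h \<in> borel_measurable M" "\<forall>B\<in>\<A>. (\<integral>\<^sup>+u\<in>B. h u \<partial>M) \<le> C * emeasure M B" for A h C
  proof (rule tendsto_upperbound[OF lim _ F(2)])
    show "eventually (\<lambda>n. X n h A \<le> C * emeasure M A) F"
      using good mem[OF A]
    proof eventually_elim
      case (elim n)
      then have "norm_bound (X n) A" by (simp add: good_def)
      then show ?case using h by (simp add: norm_bound_def)
    qed
  qed
  moreover have "\<Lambda> g E = (\<integral>\<^sup>+u\<in>E. f u \<partial>M)" if A: "A \<in> \<A>" and E: "E \<in> sets M" "E \<subseteq> A" for A E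
  proof (rule tendsto_unique[OF F(2) lim])
    have "(\<integral>\<^sup>+u\<in>E. f u \<partial>M) \<le> (\<integral>\<^sup>+u\<in>A. f u \<partial>M)"
      using E by (intro nn_integral_mono) (auto simp: indicator_def)
    then have fE: "(\<integral>\<^sup>+u\<in>E. f u \<partial>M) < top" using fin(1)[OF A] by (rule le_less_trans)
    have "eventually (\<lambda>n. ennreal (snd n) * (\<integral>\<^sup>+u\<in>E. f u \<partial>M) = X n g E) F"
      using good mem[OF A]
    proof eventually_elim
      case (elim n)
      then have "maps_to (X n) (snd n) A" by (simp add: good_def)
      then show ?case using E by (simp add: maps_to_def)
    qed
    moreover have "((\<lambda>n. ennreal (snd n) * (\<integral>\<^sup>+u\<in>E. f u \<partial>M)) \<longlongrightarrow> ennreal 1 * (\<integral>\<^sup>+u\<in>E. f u \<partial>M)) F"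
    proof -
      have "filterlim snd (at_left (1::real)) F"
        by (rule filterlim_mono[OF filterlim_snd order_refl F(1)[unfolded P_def]])
      then have "((\<lambda>n. snd n) \<longlongrightarrow> (1::real)) F"
        by (rule filterlim_mono[OF _ at_within_le_nhds order_refl])
      then have "((\<lambda>n. ennreal (snd n)) \<longlongrightarrow> ennreal 1) F" by (rule tendsto_ennrealI)
      then have "((\<lambda>n. (\<integral>\<^sup>+u\<in>E. f u \<partial>M) * ennreal (snd n)) \<longlongrightarrow> (\<integral>\<^sup>+u\<in>E. f u \<partial>M) * ennreal 1) F"
        using fE by (intro ennreal_tendsto_cmult) simp_all
      then show ?thesis by (simp only: mult.commute)
    qed
    ultimately have "((\<lambda>n. X n g E) \<longlongrightarrow> ennreal 1 * (\<integral>\<^sup>+u\<in>E. f u \<partial>M)) F"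
      by (rule Lim_transform_eventually[rotated])
    then show "((\<lambda>n. X n g E) \<longlongrightarrow> (\<integral>\<^sup>+u\<in>E. f u \<partial>M)) F" by simp
  qed
  ultimately show ?thesis by (intro exI[of _ \<Lambda>]) blast
qed

end

section \<open>Linear extension of additive operators on nonnegative functions\<close>

text \<open>
  Additivity on \<open>[0, \<infinity>]\<close>-valued functions takes care of positivity and monotonicity; infinite values of
  \<open>P h\<close> are permitted.
\<close>

locale positive_operator =
  fixes M :: "'a measure" and P :: "('a \<Rightarrow> ennreal) \<Rightarrow> 'a \<Rightarrow> ennreal"
  assumes measurable_P [measurable]: "h \<in> borel_measurable M \<Longrightarrow> P h \<in> borel_measurable M"
    and P_add: "h \<in> borel_measurable M \<Longrightarrow> k \<in> borel_measurable M \<Longrightarrow>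
      AE u in M. P (\<lambda>v. h v + k v) u = P h u + P k u"
    and P_cmult: "h \<in> borel_measurable M \<Longrightarrow> AE u in M. P (\<lambda>v. ennreal c * h v) u = ennreal c * P h u"
    and P_cong: "h \<in> borel_measurable M \<Longrightarrow> k \<in> borel_measurable M \<Longrightarrow> AE u in M. h u = k u \<Longrightarrow>
      AE u in M. P h u = P k u"
begin

lemma P_mono:
  assumes [measurable]: "h \<in> borel_measurable M" "k \<in> borel_measurable M" and le: "AE u in M. h u \<le> k u"
  shows "AE u in M. P h u \<le> P k u"
proof -
  have "AE u in M. k u = h u + (k u - h u)" using le by eventually_elim (simp add: add_diff_inverse_ennreal)
  then have "AE u in M. P k u = P (\<lambda>v. h v + (k v - h v)) u" by (intro P_cong) auto
  moreover have "AE u in M. P (\<lambda>v. h v + (k v - h v)) u = P h u + P (\<lambda>v. k v - h v) u"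
    by (intro P_add) auto
  ultimately show ?thesis by eventually_elim simp
qed

lemma P_add_cmult:
  assumes [measurable]: "h \<in> borel_measurable M" "k \<in> borel_measurable M"
  shows "AE u in M. P (\<lambda>v. h v + ennreal c * k v) u = P h u + ennreal c * P k u"
proof -
  have "AE u in M. P (\<lambda>v. h v + ennreal c * k v) u = P h u + P (\<lambda>v. ennreal c * k v) u"
    by (intro P_add) auto
  moreover have "AE u in M. P (\<lambda>v. ennreal c * k v) u = ennreal c * P k u" by (intro P_cmult) auto
  ultimately show ?thesis by eventually_elim simp
qed

text \<open>
  The shape of both sides of \<open>parts_identity\<close>, from which linearity of the extension is deduced.
\<close>

lemma P_combination:
  assumes [measurable]: "h \<in> borel_measurable M" "h\<^sub>1 \<in> borel_measurable M" "h\<^sub>2 \<in> borel_measurable M"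
    "h\<^sub>3 \<in> borel_measurable M" "h\<^sub>4 \<in> borel_measurable M"
  shows "AE u in M. P (\<lambda>v. h v + ennreal c\<^sub>1 * h\<^sub>1 v + ennreal c\<^sub>2 * h\<^sub>2 v + ennreal c\<^sub>3 * h\<^sub>3 v + ennreal c\<^sub>4 * h\<^sub>4 v) u
    = P h u + ennreal c\<^sub>1 * P h\<^sub>1 u + ennreal c\<^sub>2 * P h\<^sub>2 u + ennreal c\<^sub>3 * P h\<^sub>3 u + ennreal c\<^sub>4 * P h\<^sub>4 u"
proof -
  have "AE u in M. P (\<lambda>v. h v + ennreal c\<^sub>1 * h\<^sub>1 v) u = P h u + ennreal c\<^sub>1 * P h\<^sub>1 u"
    by (intro P_add_cmult) auto
  moreover have "AE u in M. P (\<lambda>v. h v + ennreal c\<^sub>1 * h\<^sub>1 v + ennreal c\<^sub>2 * h\<^sub>2 v) u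
      = P (\<lambda>v. h v + ennreal c\<^sub>1 * h\<^sub>1 v) u + ennreal c\<^sub>2 * P h\<^sub>2 u"
    by (intro P_add_cmult) auto
  moreover have "AE u in M. P (\<lambda>v. h v + ennreal c\<^sub>1 * h\<^sub>1 v + ennreal c\<^sub>2 * h\<^sub>2 v + ennreal c\<^sub>3 * h\<^sub>3 v) u
      = P (\<lambda>v. h v + ennreal c\<^sub>1 * h\<^sub>1 v + ennreal c\<^sub>2 * h\<^sub>2 v) u + ennreal c\<^sub>3 * P h\<^sub>3 u"
    by (intro P_add_cmult) auto
  moreover have "AE u in M. P (\<lambda>v. h v + ennreal c\<^sub>1 * h\<^sub>1 v + ennreal c\<^sub>2 * h\<^sub>2 v + ennreal c\<^sub>3 * h\<^sub>3 v + ennreal c\<^sub>4 * h\<^sub>4 v) u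
      = P (\<lambda>v. h v + ennreal c\<^sub>1 * h\<^sub>1 v + ennreal c\<^sub>2 * h\<^sub>2 v + ennreal c\<^sub>3 * h\<^sub>3 v) u + ennreal c\<^sub>4 * P h\<^sub>4 u"
    by (intro P_add_cmult) auto
  ultimately show ?thesis by eventually_elim simp
qed

text \<open>
  The difference \<open>P k\<^sup>+ - P k\<^sup>-\<close>: note that \<open>e2ennreal\<close> sends negative numbers to \<open>0\<close>.
\<close>

definition signed :: "('a \<Rightarrow> ereal) \<Rightarrow> 'a \<Rightarrow> ereal" where
  "signed k u = enn2ereal (P (\<lambda>v. e2ennreal (k v)) u) - enn2ereal (P (\<lambda>v. e2ennreal (- k v)) u)"

text \<open>
  The functions on which the extension involves no difference of infinities.
\<close>

definition signed_dom :: "('a \<Rightarrow> ereal) set" where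
  "signed_dom = {k \<in> borel_measurable M. (AE u in M. \<bar>k u\<bar> \<noteq> \<infinity>) \<and> (AE u in M. P (\<lambda>v. e2ennreal \<bar>k v\<bar>) u < top)}"

lemma measurable_signed [measurable]: "k \<in> borel_measurable M \<Longrightarrow> signed k \<in> borel_measurable M"
proof -
  assume [measurable]: "k \<in> borel_measurable M"
  have "(\<lambda>v. e2ennreal (k v)) \<in> borel_measurable M" "(\<lambda>v. e2ennreal (- k v)) \<in> borel_measurable M"
    by measurable
  note [measurable] = this[THEN measurable_P]
  show "signed k \<in> borel_measurable M" unfolding signed_def[abs_def] by measurable
qed

lemma P_parts:
  assumes [measurable]: "k \<in> borel_measurable M"
  shows "AE u in M. P (\<lambda>v. e2ennreal (k v)) u + P (\<lambda>v. e2ennreal (- k v)) u = P (\<lambda>v. e2ennreal \<bar>k v\<bar>) u"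
proof -
  have *: "e2ennreal x + e2ennreal (- x) = e2ennreal \<bar>x\<bar>" for x
    by (cases "0 \<le> x") (auto simp: e2ennreal_neg abs_ereal.simps)
  have "AE u in M. P (\<lambda>v. e2ennreal (k v) + e2ennreal (- k v)) u
      = P (\<lambda>v. e2ennreal (k v)) u + P (\<lambda>v. e2ennreal (- k v)) u"
    by (intro P_add) auto
  then show ?thesis unfolding * by eventually_elim simp
qed

lemma signed_dom_parts:
  assumes "k \<in> signed_dom"
  shows "AE u in M. P (\<lambda>v. e2ennreal (k v)) u < top \<and> P (\<lambda>v. e2ennreal (- k v)) u < top"
proof -
  have k [measurable]: "k \<in> borel_measurable M" and fin: "AE u in M. P (\<lambda>v. e2ennreal \<bar>k v\<bar>) u < top"
    using assms by (auto simp: signed_dom_def)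
  show ?thesis using P_parts[OF k] fin
    by eventually_elim (metis ennreal_add_less_top)
qed

lemma signed_finite:
  assumes "k \<in> signed_dom"
  shows "AE u in M. \<bar>signed k u\<bar> \<noteq> \<infinity>"
  using signed_dom_parts[OF assms]
proof eventually_elim
  case (elim u)
  then show ?case unfolding signed_def
    by (cases "P (\<lambda>v. e2ennreal (k v)) u"; cases "P (\<lambda>v. e2ennreal (- k v)) u") auto
qed

lemma abs_signed_le:
  assumes k: "k \<in> borel_measurable M"
  shows "AE u in M. e2ennreal \<bar>signed k u\<bar> \<le> P (\<lambda>v. e2ennreal \<bar>k v\<bar>) u"
  using P_parts[OF k]
proof eventually_elim
  case (elim u)
  have "e2ennreal \<bar>enn2ereal x - enn2ereal y\<bar> \<le> x + y" for x y
  proof -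
    have "\<bar>enn2ereal x - enn2ereal y\<bar> \<le> \<bar>enn2ereal x\<bar> + \<bar>- enn2ereal y\<bar>"
      unfolding minus_ereal_def by (rule ereal_abs_add)
    also have "\<dots> = enn2ereal (x + y)" by (simp add: plus_ennreal.rep_eq)
    finally show ?thesis using e2ennreal_mono e2ennreal_enn2ereal by metis
  qed
  then show ?case unfolding signed_def elim[symmetric] .
qed

lemma signed_cong:
  assumes [measurable]: "k \<in> borel_measurable M" "l \<in> borel_measurable M" and eq: "AE u in M. k u = l u"
  shows "AE u in M. signed k u = signed l u"
proof -
  have "AE u in M. P (\<lambda>v. e2ennreal (k v)) u = P (\<lambda>v. e2ennreal (l v)) u"
    "AE u in M. P (\<lambda>v. e2ennreal (- k v)) u = P (\<lambda>v. e2ennreal (- l v)) u"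
    by (intro P_cong; use eq in \<open>auto\<close>)+
  then show ?thesis by eventually_elim (simp add: signed_def)
qed

text \<open>
  The equation \<open>m = a x + b y\<close>, rearranged so that only nonnegative terms occur and an additive operator
  on nonnegative functions can be applied to it. For real \<open>z\<close>, \<open>ennreal z\<close> is the positive part.
\<close>

lemma parts_identity:
  fixes a b x y :: real
  defines "m \<equiv> a * x + b * y"
  shows "ennreal m + ennreal (- a) * ennreal x + ennreal a * ennreal (- x)
      + ennreal (- b) * ennreal y + ennreal b * ennreal (- y)
    = ennreal (- m) + ennreal a * ennreal x + ennreal (- a) * ennreal (- x)
      + ennreal b * ennreal y + ennreal (- b) * ennreal (- y)"
proof -
  define p where "p z = max 0 (z::real)" for z
  have e: "ennreal z = ennreal (p z)" "0 \<le> p z" "p z - p (- z) = z" for z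
    by (auto simp: p_def max_def ennreal_neg)
  have "p m + p (- a) * p x + p a * p (- x) + p (- b) * p y + p b * p (- y)
     = p (- m) + p a * p x + p (- a) * p (- x) + p b * p y + p (- b) * p (- y)
     \<longleftrightarrow> p m - p (- m) = (p a - p (- a)) * (p x - p (- x)) + (p b - p (- b)) * (p y - p (- y))"
    by (simp add: algebra_simps)
  then have "p m + p (- a) * p x + p a * p (- x) + p (- b) * p y + p b * p (- y)
     = p (- m) + p a * p x + p (- a) * p (- x) + p b * p y + p (- b) * p (- y)"
    unfolding e(3) m_def by simp
  then show ?thesis
    unfolding e(1)[of m] e(1)[of a] e(1)[of b] e(1)[of x] e(1)[of y]
      e(1)[of "- m"] e(1)[of "- a"] e(1)[of "- b"] e(1)[of "- x"] e(1)[of "- y"]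
    using e(2) by (simp add: ennreal_mult[symmetric] ennreal_plus[symmetric] del: ennreal_plus)
qed

lemma signed_dom_combination:
  assumes k: "k \<in> signed_dom" and l: "l \<in> signed_dom"
  shows "(\<lambda>v. ereal a * k v + ereal b * l v) \<in> signed_dom"
proof -
  have [measurable]: "k \<in> borel_measurable M" "l \<in> borel_measurable M" using k l by (auto simp: signed_dom_def)
  have fin: "AE u in M. \<bar>k u\<bar> \<noteq> \<infinity>" "AE u in M. \<bar>l u\<bar> \<noteq> \<infinity>" using k l by (auto simp: signed_dom_def)
  let ?m = "\<lambda>v. ereal a * k v + ereal b * l v"
  have "AE u in M. \<bar>?m u\<bar> \<noteq> \<infinity>"
    using fin by eventually_elim auto
  moreover have "AE u in M. e2ennreal \<bar>?m u\<bar> \<le> 0 + ennreal \<bar>a\<bar> * e2ennreal \<bar>k u\<bar> + ennreal \<bar>b\<bar> * e2ennreal \<bar>l u\<bar>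
      + ennreal 0 * 0 + ennreal 0 * 0"
    using fin
  proof eventually_elim
    case (elim u)
    then obtain x y where xy: "k u = ereal x" "l u = ereal y" by (cases "k u"; cases "l u") auto
    have "ennreal \<bar>a * x + b * y\<bar> \<le> ennreal (\<bar>a\<bar> * \<bar>x\<bar> + \<bar>b\<bar> * \<bar>y\<bar>)"
      by (intro ennreal_leI) (metis abs_mult abs_triangle_ineq)
    then show ?case by (simp add: xy e2ennreal_ereal ennreal_mult)
  qed
  then have "AE u in M. P (\<lambda>v. e2ennreal \<bar>?m v\<bar>) u \<le> P (\<lambda>v. 0 + ennreal \<bar>a\<bar> * e2ennreal \<bar>k v\<bar> + ennreal \<bar>b\<bar> * e2ennreal \<bar>l v\<bar>
      + ennreal 0 * 0 + ennreal 0 * 0) u"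
    by (intro P_mono) auto
  moreover have "AE u in M. P (\<lambda>v. 0 + ennreal \<bar>a\<bar> * e2ennreal \<bar>k v\<bar> + ennreal \<bar>b\<bar> * e2ennreal \<bar>l v\<bar>
      + ennreal 0 * 0 + ennreal 0 * 0) u = P (\<lambda>v. 0) u + ennreal \<bar>a\<bar> * P (\<lambda>v. e2ennreal \<bar>k v\<bar>) u
      + ennreal \<bar>b\<bar> * P (\<lambda>v. e2ennreal \<bar>l v\<bar>) u + ennreal 0 * P (\<lambda>v. 0) u + ennreal 0 * P (\<lambda>v. 0) u"
    by (intro P_combination) auto
  moreover have "AE u in M. P (\<lambda>v. 0) u = 0"
    using P_cmult[of "\<lambda>v. 0" 0] by simp
  moreover have "AE u in M. P (\<lambda>v. e2ennreal \<bar>k v\<bar>) u < top" "AE u in M. P (\<lambda>v. e2ennreal \<bar>l v\<bar>) u < top"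
    using k l by (auto simp: signed_dom_def)
  ultimately have "AE u in M. \<bar>?m u\<bar> \<noteq> \<infinity>" "AE u in M. P (\<lambda>v. e2ennreal \<bar>?m v\<bar>) u < top"
    by (eventually_elim, simp, eventually_elim, auto simp: ennreal_mult_less_top intro: le_less_trans)
  then show ?thesis by (simp add: signed_dom_def)
qed

lemma signed_linear:
  assumes k: "k \<in> signed_dom" and l: "l \<in> signed_dom"
  shows "AE u in M. signed (\<lambda>v. ereal a * k v + ereal b * l v) u = ereal a * signed k u + ereal b * signed l u"
proof -
  let ?m = "\<lambda>v. ereal a * k v + ereal b * l v"
  let ?p = "\<lambda>k v. e2ennreal (k v :: ereal)" and ?n = "\<lambda>k v. e2ennreal (- k v :: ereal)"
  have [measurable]: "k \<in> borel_measurable M" "l \<in> borel_measurable M" using k l by (auto simp: signed_dom_def)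
  have fin: "AE u in M. \<bar>k u\<bar> \<noteq> \<infinity>" "AE u in M. \<bar>l u\<bar> \<noteq> \<infinity>" using k l by (auto simp: signed_dom_def)
  have m: "?m \<in> signed_dom" by (rule signed_dom_combination[OF k l])
  have "AE u in M. P (\<lambda>v. ?p ?m v + ennreal (- a) * ?p k v + ennreal a * ?n k v + ennreal (- b) * ?p l v + ennreal b * ?n l v) u
     = P (\<lambda>v. ?n ?m v + ennreal a * ?p k v + ennreal (- a) * ?n k v + ennreal b * ?p l v + ennreal (- b) * ?n l v) u"
  proof (rule P_cong)
    show "AE v in M. ?p ?m v + ennreal (- a) * ?p k v + ennreal a * ?n k v + ennreal (- b) * ?p l v + ennreal b * ?n l v
      = ?n ?m v + ennreal a * ?p k v + ennreal (- a) * ?n k v + ennreal b * ?p l v + ennreal (- b) * ?n l v"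
      using fin
    proof eventually_elim
      case (elim v)
      then obtain x y where xy: "k v = ereal x" "l v = ereal y" by (cases "k v"; cases "l v") auto
      show ?case using parts_identity[of a x b y] by (simp add: xy e2ennreal_ereal)
    qed
  qed measurable
  moreover have "AE u in M. P (\<lambda>v. ?p ?m v + ennreal (- a) * ?p k v + ennreal a * ?n k v + ennreal (- b) * ?p l v + ennreal b * ?n l v) u
    = P (?p ?m) u + ennreal (- a) * P (?p k) u + ennreal a * P (?n k) u + ennreal (- b) * P (?p l) u + ennreal b * P (?n l) u"
    by (rule P_combination) measurable
  moreover have "AE u in M. P (\<lambda>v. ?n ?m v + ennreal a * ?p k v + ennreal (- a) * ?n k v + ennreal b * ?p l v + ennreal (- b) * ?n l v) u
    = P (?n ?m) u + ennreal a * P (?p k) u + ennreal (- a) * P (?n k) u + ennreal b * P (?p l) u + ennreal (- b) * P (?n l) u"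
    by (rule P_combination) measurable
  ultimately show ?thesis using signed_dom_parts[OF m] signed_dom_parts[OF k] signed_dom_parts[OF l]
  proof eventually_elim
    case (elim u)
    have real: "\<exists>r\<ge>0. x = ennreal r" if "x < top" for x
      using that by (cases x) auto
    obtain pm nm where m: "P (?p ?m) u = ennreal pm" "0 \<le> pm" "P (?n ?m) u = ennreal nm" "0 \<le> nm"
      using elim(4)[THEN conjunct1, THEN real] elim(4)[THEN conjunct2, THEN real] by (elim exE conjE) (rule that)
    obtain pk nk where k: "P (?p k) u = ennreal pk" "0 \<le> pk" "P (?n k) u = ennreal nk" "0 \<le> nk"
      using elim(5)[THEN conjunct1, THEN real] elim(5)[THEN conjunct2, THEN real] by (elim exE conjE) (rule that)
    obtain pl nl where l: "P (?p l) u = ennreal pl" "0 \<le> pl" "P (?n l) u = ennreal nl" "0 \<le> nl"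
      using elim(6)[THEN conjunct1, THEN real] elim(6)[THEN conjunct2, THEN real] by (elim exE conjE) (rule that)
    note r = m(1,3) k(1,3) l(1,3) and nn = m(2,4) k(2,4) l(2,4)
    define p where "p z = max 0 (z::real)" for z
    have e: "ennreal z = ennreal (p z)" "0 \<le> p z" "p z - p (- z) = z" for z
      by (auto simp: p_def max_def ennreal_neg)
    have "ennreal pm + ennreal (- a) * ennreal pk + ennreal a * ennreal nk + ennreal (- b) * ennreal pl + ennreal b * ennreal nl
      = ennreal nm + ennreal a * ennreal pk + ennreal (- a) * ennreal nk + ennreal b * ennreal pl + ennreal (- b) * ennreal nl"
      using elim(1-3) unfolding r by simp
    then have "ennreal (pm + p (- a) * pk + p a * nk + p (- b) * pl + p b * nl)
      = ennreal (nm + p a * pk + p (- a) * nk + p b * pl + p (- b) * nl)"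
      unfolding e(1)[of a] e(1)[of b] e(1)[of "- a"] e(1)[of "- b"]
      using nn e(2) by (simp add: ennreal_mult[symmetric] ennreal_plus[symmetric] del: ennreal_plus)
    then have "pm + p (- a) * pk + p a * nk + p (- b) * pl + p b * nl
      = nm + p a * pk + p (- a) * nk + p b * pl + p (- b) * nl"
      by (subst (asm) ennreal_inj) (use nn e(2) in \<open>auto intro!: add_nonneg_nonneg mult_nonneg_nonneg\<close>)
    then have "pm - nm = (p a - p (- a)) * (pk - nk) + (p b - p (- b)) * (pl - nl)"
      by (simp add: algebra_simps)
    then have "pm - nm = a * (pk - nk) + b * (pl - nl)" unfolding e(3) .
    then show ?case unfolding signed_def r using nn by simp
  qed
qed

end

lemma (in positive_operator) signed_dom_cong:
  assumes k: "k \<in> signed_dom" and l [measurable]: "l \<in> borel_measurable M" and eq: "AE u in M. k u = l u"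
  shows "l \<in> signed_dom"
proof -
  have [measurable]: "k \<in> borel_measurable M" using k by (simp add: signed_dom_def)
  have "AE u in M. e2ennreal \<bar>k u\<bar> = e2ennreal \<bar>l u\<bar>" using eq by eventually_elim simp
  then have "AE u in M. P (\<lambda>v. e2ennreal \<bar>k v\<bar>) u = P (\<lambda>v. e2ennreal \<bar>l v\<bar>) u" by (intro P_cong) auto
  moreover have "AE u in M. P (\<lambda>v. e2ennreal \<bar>k v\<bar>) u < top" "AE u in M. \<bar>k u\<bar> \<noteq> \<infinity>"
    using k by (auto simp: signed_dom_def)
  ultimately have "AE u in M. P (\<lambda>v. e2ennreal \<bar>l v\<bar>) u < top" "AE u in M. \<bar>l u\<bar> \<noteq> \<infinity>"
    using eq by (eventually_elim, simp)+
  then show ?thesis by (simp add: signed_dom_def)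
qed

section \<open>The Calderon property\<close>

context sigma_finite_measure
begin

lemma AE_eq_set_nn_integralI:
  assumes [measurable]: "h \<in> borel_measurable M" "k \<in> borel_measurable M"
    and "\<And>E. E \<in> sets M \<Longrightarrow> (\<integral>\<^sup>+u\<in>E. h u \<partial>M) = (\<integral>\<^sup>+u\<in>E. k u \<partial>M)"
  shows "AE u in M. h u = k u"
  by (rule density_unique) (auto intro!: measure_eqI simp: emeasure_density assms(3))

definition transport_density :: "(('a \<Rightarrow> ennreal) \<Rightarrow> 'a set \<Rightarrow> ennreal) \<Rightarrow> ('a \<Rightarrow> ennreal) \<Rightarrow> 'a \<Rightarrow> ennreal" where
  "transport_density \<Lambda> h = RN_deriv M (sigma_part M (\<Lambda> h))"

lemma measurable_transport_density [measurable]: "transport_density \<Lambda> h \<in> borel_measurable M"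
  by (simp add: transport_density_def)

lemma set_nn_integral_transport_density:
  assumes T: "transport M \<Lambda>" and h: "h \<in> borel_measurable M" and E: "E \<in> sets M"
  shows "(\<integral>\<^sup>+u\<in>E. transport_density \<Lambda> h u \<partial>M) = emeasure (sigma_part M (\<Lambda> h)) E"
proof -
  have "absolutely_continuous M (sigma_part M (\<Lambda> h))"
    unfolding absolutely_continuous_def
  proof
    fix D assume D: "D \<in> null_sets M"
    then have "emeasure (sigma_part M (\<Lambda> h)) D \<le> \<Lambda> h D"
      by (intro emeasure_sigma_part_le transportD(1)[OF T h]) auto
    then show "D \<in> null_sets (sigma_part M (\<Lambda> h))"
      using D transportD(2)[OF T h D] by (auto simp: null_sets_def)
  qed
  then have "density M (transport_density \<Lambda> h) = sigma_part M (\<Lambda> h)"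
    unfolding transport_density_def by (simp add: density_RN_deriv)
  then show ?thesis using E by (simp add: emeasure_density flip: \<open>density M _ = _\<close>)
qed

lemma set_nn_integral_transport_density_le:
  assumes T: "transport M \<Lambda>" and h: "h \<in> borel_measurable M" and E: "E \<in> sets M"
  shows "(\<integral>\<^sup>+u\<in>E. transport_density \<Lambda> h u \<partial>M) \<le> \<Lambda> h E"
  unfolding set_nn_integral_transport_density[OF assms]
  by (rule emeasure_sigma_part_le[OF transportD(1)[OF T h] E])

lemma positive_operator_transport_density:
  assumes T: "transport M \<Lambda>"
  shows "positive_operator M (transport_density \<Lambda>)"
proof
  note int = set_nn_integral_transport_density[OF T]
  show "transport_density \<Lambda> h \<in> borel_measurable M" for h by measurable
  show "AE u in M. transport_density \<Lambda> (\<lambda>v. h v + k v) u = transport_density \<Lambda> h u + transport_density \<Lambda> k u"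
    if [measurable]: "h \<in> borel_measurable M" "k \<in> borel_measurable M" for h k
  proof (rule AE_eq_set_nn_integralI)
    fix E assume E [measurable]: "E \<in> sets M"
    have "(\<integral>\<^sup>+u\<in>E. transport_density \<Lambda> (\<lambda>v. h v + k v) u \<partial>M) = emeasure (sigma_part M (\<lambda>E. \<Lambda> h E + \<Lambda> k E)) E"
      by (subst int) (auto intro!: arg_cong2[where f=emeasure] sigma_part_cong transportD(4)[OF T])
    also have "\<dots> = emeasure (sigma_part M (\<Lambda> h)) E + emeasure (sigma_part M (\<Lambda> k)) E"
      by (rule emeasure_sigma_part_add) (auto intro!: transportD(1)[OF T])
    also have "\<dots> = (\<integral>\<^sup>+u\<in>E. transport_density \<Lambda> h u + transport_density \<Lambda> k u \<partial>M)"
      by (simp add: int[symmetric] distrib_right nn_integral_add)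
    finally show "(\<integral>\<^sup>+u\<in>E. transport_density \<Lambda> (\<lambda>v. h v + k v) u \<partial>M)
      = (\<integral>\<^sup>+u\<in>E. transport_density \<Lambda> h u + transport_density \<Lambda> k u \<partial>M)" .
  qed measurable
  show "AE u in M. transport_density \<Lambda> (\<lambda>v. ennreal c * h v) u = ennreal c * transport_density \<Lambda> h u"
    if [measurable]: "h \<in> borel_measurable M" for h c
  proof (rule AE_eq_set_nn_integralI)
    fix E assume E [measurable]: "E \<in> sets M"
    have "(\<integral>\<^sup>+u\<in>E. transport_density \<Lambda> (\<lambda>v. ennreal c * h v) u \<partial>M) = emeasure (sigma_part M (\<lambda>E. ennreal c * \<Lambda> h E)) E"
      by (subst int) (auto intro!: arg_cong2[where f=emeasure] sigma_part_cong transportD(5)[OF T])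
    also have "\<dots> = ennreal c * emeasure (sigma_part M (\<Lambda> h)) E"
      by (rule emeasure_sigma_part_cmult) (auto intro!: transportD(1)[OF T])
    also have "\<dots> = (\<integral>\<^sup>+u\<in>E. ennreal c * transport_density \<Lambda> h u \<partial>M)"
      by (simp add: int[symmetric] mult.assoc nn_integral_cmult)
    finally show "(\<integral>\<^sup>+u\<in>E. transport_density \<Lambda> (\<lambda>v. ennreal c * h v) u \<partial>M)
      = (\<integral>\<^sup>+u\<in>E. ennreal c * transport_density \<Lambda> h u \<partial>M)" .
  qed measurable
  show "AE u in M. transport_density \<Lambda> h u = transport_density \<Lambda> k u"
    if hk: "h \<in> borel_measurable M" "k \<in> borel_measurable M" "AE u in M. h u = k u" for h k
  proof -
    have "sigma_part M (\<Lambda> h) = sigma_part M (\<Lambda> k)"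
      by (rule sigma_part_cong) (rule transportD(6)[OF T hk(1,2) _ hk(3)])
    then show ?thesis by (simp add: transport_density_def)
  qed
qed

end

context full_core_space
begin

lemma L1_AE_finite:
  assumes "k \<in> fst (L1 M)"
  shows "AE u in M. \<bar>k u\<bar> \<noteq> \<infinity>"
proof -
  have [measurable]: "k \<in> borel_measurable M" using assms by (simp add: L1_def)
  have "AE u in M. e2ennreal \<bar>k u\<bar> \<noteq> \<infinity>"
    using assms by (intro nn_integral_PInf_AE) (auto simp: L1_def L1_norm_def)
  then show ?thesis by eventually_elim (auto simp: e2ennreal_infty)
qed

text \<open>
  The factors \<open>sgn g\<close> and \<open>sgn f\<close> do not change norms. They turn an operator that takes \<open>\<bar>g\<bar>\<close> to
  \<open>\<bar>f\<bar>\<close> into one that takes \<open>g\<close> to \<open>f\<close>.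
\<close>

lemma admissible_contraction_of_transport:
  assumes fg: "f \<in> sum_space M (L1 M) (Linf_down M \<A>)" "g \<in> sum_space M (L1 M) (Linf_down M \<A>)"
    and T: "transport M \<Lambda>"
    and bound: "\<And>A h C. A \<in> \<A> \<Longrightarrow> h \<in> borel_measurable M \<Longrightarrow>
       (\<forall>B\<in>\<A>. (\<integral>\<^sup>+u\<in>B. h u \<partial>M) \<le> C * emeasure M B) \<Longrightarrow> \<Lambda> h A \<le> C * emeasure M A"
    and image: "\<And>A E. A \<in> \<A> \<Longrightarrow> E \<in> sets M \<Longrightarrow> E \<subseteq> A \<Longrightarrow>
       \<Lambda> (\<lambda>u. e2ennreal \<bar>g u\<bar>) E = (\<integral>\<^sup>+u\<in>E. e2ennreal \<bar>f u\<bar> \<partial>M)"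
  shows "\<exists>S. admissible_contraction M (L1 M) (Linf_down M \<A>) S \<and> (AE u in M. S g u = f u)"
proof -
  note fm [measurable] = sum_space_properties(1)[OF fg(1)]
  note gm [measurable] = sum_space_properties(1)[OF fg(2)]
  define P where "P = transport_density \<Lambda>"
  interpret positive_operator M P
    unfolding P_def by (rule positive_operator_transport_density[OF T])
  define \<sigma> where "\<sigma> k v = ereal_sign (g v) * k v" for k v
  define S where "S k u = ereal_sign (f u) * signed (\<sigma> k) u" for k u
  have \<sigma>m [measurable]: "\<sigma> k \<in> borel_measurable M" if "k \<in> borel_measurable M" for k
    unfolding \<sigma>_def[abs_def] using that by measurable
  have Sm: "S k \<in> borel_measurable M" if [measurable]: "k \<in> borel_measurable M" for k
    unfolding S_def[abs_def] by measurable
  have absS: "AE u in M. e2ennreal \<bar>S k u\<bar> \<le> P (\<lambda>v. e2ennreal \<bar>k v\<bar>) u" if "k \<in> borel_measurable M" for k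
    using abs_signed_le[OF \<sigma>m[OF that]] by (simp add: S_def \<sigma>_def)
  have core_le: "(\<integral>\<^sup>+u\<in>A. P (\<lambda>v. e2ennreal \<bar>k v\<bar>) u \<partial>M) \<le> Linf_down_norm M \<A> k * emeasure M A"
    if [measurable]: "k \<in> borel_measurable M" and A: "A \<in> \<A>" for k A
  proof -
    have "(\<integral>\<^sup>+u\<in>A. P (\<lambda>v. e2ennreal \<bar>k v\<bar>) u \<partial>M) \<le> \<Lambda> (\<lambda>v. e2ennreal \<bar>k v\<bar>) A"
      unfolding P_def by (rule set_nn_integral_transport_density_le[OF T _ core_sets[OF A]]) measurable
    also have "\<dots> \<le> Linf_down_norm M \<A> k * emeasure M A"
      by (rule bound[OF A]) (auto intro: core_integral_le_norm)
    finally show ?thesis .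
  qed
  have total_le: "(\<integral>\<^sup>+u. P (\<lambda>v. e2ennreal \<bar>k v\<bar>) u \<partial>M) \<le> L1_norm M k"
    if [measurable]: "k \<in> borel_measurable M" for k
  proof -
    have "(\<integral>\<^sup>+u. P (\<lambda>v. e2ennreal \<bar>k v\<bar>) u \<partial>M) = (\<integral>\<^sup>+u\<in>space M. P (\<lambda>v. e2ennreal \<bar>k v\<bar>) u \<partial>M)"
      by (intro nn_integral_cong) auto
    also have "\<dots> \<le> \<Lambda> (\<lambda>v. e2ennreal \<bar>k v\<bar>) (space M)"
      unfolding P_def by (rule set_nn_integral_transport_density_le[OF T]) measurable
    also have "\<dots> \<le> L1_norm M k"
      unfolding L1_norm_def by (rule transportD(3)[OF T]) measurable
    finally show ?thesis .
  qed
  have S_L1: "S k \<in> fst (L1 M) \<and> L1_norm M (S k) \<le> L1_norm M k" if k: "k \<in> fst (L1 M)" for k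
  proof -
    have km: "k \<in> borel_measurable M" and fin: "L1_norm M k < top" using k by (auto simp: L1_def)
    have "L1_norm M (S k) \<le> (\<integral>\<^sup>+u. P (\<lambda>v. e2ennreal \<bar>k v\<bar>) u \<partial>M)"
      unfolding L1_norm_def by (intro nn_integral_mono_AE absS km)
    also note total_le[OF km]
    finally show ?thesis using fin Sm[OF km] by (auto simp: L1_def intro: le_less_trans)
  qed
  have S_Linf: "S k \<in> fst (Linf_down M \<A>) \<and> Linf_down_norm M \<A> (S k) \<le> Linf_down_norm M \<A> k"
    if k: "k \<in> fst (Linf_down M \<A>)" for k
  proof -
    have km: "k \<in> borel_measurable M" and fin: "Linf_down_norm M \<A> k < top" using k by (auto simp: Linf_down_def)
    have "Linf_down_norm M \<A> (S k) \<le> Linf_down_norm M \<A> k"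
    proof (rule Linf_down_norm_leI[OF Sm[OF km]])
      fix A assume A: "A \<in> \<A>"
      have "(\<integral>\<^sup>+u\<in>A. e2ennreal \<bar>S k u\<bar> \<partial>M) \<le> (\<integral>\<^sup>+u\<in>A. P (\<lambda>v. e2ennreal \<bar>k v\<bar>) u \<partial>M)"
      proof (rule nn_integral_mono_AE)
        show "AE u in M. e2ennreal \<bar>S k u\<bar> * indicator A u \<le> P (\<lambda>v. e2ennreal \<bar>k v\<bar>) u * indicator A u"
          using absS[OF km] by eventually_elim (rule mult_right_mono; simp)
      qed
      also note core_le[OF km A]
      finally show "(\<integral>\<^sup>+u\<in>A. e2ennreal \<bar>S k u\<bar> \<partial>M) \<le> Linf_down_norm M \<A> k * emeasure M A" .
    qed
    then show ?thesis using fin Sm[OF km] by (auto simp: Linf_down_def intro: le_less_trans)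
  qed
  have dom_L1: "\<sigma> k \<in> signed_dom" if k: "k \<in> fst (L1 M)" for k
  proof -
    have km [measurable]: "k \<in> borel_measurable M" and fin: "L1_norm M k < top" using k by (auto simp: L1_def)
    have "AE u in M. P (\<lambda>v. e2ennreal \<bar>k v\<bar>) u \<noteq> \<infinity>"
      using le_less_trans[OF total_le[OF km] fin] by (intro nn_integral_PInf_AE) (auto simp: less_top)
    then show ?thesis using L1_AE_finite[OF k] by (simp add: signed_dom_def \<sigma>m) (simp add: \<sigma>_def less_top)
  qed
  have dom_Linf: "\<sigma> k \<in> signed_dom" if k: "k \<in> fst (Linf_down M \<A>)" for k
  proof -
    have km [measurable]: "k \<in> borel_measurable M" and fin: "Linf_down_norm M \<A> k < top"
      using k by (auto simp: Linf_down_def)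
    have "AE u in M. P (\<lambda>v. e2ennreal \<bar>k v\<bar>) u \<noteq> \<infinity>"
    proof (rule AE_core)
      fix A assume A: "A \<in> \<A>"
      then have [measurable]: "A \<in> sets M" by auto
      have "(\<integral>\<^sup>+u\<in>A. P (\<lambda>v. e2ennreal \<bar>k v\<bar>) u \<partial>M) < top"
        by (rule le_less_trans[OF core_le[OF km A]])
          (simp add: ennreal_mult_less_top fin core_emeasure_finite[OF A])
      then have "AE u in M. P (\<lambda>v. e2ennreal \<bar>k v\<bar>) u * indicator A u \<noteq> \<infinity>"
        by (intro nn_integral_PInf_AE) (auto simp: less_top)
      then show "AE u in M. u \<in> A \<longrightarrow> P (\<lambda>v. e2ennreal \<bar>k v\<bar>) u \<noteq> \<infinity>" by eventually_elim auto
    qed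
    then show ?thesis using Linf_down_AE_finite[OF full_core k]
      by (simp add: signed_dom_def \<sigma>m) (simp add: \<sigma>_def less_top)
  qed
  have S_lin: "AE u in M. S (\<lambda>v. ereal a * k v + ereal b * l v) u = ereal a * S k u + ereal b * S l u"
    and dom_lin: "\<sigma> (\<lambda>v. ereal a * k v + ereal b * l v) \<in> signed_dom"
    if km [measurable]: "k \<in> borel_measurable M" "l \<in> borel_measurable M" and dom: "\<sigma> k \<in> signed_dom" "\<sigma> l \<in> signed_dom" for k l a b
  proof -
    have "AE u in M. \<bar>\<sigma> k u\<bar> \<noteq> \<infinity>" "AE u in M. \<bar>\<sigma> l u\<bar> \<noteq> \<infinity>" using dom by (auto simp: signed_dom_def)
    then have eq: "AE u in M. ereal a * \<sigma> k u + ereal b * \<sigma> l u = \<sigma> (\<lambda>v. ereal a * k v + ereal b * l v) u"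
    proof eventually_elim
      case (elim u)
      then have "\<bar>k u\<bar> \<noteq> \<infinity>" "\<bar>l u\<bar> \<noteq> \<infinity>" by (auto simp: \<sigma>_def)
      then show ?case by (cases "k u"; cases "l u") (auto simp: \<sigma>_def ereal_sign_def)
    qed
    have m1: "(\<lambda>v. ereal a * \<sigma> k v + ereal b * \<sigma> l v) \<in> borel_measurable M"
      and m2: "\<sigma> (\<lambda>v. ereal a * k v + ereal b * l v) \<in> borel_measurable M" by measurable
    show "\<sigma> (\<lambda>v. ereal a * k v + ereal b * l v) \<in> signed_dom"
      by (rule signed_dom_cong[OF signed_dom_combination[OF dom] m2 eq])
    show "AE u in M. S (\<lambda>v. ereal a * k v + ereal b * l v) u = ereal a * S k u + ereal b * S l u"
      using signed_cong[OF m1 m2 eq] signed_linear[OF dom, of a b] signed_finite[OF dom(1)] signed_finite[OF dom(2)]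
    proof eventually_elim
      case (elim u)
      have "S (\<lambda>v. ereal a * k v + ereal b * l v) u = ereal_sign (f u) * (ereal a * signed (\<sigma> k) u + ereal b * signed (\<sigma> l) u)"
        using elim(1,2) by (simp add: S_def)
      also have "\<dots> = ereal a * S k u + ereal b * S l u"
        using elim(3,4) by (cases "signed (\<sigma> k) u"; cases "signed (\<sigma> l) u") (auto simp: S_def ereal_sign_def)
      finally show ?case .
    qed
  qed
  have S_cong: "AE u in M. S k u = S l u"
    if [measurable]: "k \<in> borel_measurable M" "l \<in> borel_measurable M" and eq: "AE u in M. k u = l u" for k l
  proof -
    have "AE u in M. \<sigma> k u = \<sigma> l u" using eq by eventually_elim (simp add: \<sigma>_def)
    then have "AE u in M. signed (\<sigma> k) u = signed (\<sigma> l) u" by (intro signed_cong \<sigma>m) auto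
    then show ?thesis by eventually_elim (simp add: S_def)
  qed
  have sum: "\<sigma> k \<in> signed_dom \<and> S k \<in> sum_space M (L1 M) (Linf_down M \<A>)"
    if k: "k \<in> sum_space M (L1 M) (Linf_down M \<A>)" for k
  proof -
    have km [measurable]: "k \<in> borel_measurable M" using k by (simp add: sum_space_def)
    obtain k\<^sub>0 k\<^sub>1 where k01: "k\<^sub>0 \<in> fst (L1 M)" "k\<^sub>1 \<in> fst (Linf_down M \<A>)" and eq: "AE u in M. k\<^sub>0 u + k\<^sub>1 u = k u"
      using k by (auto simp: sum_space_def)
    have [measurable]: "k\<^sub>0 \<in> borel_measurable M" "k\<^sub>1 \<in> borel_measurable M"
      using k01 by (auto simp: L1_def Linf_down_def)
    let ?l = "\<lambda>v. ereal 1 * k\<^sub>0 v + ereal 1 * k\<^sub>1 v"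
    have eq': "AE u in M. ?l u = k u" using eq by (simp add: one_ereal_def[symmetric])
    have "AE u in M. \<sigma> ?l u = \<sigma> k u" using eq' by eventually_elim (simp only: \<sigma>_def)
    then have dom: "\<sigma> k \<in> signed_dom"
      using dom_lin[of k\<^sub>0 k\<^sub>1 1 1] dom_L1[OF k01(1)] dom_Linf[OF k01(2)]
      by (intro signed_dom_cong[of "\<sigma> ?l" "\<sigma> k"] \<sigma>m km) auto
    have "AE u in M. S ?l u = S k u" by (rule S_cong[OF _ km eq']) measurable
    moreover have "AE u in M. S ?l u = ereal 1 * S k\<^sub>0 u + ereal 1 * S k\<^sub>1 u"
      by (rule S_lin) (auto intro: dom_L1 dom_Linf k01)
    ultimately have "AE u in M. S k\<^sub>0 u + S k\<^sub>1 u = S k u"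
      by eventually_elim (simp add: one_ereal_def[symmetric])
    then show ?thesis
      using dom Sm[OF km] S_L1[OF k01(1)] S_Linf[OF k01(2)] unfolding sum_space_def by blast
  qed
  have "linear_on_sum_space M (L1 M) (Linf_down M \<A>) S"
    unfolding linear_on_sum_space_def
  proof (intro conjI ballI allI impI)
    show "S ` sum_space M (L1 M) (Linf_down M \<A>) \<subseteq> sum_space M (L1 M) (Linf_down M \<A>)"
      using sum by blast
  next
    fix k l assume kl: "k \<in> sum_space M (L1 M) (Linf_down M \<A>)" "l \<in> sum_space M (L1 M) (Linf_down M \<A>)"
    note km = sum_space_properties(1)[OF kl(1)] sum_space_properties(1)[OF kl(2)]
    show "AE u in M. S k u = S l u" if "AE u in M. k u = l u"
      by (rule S_cong[OF km that])
    show "AE u in M. S (\<lambda>v. ereal a * k v + ereal b * l v) u = ereal a * S k u + ereal b * S l u" for a b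
      using S_lin[OF km] sum kl by blast
  qed
  moreover have "contraction_on (L1 M) S"
    using S_L1 by (simp add: contraction_on_def) (simp add: L1_def)
  moreover have "contraction_on (Linf_down M \<A>) S"
    using S_Linf by (simp add: contraction_on_def) (simp add: Linf_down_def)
  moreover have "AE u in M. S g u = f u"
  proof -
    have Pg: "AE u in M. P (\<lambda>v. e2ennreal \<bar>g v\<bar>) u = e2ennreal \<bar>f u\<bar>"
    proof (rule AE_core)
      fix A assume A: "A \<in> \<A>"
      then have [measurable]: "A \<in> sets M" by auto
      have "AE u in M. P (\<lambda>v. e2ennreal \<bar>g v\<bar>) u * indicator A u = e2ennreal \<bar>f u\<bar> * indicator A u"
      proof (rule AE_eq_set_nn_integralI)
        fix E assume E [measurable]: "E \<in> sets M"
        have restr: "(\<integral>\<^sup>+u\<in>E. h u * indicator A u \<partial>M) = (\<integral>\<^sup>+u\<in>E \<inter> A. h u \<partial>M)" for h :: "'a \<Rightarrow> ennreal"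
          by (intro nn_integral_cong) (auto simp: indicator_def)
        have "(\<integral>\<^sup>+u\<in>E \<inter> A. P (\<lambda>v. e2ennreal \<bar>g v\<bar>) u \<partial>M)
            = emeasure (sigma_part M (\<Lambda> (\<lambda>v. e2ennreal \<bar>g v\<bar>))) (E \<inter> A)"
          unfolding P_def by (rule set_nn_integral_transport_density[OF T]) measurable
        also have "\<dots> = emeasure (density M (\<lambda>u. e2ennreal \<bar>f u\<bar>)) (E \<inter> A)"
        proof (rule emeasure_sigma_part_eq)
          show "content M (\<Lambda> (\<lambda>v. e2ennreal \<bar>g v\<bar>))" by (rule transportD(1)[OF T]) measurable
          fix D assume D: "D \<in> sets M" "D \<subseteq> E \<inter> A"
          then show "\<Lambda> (\<lambda>v. e2ennreal \<bar>g v\<bar>) D = emeasure (density M (\<lambda>u. e2ennreal \<bar>f u\<bar>)) D"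
            using image[OF A, of D] by (simp add: emeasure_density)
        qed auto
        also have "\<dots> = (\<integral>\<^sup>+u\<in>E \<inter> A. e2ennreal \<bar>f u\<bar> \<partial>M)" by (simp add: emeasure_density)
        finally show "(\<integral>\<^sup>+u\<in>E. P (\<lambda>v. e2ennreal \<bar>g v\<bar>) u * indicator A u \<partial>M)
            = (\<integral>\<^sup>+u\<in>E. e2ennreal \<bar>f u\<bar> * indicator A u \<partial>M)"
          unfolding restr .
      qed measurable
      then show "AE u in M. u \<in> A \<longrightarrow> P (\<lambda>v. e2ennreal \<bar>g v\<bar>) u = e2ennreal \<bar>f u\<bar>"
        by eventually_elim auto
    qed
    have "AE u in M. P (\<lambda>v. 0) u = 0" using P_cmult[of "\<lambda>v. 0" 0] by simp
    with Pg show ?thesis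
    proof eventually_elim
      case (elim u)
      have "signed (\<sigma> g) u = \<bar>f u\<bar>"
        using elim by (simp add: signed_def \<sigma>_def e2ennreal_neg enn2ereal_e2ennreal zero_ennreal.rep_eq)
      then show ?case by (simp add: S_def)
    qed
  qed
  ultimately show ?thesis unfolding admissible_contraction_def by blast
qed

end

theorem theorem8p6:
  fixes M :: "'a measure" and \<A> :: "'a set set"
  assumes "sigma_finite_measure M" and "full_core M \<A>"
  shows "exact_calderon_couple M (L1 M) (Linf_down M \<A>)"
proof -
  interpret sigma_finite_measure M by (rule assms(1))
  interpret full_core_space M \<A> by unfold_locales (rule assms(2))
  show ?thesis
    unfolding exact_calderon_couple_def
  proof (intro ballI impI)
    fix f g assume f: "f \<in> sum_space M (L1 M) (Linf_down M \<A>)" and g: "g \<in> sum_space M (L1 M) (Linf_down M \<A>)"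
      and K: "\<forall>t>0. K_core f t \<le> K_core g t"
    note fp = sum_space_properties[OF f] and gp = sum_space_properties[OF g]
    have m: "(\<lambda>u. e2ennreal \<bar>f u\<bar>) \<in> borel_measurable M" "(\<lambda>u. e2ennreal \<bar>g u\<bar>) \<in> borel_measurable M"
      using fp(1) gp(1) by measurable
    have "\<exists>\<Lambda>. transport M \<Lambda> \<and>
      (\<forall>A\<in>\<A>. \<forall>h\<in>borel_measurable M. \<forall>C.
        (\<forall>B\<in>\<A>. (\<integral>\<^sup>+u\<in>B. h u \<partial>M) \<le> C * emeasure M B) \<longrightarrow> \<Lambda> h A \<le> C * emeasure M A) \<and>
      (\<forall>A\<in>\<A>. \<forall>E\<in>sets M. E \<subseteq> A \<longrightarrow> \<Lambda> (\<lambda>u. e2ennreal \<bar>g u\<bar>) E = (\<integral>\<^sup>+u\<in>E. e2ennreal \<bar>f u\<bar> \<partial>M))"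
      by (rule exact_transport[OF m fp(2) gp(2) K_le_imp_majorants[OF fp(1) gp(1,3) K]])
    then obtain \<Lambda> where T: "transport M \<Lambda>"
      and bound: "\<forall>A\<in>\<A>. \<forall>h\<in>borel_measurable M. \<forall>C.
        (\<forall>B\<in>\<A>. (\<integral>\<^sup>+u\<in>B. h u \<partial>M) \<le> C * emeasure M B) \<longrightarrow> \<Lambda> h A \<le> C * emeasure M A"
      and image: "\<forall>A\<in>\<A>. \<forall>E\<in>sets M. E \<subseteq> A \<longrightarrow> \<Lambda> (\<lambda>u. e2ennreal \<bar>g u\<bar>) E = (\<integral>\<^sup>+u\<in>E. e2ennreal \<bar>f u\<bar> \<partial>M)"
      by (elim exE conjE) (rule that)
    show "\<exists>S. admissible_contraction M (L1 M) (Linf_down M \<A>) S \<and> (AE u in M. S g u = f u)"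
      by (rule admissible_contraction_of_transport[OF f g T]) (use bound image in blast)+
  qed
qed

end
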